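(* Let $k$ be an algebraically closed field of characteristic $0$ and let $f=f(x_1,x_2,x_3)\in k[x_1,x_2,x_3]$ be a nondegenerate ternary cubic form. Then there are exactly $72$ equivalence classes of irreducible $3$-dimensional representations of the generalized Clifford algebra $C_f$.
   Context: The form $f$ is nondegenerate if the cubic surface in $\mathbb{P}^3=\mathrm{Proj}\,k[w,x_1,x_2,x_3]$ given by $w^3=f(x_1,x_2,x_3)$ is nonsingular. The generalized Clifford algebra $C_f$ is the quotient of the free associative $k$-algebra $k\{y_1,y_2,y_3\}$ by the two-sided ideal generated by all elements $(\alpha_1y_1+\alpha_2y_2+\alpha_3y_3)^3-f(\alpha_1,\alpha_2,\alpha_3)$ with $\alpha_1,\alpha_2,\alpha_3\in k$. A representation of dimension $m$ is a $k$-algebra homomorphism $\phi:C_f\to\mathrm{Mat}_m(k)$; equivalently, it is a triple of matrices $A_i=\phi(y_i)$ with $(x_1A_1+x_2A_2+x_3A_3)^3=f(x_1,x_2,x_3)\cdot I_m$ in $\mathrm{Mat}_m(k[x_1,x_2,x_3])$. Two $m$-dimensional representations $\phi_1,\phi_2$ are equivalent if $\phi_1=\theta\phi_2\theta^{-1}$ for some invertible $\theta\in\mathrm{Mat}_m(k)$. A representation is irreducible if the image of $C_f$ generates $\mathrm{Mat}_m(k)$ as a $k$-algebra. *)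

theory Defs
  imports
    "HOL-Library.Poly_Mapping"
    "HOL-Library.Numeral_Type"
    "HOL-Computational_Algebra.Polynomial"
    "HOL-Algebra.Algebraic_Closure_Type"
    "HOL-Algebra.QuotRing"
    "HOL-Algebra.Subrings"
    "Jordan_Normal_Form.Matrix"
begin

section \<open>Polynomials in several variables\<close>

text \<open>The polynomial ring over \<open>'k\<close> in the variables \<open>'v\<close> is the monoid algebra of the free
  commutative monoid \<open>'v \<Rightarrow>\<^sub>0 nat\<close> of exponent vectors; \<^typ>\<open>'v \<Rightarrow>\<^sub>0 nat\<close> is written additively, and
  the product on \<^typ>\<open>'a \<Rightarrow>\<^sub>0 'b\<close> is convolution.\<close>

type_synonym ('v, 'k) mpoly = "('v \<Rightarrow>\<^sub>0 nat) \<Rightarrow>\<^sub>0 'k"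

definition mpoly_const :: "'k::zero \<Rightarrow> ('v, 'k) mpoly"
  where "mpoly_const c = Poly_Mapping.single 0 c"

definition mpoly_var :: "'v \<Rightarrow> ('v, 'k::zero_neq_one) mpoly"
  where "mpoly_var v = Poly_Mapping.single (Poly_Mapping.single v 1) 1"

text \<open>The homomorphism to a commutative ring that is \<open>h\<close> on coefficients and sends the variable \<open>v\<close>
  to \<open>a v\<close>. It serves both for evaluation at a point and for substitution of polynomials.\<close>

definition mpoly_hom ::
    "('k::zero \<Rightarrow> 'r::comm_semiring_1) \<Rightarrow> ('v \<Rightarrow> 'r) \<Rightarrow> ('v, 'k) mpoly \<Rightarrow> 'r"
  where "mpoly_hom h a p =
    (\<Sum>m\<in>Poly_Mapping.keys p.
       h (Poly_Mapping.lookup p m) *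
       (\<Prod>v\<in>Poly_Mapping.keys m. a v ^ Poly_Mapping.lookup m v))"

definition mpoly_eval :: "('v, 'k::comm_semiring_1) mpoly \<Rightarrow> ('v \<Rightarrow> 'k) \<Rightarrow> 'k"
  where "mpoly_eval p a = mpoly_hom id a p"

definition mpoly_deriv :: "'v \<Rightarrow> ('v, 'k::comm_semiring_1) mpoly \<Rightarrow> ('v, 'k) mpoly"
  where "mpoly_deriv v p =
    (\<Sum>m\<in>Poly_Mapping.keys p.
       Poly_Mapping.single (m - Poly_Mapping.single v 1)
         (of_nat (Poly_Mapping.lookup m v) * Poly_Mapping.lookup p m))"

text \<open>As usual, the zero polynomial is a form of every degree.\<close>

definition form_of_degree :: "nat \<Rightarrow> ('v, 'k::zero) mpoly \<Rightarrow> bool"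
  where "form_of_degree d p \<longleftrightarrow>
    (\<forall>m\<in>Poly_Mapping.keys p. (\<Sum>v\<in>Poly_Mapping.keys m. Poly_Mapping.lookup m v) = d)"


section \<open>Nondegenerate ternary cubic forms\<close>

text \<open>The projective hypersurface \<open>F = 0\<close> over an algebraically closed field, with a homogeneous
  equation \<open>F\<close>, is nonsingular if it satisfies the Jacobian criterion at each of its points, given
  by nonzero vectors of homogeneous coordinates.\<close>

definition nonsingular_hypersurface :: "('v::finite, 'k::alg_closed_field) mpoly \<Rightarrow> bool"
  where "nonsingular_hypersurface F \<longleftrightarrow>
    (\<forall>P. (\<exists>v. P v \<noteq> 0) \<and> mpoly_eval F P = 0 \<longrightarrow> (\<exists>v. mpoly_eval (mpoly_deriv v F) P \<noteq> 0))"

text \<open>The three variables of a ternary form are indexed by the three-element type \<^typ>\<open>3\<close>. The ring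
  \<open>k[w,x\<^sub>1,x\<^sub>2,x\<^sub>3]\<close> has the variables \<^typ>\<open>3 option\<close>, where \<^term>\<open>None\<close> stands for \<open>w\<close> and
  \<^term>\<open>Some i\<close> for \<open>x\<^sub>i\<close>.\<close>

definition cubic_surface :: "(3, 'k::comm_ring_1) mpoly \<Rightarrow> (3 option, 'k) mpoly"
  where "cubic_surface f = mpoly_var None ^ 3 - mpoly_hom mpoly_const (\<lambda>i. mpoly_var (Some i)) f"

definition nondegenerate :: "(3, 'k::alg_closed_field) mpoly \<Rightarrow> bool"
  where "nondegenerate f \<longleftrightarrow> nonsingular_hypersurface (cubic_surface f)"


section \<open>The generalized Clifford algebra\<close>

text \<open>The free monoid on \<open>'v\<close>, written additively as \<^theory>\<open>HOL-Library.Poly_Mapping\<close> requires of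
  index monoids. The free associative algebra on \<open>'v\<close> is the monoid algebra of this monoid.\<close>

datatype 'v free_mon = Letters "'v list"

instantiation free_mon :: (type) monoid_add
begin

definition zero_free_mon :: "'a free_mon"
  where "0 = Letters []"

fun plus_free_mon :: "'a free_mon \<Rightarrow> 'a free_mon \<Rightarrow> 'a free_mon"
  where "Letters u + Letters v = Letters (u @ v)"

instance
proof
  fix a b c :: "'a free_mon"
  show "a + b + c = a + (b + c)"
    by (cases a; cases b; cases c) simp
  show "0 + a = a" and "a + 0 = a"
    by (cases a; simp add: zero_free_mon_def)+
qed

end

type_synonym ('v, 'k) free_alg = "'v free_mon \<Rightarrow>\<^sub>0 'k"

definition fa_const :: "'k::zero \<Rightarrow> ('v, 'k) free_alg"
  where "fa_const c = Poly_Mapping.single 0 c"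

definition fa_gen :: "'v \<Rightarrow> ('v, 'k::zero_neq_one) free_alg"
  where "fa_gen v = Poly_Mapping.single (Letters [v]) 1"

abbreviation free_alg_ring :: "('v, 'k::ring_1) free_alg ring"
  where "free_alg_ring \<equiv> ring_of_type_algebra"

definition clifford_relations :: "(3, 'k::comm_ring_1) mpoly \<Rightarrow> (3, 'k) free_alg set"
  where "clifford_relations f =
    {(\<Sum>i\<in>UNIV. fa_const (\<alpha> i) * fa_gen i) ^ 3 - fa_const (mpoly_eval f \<alpha>) | \<alpha>. True}"

text \<open>In HOL-Algebra, \<^const>\<open>genideal\<close> is the two-sided ideal generated by a set.\<close>

definition clifford_ideal :: "(3, 'k::comm_ring_1) mpoly \<Rightarrow> (3, 'k) free_alg set"
  where "clifford_ideal f = genideal free_alg_ring (clifford_relations f)"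

definition clifford_algebra :: "(3, 'k::comm_ring_1) mpoly \<Rightarrow> (3, 'k) free_alg set ring"
  where "clifford_algebra f = free_alg_ring Quot clifford_ideal f"

text \<open>\<open>clifford_algebra f\<close> carries only the ring structure. Its scalar multiplication is
  multiplication by the residue classes of the constants.\<close>

definition clifford_smult ::
    "(3, 'k::comm_ring_1) mpoly \<Rightarrow> 'k \<Rightarrow> (3, 'k) free_alg set \<Rightarrow> (3, 'k) free_alg set"
  where "clifford_smult f c x =
    (clifford_ideal f +>\<^bsub>free_alg_ring\<^esub> fa_const c) \<otimes>\<^bsub>clifford_algebra f\<^esub> x"


section \<open>Representations\<close>

abbreviation Mat :: "nat \<Rightarrow> 'k::comm_ring_1 mat ring"
  where "Mat m \<equiv> ring_mat TYPE('k) m ()"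

text \<open>Homomorphisms of HOL-Algebra are unconstrained outside the carrier of their domain. Below,
  \<open>clifford_rep_equiv\<close> looks at the values on the carrier only, so that functions representing the
  same homomorphism are identified in the set of equivalence classes.\<close>

definition clifford_rep ::
    "(3, 'k::comm_ring_1) mpoly \<Rightarrow> nat \<Rightarrow> ((3, 'k) free_alg set \<Rightarrow> 'k mat) set"
  where "clifford_rep f m =
    {\<rho> \<in> Ring.ring_hom (clifford_algebra f) (Mat m).
       \<forall>c. \<forall>x\<in>carrier (clifford_algebra f). \<rho> (clifford_smult f c x) = c \<cdot>\<^sub>m \<rho> x}"

definition mat_subalgebra :: "nat \<Rightarrow> 'k::comm_ring_1 mat set \<Rightarrow> bool"
  where "mat_subalgebra m S \<longleftrightarrow> subring S (Mat m) \<and> (\<forall>c. \<forall>A\<in>S. c \<cdot>\<^sub>m A \<in> S)"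

definition mat_algebra_generated :: "nat \<Rightarrow> 'k::comm_ring_1 mat set \<Rightarrow> 'k mat set"
  where "mat_algebra_generated m A = \<Inter>{S. mat_subalgebra m S \<and> A \<subseteq> S}"

definition irreducible_clifford_rep ::
    "(3, 'k::comm_ring_1) mpoly \<Rightarrow> nat \<Rightarrow> ((3, 'k) free_alg set \<Rightarrow> 'k mat) set"
  where "irreducible_clifford_rep f m =
    {\<rho> \<in> clifford_rep f m.
       mat_algebra_generated m (\<rho> ` carrier (clifford_algebra f)) = carrier_mat m m}"

text \<open>The witnesses \<open>\<theta>\<close> and \<open>\<theta>'\<close> in \<^term>\<open>similar_mat_wit A B \<theta> \<theta>'\<close> are inverse to each other, with
  \<^term>\<open>A = \<theta> * B * \<theta>'\<close>.\<close>

definition clifford_rep_equiv ::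
    "(3, 'k::comm_ring_1) mpoly \<Rightarrow> nat \<Rightarrow>
      (((3, 'k) free_alg set \<Rightarrow> 'k mat) \<times> ((3, 'k) free_alg set \<Rightarrow> 'k mat)) set"
  where "clifford_rep_equiv f m =
    {(\<rho>\<^sub>1, \<rho>\<^sub>2). \<rho>\<^sub>1 \<in> clifford_rep f m \<and> \<rho>\<^sub>2 \<in> clifford_rep f m \<and>
       (\<exists>\<theta> \<theta>'. \<forall>x\<in>carrier (clifford_algebra f).
          similar_mat_wit (\<rho>\<^sub>1 x) (\<rho>\<^sub>2 x) \<theta> \<theta>')}"

end

theory Submission
  imports Defs
begin

text \<open>A representation is a triple of matrices with \<open>(x A + y B + z C)\<^sup>3 = f(x,y,z)\<close>. Its class up to
  conjugation is counted after a linear change of variables that brings \<open>f\<close> to Weierstrass form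
  \<open>x\<^sup>3 + a x z\<^sup>2 + b z\<^sup>3 - y\<^sup>2 z\<close>. As \<open>z = 0\<close> is then an inflection tangent, \<open>A\<close> can be diagonalized
  to \<open>diag(1, \<eta>, \<eta>\<^sup>2)\<close> with a primitive cube root of unity \<open>\<eta>\<close>, the matrices \<open>B\<close> and \<open>C\<close> get a zero
  diagonal, and \<open>B\<close> is nilpotent of rank two.

  Either all off-diagonal entries of \<open>B\<close> are nonzero. Then \<open>C\<close> amounts to square roots of
  \<open>c + t\<close>, \<open>c + \<eta> t\<close>, \<open>c + \<eta>\<^sup>2 t\<close> with a prescribed product, where \<open>t\<close> is fixed and \<open>c\<^sup>3\<close> is fixed and
  nonzero, and \<open>B\<close> is determined up to sign: \<open>3 \<cdot> 4 \<cdot> 2 = 24\<close> classes. Or \<open>B\<close> becomes strictly upper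
  triangular after one of the six reorderings of the eigenbasis of \<open>A\<close>. Then the class is given by an
  entry \<open>v\<close> of \<open>C\<close> whose square is, up to a sixth root of unity, the abscissa of a point of order 3 (so
  one of the four simple roots of a quartic) and by a second entry: \<open>6 \<cdot> 8 = 48\<close> classes. In the geometry of the cubic
  surface the two cases are the two positions of a six of disjoint lines relative to the three lines
  above the inflection tangent.\<close>

section \<open>Three by three matrices\<close>

text \<open>Why \<open>A\<close> has three distinct eigenvalues: \<open>A*A*A = 1\<close> makes it
  diagonalizable, and the relations linear in \<open>B\<close> or in \<open>C\<close> kill the
  diagonal blocks of \<open>B\<close> and \<open>C\<close>. With at most two eigenvalues,
  \<open>B\<close> and \<open>C\<close> would exchange two complementary eigenspaces, and
  \<open>B*B*C + B*C*B + C*B*B\<close> would do the same, so it could not be \<open>-1\<close>. With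
  three eigenvalues, only products of opposite entries and the two 3-cycles of entries enter the
  remaining relations, and diagonal conjugation suffices to normalize.

  The normal forms are chosen so that conjugate ones are equal; classes are then counted as
  parameter tuples. Once \<open>f\<close> is in Weierstrass form, nonsingularity enters only as
  \<open>4 * a^3 + 27 * b^2 \<noteq> 0\<close>: it makes \<open>c^3\<close> nonzero in the first
  case and the roots of the quartic simple in the second. Every normal form generates the full
  matrix algebra, so irreducibility is automatic and the count is one of all 3-dimensional
  representations.

  The change of variables needs an inflection point, which is found by explicit elimination starting
  from an arbitrary point of the cubic.\<close>

datatype 'k m3 = M3 (e11: 'k) (e12: 'k) (e13: 'k) (e21: 'k) (e22: 'k) (e23: 'k) (e31: 'k) (e32: 'k) (e33: 'k)

text \<open>As a type of class \<open>ring_1\<close>, matrices of this fixed size admit the class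
  lemmas and entrywise simplification without carrier conditions. The passage to
  \<open>carrier_mat 3 3\<close> is made only at the end.\<close>

instantiation m3 :: (comm_ring_1) ring_1
begin

definition zero_m3 :: "'a m3" where "0 = M3 0 0 0 0 0 0 0 0 0"
definition one_m3 :: "'a m3" where "1 = M3 1 0 0 0 1 0 0 0 1"

fun plus_m3 :: "'a m3 \<Rightarrow> 'a m3 \<Rightarrow> 'a m3" where
  "M3 a b c d e f g h i + M3 a' b' c' d' e' f' g' h' i' =
    M3 (a + a') (b + b') (c + c') (d + d') (e + e') (f + f') (g + g') (h + h') (i + i')"

fun minus_m3 :: "'a m3 \<Rightarrow> 'a m3 \<Rightarrow> 'a m3" where
  "M3 a b c d e f g h i - M3 a' b' c' d' e' f' g' h' i' =
    M3 (a - a') (b - b') (c - c') (d - d') (e - e') (f - f') (g - g') (h - h') (i - i')"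

fun uminus_m3 :: "'a m3 \<Rightarrow> 'a m3" where
  "- M3 a b c d e f g h i = M3 (-a) (-b) (-c) (-d) (-e) (-f) (-g) (-h) (-i)"

fun times_m3 :: "'a m3 \<Rightarrow> 'a m3 \<Rightarrow> 'a m3" where
  "M3 a b c d e f g h i * M3 a' b' c' d' e' f' g' h' i' =
    M3 (a * a' + b * d' + c * g') (a * b' + b * e' + c * h') (a * c' + b * f' + c * i')
       (d * a' + e * d' + f * g') (d * b' + e * e' + f * h') (d * c' + e * f' + f * i')
       (g * a' + h * d' + i * g') (g * b' + h * e' + i * h') (g * c' + h * f' + i * i')"

instance
proof
  fix x y z :: "'a m3"
  show "x + y + z = x + (y + z)" by (cases x; cases y; cases z) (simp add: add.assoc)
  show "x + y = y + x" by (cases x; cases y) (simp add: add.commute)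
  show "0 + x = x" "1 * x = x" "x * 1 = x" "- x + x = 0"
    by (cases x; simp add: zero_m3_def one_m3_def)+
  show "x - y = x + - y" by (cases x; cases y) simp
  show "x * y * z = x * (y * z)" by (cases x; cases y; cases z) (simp add: algebra_simps)
  show "(x + y) * z = x * z + y * z" "x * (y + z) = x * y + x * z"
    by (cases x; cases y; cases z; simp add: algebra_simps)+
  show "(0 :: 'a m3) \<noteq> 1" by (simp add: zero_m3_def one_m3_def)
qed

end

fun sm :: "'k::comm_ring_1 \<Rightarrow> 'k m3 \<Rightarrow> 'k m3" (infixr "*#" 75) where
  "s *# M3 a b c d e f g h i = M3 (s*a) (s*b) (s*c) (s*d) (s*e) (s*f) (s*g) (s*h) (s*i)"

lemma sm_simps:
  fixes M Y :: "'k::comm_ring_1 m3"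
  shows "(s + t) *# M = s *# M + t *# M" "s *# (M + Y) = s *# M + s *# Y"
    "(s - t) *# M = s *# M - t *# M" "s *# (M - Y) = s *# M - s *# Y"
    "(s *# M) * Y = s *# (M * Y)" "M * (s *# Y) = s *# (M * Y)" "s *# t *# M = (s * t) *# M"
    "s *# (- M) = - (s *# M)" "(- s) *# M = - (s *# M)"
  by (cases M; cases Y; simp add: algebra_simps)+

lemma sm_01 [simp]:
  fixes M :: "'k::comm_ring_1 m3"
  shows "0 *# M = 0" "1 *# M = M" "s *# (0 :: 'k m3) = 0"
  by (cases M; simp add: zero_m3_def)+

lemma sm_eq_0: "s *# M = 0 \<longleftrightarrow> s = 0 \<or> M = 0" for M :: "'k::field m3"
  by (cases M) (auto simp: zero_m3_def)

definition diag3 :: "'k::zero \<Rightarrow> 'k \<Rightarrow> 'k \<Rightarrow> 'k m3"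
  where "diag3 p q r = M3 p 0 0 0 q 0 0 0 r"

type_synonym 'k triple = "'k m3 \<times> 'k m3 \<times> 'k m3"

section \<open>Simultaneous conjugation of triples\<close>

definition conj3 :: "'k::comm_ring_1 triple \<Rightarrow> 'k triple \<Rightarrow> bool"
  where "conj3 S T \<longleftrightarrow> (\<exists>\<theta> \<theta>'. \<theta> * \<theta>' = 1 \<and> \<theta>' * \<theta> = 1 \<and>
    S = (\<theta> * fst T * \<theta>', \<theta> * fst (snd T) * \<theta>', \<theta> * snd (snd T) * \<theta>'))"

text \<open>The intertwining equations are linear in \<open>\<theta>\<close>, so they can be checked
  and exploited entry by entry without computing the inverse.\<close>

lemma conj3I:
  assumes "\<theta> * \<theta>' = 1" "\<theta>' * \<theta> = 1" "A * \<theta> = \<theta> * A'" "B * \<theta> = \<theta> * B'" "C * \<theta> = \<theta> * C'"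
  shows "conj3 (A, B, C) (A', B', C')"
proof -
  have "M = \<theta> * M' * \<theta>'" if "M * \<theta> = \<theta> * M'" for M M'
    using assms(1) that by (metis mult.assoc mult.right_neutral)
  with assms show ?thesis unfolding conj3_def by auto
qed

lemma conj3E:
  assumes "conj3 (A, B, C) (A', B', C')"
  obtains \<theta> \<theta>' where "\<theta> * \<theta>' = 1" "\<theta>' * \<theta> = 1" "A * \<theta> = \<theta> * A'" "B * \<theta> = \<theta> * B'" "C * \<theta> = \<theta> * C'"
proof -
  obtain \<theta> \<theta>' where *: "\<theta> * \<theta>' = 1" "\<theta>' * \<theta> = 1" "A = \<theta> * A' * \<theta>'" "B = \<theta> * B' * \<theta>'"
    "C = \<theta> * C' * \<theta>'"
    using assms unfolding conj3_def by auto
  show thesis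
    by (rule that[of \<theta> \<theta>']) (simp_all add: * mult.assoc)
qed

lemma conj3_refl: "conj3 S S"
  unfolding conj3_def by (intro exI[of _ 1]) simp

lemma conj3_sym: assumes "conj3 S T" shows "conj3 T S"
proof -
  obtain A B C A' B' C' where [simp]: "S = (A, B, C)" "T = (A', B', C')" by (metis prod_cases3)
  obtain \<theta> \<theta>' where *: "\<theta> * \<theta>' = 1" "\<theta>' * \<theta> = 1" "A * \<theta> = \<theta> * A'" "B * \<theta> = \<theta> * B'" "C * \<theta> = \<theta> * C'"
    using assms conj3E unfolding \<open>S = _\<close> \<open>T = _\<close> by metis
  have **: "N' * \<theta>' = \<theta>' * N" if "N * \<theta> = \<theta> * N'" for N N'
  proof -
    have "\<theta>' * N = \<theta>' * (N * \<theta>) * \<theta>'" by (simp add: mult.assoc *(1))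
    also have "\<dots> = N' * \<theta>'" by (simp only: that) (simp add: *(2) flip: mult.assoc)
    finally show ?thesis by simp
  qed
  show ?thesis
    unfolding \<open>S = _\<close> \<open>T = _\<close> using * ** by (intro conj3I[of \<theta>' \<theta>]) auto
qed

lemma conj3_trans: assumes "conj3 S T" "conj3 T U" shows "conj3 S U"
proof -
  obtain \<theta> \<theta>' where 1: "\<theta> * \<theta>' = 1" "\<theta>' * \<theta> = 1"
    "S = (\<theta> * fst T * \<theta>', \<theta> * fst (snd T) * \<theta>', \<theta> * snd (snd T) * \<theta>')"
    using assms(1) unfolding conj3_def by blast
  obtain \<eta> \<eta>' where 2: "\<eta> * \<eta>' = 1" "\<eta>' * \<eta> = 1"
    "T = (\<eta> * fst U * \<eta>', \<eta> * fst (snd U) * \<eta>', \<eta> * snd (snd U) * \<eta>')"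
    using assms(2) unfolding conj3_def by blast
  have "(\<theta> * \<eta>) * (\<eta>' * \<theta>') = 1" "(\<eta>' * \<theta>') * (\<theta> * \<eta>) = 1"
    using 1(1,2) 2(1,2) by (metis mult.assoc mult_1_left)+
  with 1(3) 2(3) show ?thesis
    unfolding conj3_def by (intro exI[of _ "\<theta> * \<eta>"] exI[of _ "\<eta>' * \<theta>'"]) (simp add: mult.assoc)
qed

text \<open>Kernel vectors are encoded as nonzero matrices \<open>V\<close> with
  \<open>\<theta> * V = 0\<close>. If the determinant vanishes, the adjugate is such a
  \<open>V\<close> unless it is zero too.\<close>

lemma m3_inverse_or_kernel:
  fixes \<theta> :: "'k::field m3"
  obtains \<theta>' where "\<theta> * \<theta>' = 1" "\<theta>' * \<theta> = 1" | V where "V \<noteq> 0" "\<theta> * V = 0"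
proof -
  obtain a b c d e f g h i where \<theta>: "\<theta> = M3 a b c d e f g h i" by (cases \<theta>)
  define adj where "adj = M3 (e*i - f*h) (c*h - b*i) (b*f - c*e) (f*g - d*i) (a*i - c*g) (c*d - a*f)
    (d*h - e*g) (b*g - a*h) (a*e - b*d)"
  define D where "D = a * (e*i - f*h) + b * (f*g - d*i) + c * (d*h - e*g)"
  have adj: "\<theta> * adj = D *# 1" "adj * \<theta> = D *# 1"
    unfolding \<theta> adj_def D_def one_m3_def by (simp_all add: algebra_simps)
  consider "D \<noteq> 0" | "D = 0" "adj \<noteq> 0" | "adj = 0" by blast
  then show thesis
  proof cases
    case 1
    show thesis
      by (rule that(1)[of "inverse D *# adj"]) (use 1 in \<open>simp_all add: sm_simps adj\<close>)
  next
    case 2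
    then show thesis using that(2)[of adj] adj by simp
  next
    case 3
    \<comment> \<open>With vanishing 2x2 minors the first two columns of \<open>\<theta>\<close> are
      dependent. The witnesses below carry the coefficients of a dependence in their first
      column.\<close>
    then have m: "a * e = b * d" "b * g = a * h" "d * h = e * g"
      by (simp_all add: adj_def zero_m3_def)
    consider "a = 0" "d = 0" "g = 0" | "a \<noteq> 0" | "d \<noteq> 0" | "g \<noteq> 0" by blast
    then show thesis
    proof cases
      case 1
      show thesis
        by (rule that(2)[of "M3 1 0 0 0 0 0 0 0 0"]) (simp_all add: \<theta> 1 zero_m3_def)
    next
      case 2
      show thesis
        by (rule that(2)[of "M3 (-b) 0 0 a 0 0 0 0 0"])
          (use 2 m in \<open>simp_all add: \<theta> zero_m3_def algebra_simps\<close>)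
    next
      case 3
      show thesis
        by (rule that(2)[of "M3 (-e) 0 0 d 0 0 0 0 0"])
          (use 3 m in \<open>simp_all add: \<theta> zero_m3_def algebra_simps\<close>)
    next
      case 4
      show thesis
        by (rule that(2)[of "M3 (-h) 0 0 g 0 0 0 0 0"])
          (use 4 m in \<open>simp_all add: \<theta> zero_m3_def algebra_simps\<close>)
    qed
  qed
qed

section \<open>Cubic identities\<close>

text \<open>The defining relations of the Clifford algebra are indexed by points, so the identity is
  required at all points and \<open>F\<close> is merely a function. Linear changes of variables are
  then compositions.\<close>

definition triples :: "('k::comm_ring_1 \<Rightarrow> 'k \<Rightarrow> 'k \<Rightarrow> 'k) \<Rightarrow> 'k triple set"
  where "triples F = {(A, B, C). \<forall>x y z. (x *# A + y *# B + z *# C) ^ 3 = F x y z *# 1}"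

lemma conj3_triples:
  assumes "conj3 S T" "T \<in> triples F"
  shows "S \<in> triples F"
proof -
  obtain A B C A' B' C' where [simp]: "S = (A, B, C)" "T = (A', B', C')" by (metis prod_cases3)
  obtain \<theta> \<theta>' where *: "\<theta> * \<theta>' = 1" "\<theta>' * \<theta> = 1" "A = \<theta> * A' * \<theta>'" "B = \<theta> * B' * \<theta>'"
    "C = \<theta> * C' * \<theta>'"
    using assms unfolding conj3_def by auto
  have "(x *# A + y *# B + z *# C) ^ 3 = F x y z *# 1" for x y z
  proof -
    let ?N = "x *# A' + y *# B' + z *# C'"
    have "x *# A + y *# B + z *# C = \<theta> * ?N * \<theta>'"
      by (simp only: *(3-5) sm_simps(5,6) distrib_left distrib_right)
    moreover have "(\<theta> * ?N * \<theta>') ^ 3 = \<theta> * ?N ^ 3 * \<theta>'"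
    proof -
      have "\<theta>' * (\<theta> * N) = N" for N using *(2) by (simp flip: mult.assoc)
      then show ?thesis by (simp add: power3_eq_cube mult.assoc)
    qed
    moreover have "?N ^ 3 = F x y z *# 1"
      using assms(2) by (auto simp: triples_def)
    ultimately show ?thesis using *(1) by (simp add: sm_simps)
  qed
  then show ?thesis by (simp add: triples_def)
qed

text \<open>Evaluation at points with coordinates in {0, 1, -1} separates the ten coefficients as
  soon as 2 is invertible.\<close>

lemma ternary_cubic_eq_0:
  fixes c :: "'k::field_char_0"
  assumes "\<And>x y z. c1 * x^3 + c2 * y^3 + c3 * z^3 + c4 * (x^2*y) + c5 * (x*y^2) + c6 * (x^2*z)
    + c7 * (x*z^2) + c8 * (y^2*z) + c9 * (y*z^2) + c * (x*y*z) = 0"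
  shows "c1 = 0" "c2 = 0" "c3 = 0" "c4 = 0" "c5 = 0" "c6 = 0" "c7 = 0" "c8 = 0" "c9 = 0" "c = 0"
proof -
  show 1: "c1 = 0" "c2 = 0" "c3 = 0"
    using assms[of 1 0 0] assms[of 0 1 0] assms[of 0 0 1] by auto
  have two: "u = 0 \<and> v = 0" if "u + v = 0" "v - u = 0" for u v :: 'k
  proof -
    have "2 * v = 0" using that by (simp add: algebra_simps mult_2 eq_neg_iff_add_eq_0)
    then show ?thesis using that by simp
  qed
  have "c4 + c5 = 0" "c5 - c4 = 0" using assms[of 1 1 0] assms[of "-1" 1 0] assms[of 1 "-1" 0] 1
    by (auto simp: algebra_simps)
  then show 2: "c4 = 0" "c5 = 0" using two by blast+
  have "c6 + c7 = 0" "c7 - c6 = 0" using assms[of 1 0 1] assms[of 1 0 "-1"] 1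
    by (auto simp: algebra_simps)
  then show 3: "c6 = 0" "c7 = 0" using two by blast+
  have "c8 + c9 = 0" "c9 - c8 = 0" using assms[of 0 1 1] assms[of 0 1 "-1"] 1
    by (auto simp: algebra_simps)
  then show 4: "c8 = 0" "c9 = 0" using two by blast+
  show "c = 0" using assms[of 1 1 1] 1 2 3 4 by simp
qed

lemma entry_m3:
  fixes M N :: "'k::comm_ring_1 m3"
  assumes "h \<in> {e11, e12, e13, e21, e22, e23, e31, e32, e33}"
  shows "h (M + N) = h M + h N" "h (s *# M) = h M * s" "h (0 :: 'k m3) = 0"
proof -
  show "h (M + N) = h M + h N" using assms by (cases M; cases N) auto
  show "h (s *# M) = h M * s" using assms by (cases M) (auto simp: mult.commute)
  show "h (0 :: 'k m3) = 0" using assms by (auto simp: zero_m3_def)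
qed

lemma m3_eq_0I:
  fixes M :: "'k::comm_ring_1 m3"
  assumes "\<And>h. h \<in> {e11, e12, e13, e21, e22, e23, e31, e32, e33} \<Longrightarrow> h M = 0"
  shows "M = 0"
proof -
  have "e11 M = 0" "e12 M = 0" "e13 M = 0" "e21 M = 0" "e22 M = 0" "e23 M = 0" "e31 M = 0"
    "e32 M = 0" "e33 M = 0"
    by (rule assms, blast)+
  then show ?thesis by (cases M) (simp add: zero_m3_def)
qed

lemma ternary_cubic_m3_eq_0:
  fixes Y1 :: "'k::field_char_0 m3"
  assumes "\<And>x y z. (x^3) *# Y1 + (y^3) *# Y2 + (z^3) *# Y3 + (x^2*y) *# Y4 + (x*y^2) *# Y5 + (x^2*z) *# Y6
    + (x*z^2) *# Y7 + (y^2*z) *# Y8 + (y*z^2) *# Y9 + (x*y*z) *# Y0 = 0"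
  shows "Y1 = 0" "Y2 = 0" "Y3 = 0" "Y4 = 0" "Y5 = 0" "Y6 = 0" "Y7 = 0" "Y8 = 0" "Y9 = 0" "Y0 = 0"
proof -
  have *: "h Y1 * x^3 + h Y2 * y^3 + h Y3 * z^3 + h Y4 * (x^2*y) + h Y5 * (x*y^2) + h Y6 * (x^2*z)
      + h Y7 * (x*z^2) + h Y8 * (y^2*z) + h Y9 * (y*z^2) + h Y0 * (x*y*z) = 0"
    if h: "h \<in> {e11, e12, e13, e21, e22, e23, e31, e32, e33}" for h x y z
    using arg_cong[OF assms[of x y z], of h] by (simp only: entry_m3[OF h])
  note ** = ternary_cubic_eq_0[OF *]
  show "Y1 = 0" "Y2 = 0" "Y3 = 0" "Y4 = 0" "Y5 = 0" "Y6 = 0" "Y7 = 0" "Y8 = 0" "Y9 = 0" "Y0 = 0"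
    by - (rule m3_eq_0I, rule **, assumption)+
qed

definition weierstrass :: "'k::comm_ring_1 \<Rightarrow> 'k \<Rightarrow> 'k \<Rightarrow> 'k \<Rightarrow> 'k \<Rightarrow> 'k"
  where "weierstrass a b x y z = x^3 + a * (x * z^2) + b * z^3 - y^2 * z"

lemma cube_of_trinomial:
  fixes P Q R :: "'a::ring_1"
  shows "(P + Q + R) ^ 3 = P*P*P + Q*Q*Q + R*R*R + (P*P*Q + P*Q*P + Q*P*P) + (P*Q*Q + Q*P*Q + Q*Q*P) +
    (P*P*R + P*R*P + R*P*P) + (P*R*R + R*P*R + R*R*P) + (Q*Q*R + Q*R*Q + R*Q*Q) +
    (Q*R*R + R*Q*R + R*R*Q) + (P*Q*R + P*R*Q + Q*P*R + Q*R*P + R*P*Q + R*Q*P)"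
  unfolding power3_eq_cube by (simp only: distrib_left distrib_right mult.assoc add_ac)

lemma triples_weierstrass_iff:
  fixes A :: "'k::field_char_0 m3"
  shows "(A, B, C) \<in> triples (weierstrass a b) \<longleftrightarrow>
    A*A*A = 1 \<and> B*B*B = 0 \<and> C*C*C = b *# 1 \<and>
    A*A*B + A*B*A + B*A*A = 0 \<and> A*B*B + B*A*B + B*B*A = 0 \<and>
    A*A*C + A*C*A + C*A*A = 0 \<and> A*C*C + C*A*C + C*C*A = a *# 1 \<and>
    B*B*C + B*C*B + C*B*B = -1 \<and> B*C*C + C*B*C + C*C*B = 0 \<and>
    A*B*C + A*C*B + B*A*C + B*C*A + C*A*B + C*B*A = 0" (is "_ \<longleftrightarrow> ?R")
proof -
  let ?E = "\<lambda>x y z. (x^3) *# (A*A*A - 1) + (y^3) *# (B*B*B) + (z^3) *# (C*C*C - b *# 1) +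
    (x^2*y) *# (A*A*B + A*B*A + B*A*A) + (x*y^2) *# (A*B*B + B*A*B + B*B*A) +
    (x^2*z) *# (A*A*C + A*C*A + C*A*A) + (x*z^2) *# (A*C*C + C*A*C + C*C*A - a *# 1) +
    (y^2*z) *# (B*B*C + B*C*B + C*B*B + 1) + (y*z^2) *# (B*C*C + C*B*C + C*C*B) +
    (x*y*z) *# (A*B*C + A*C*B + B*A*C + B*C*A + C*A*B + C*B*A)"
  have eq: "(x *# A + y *# B + z *# C) ^ 3 - weierstrass a b x y z *# 1 = ?E x y z" for x y z
  proof -
    have 1: "(p *# P) * (q *# Q) * (r *# R) = (p * q * r) *# (P * Q * R)" for p q r and P Q R :: "'k m3"
      by (simp add: sm_simps mult_ac)
    have "(x *# A + y *# B + z *# C) ^ 3 = (x^3) *# (A*A*A) + (y^3) *# (B*B*B) + (z^3) *# (C*C*C) +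
      (x^2*y) *# (A*A*B + A*B*A + B*A*A) + (x*y^2) *# (A*B*B + B*A*B + B*B*A) +
      (x^2*z) *# (A*A*C + A*C*A + C*A*A) + (x*z^2) *# (A*C*C + C*A*C + C*C*A) +
      (y^2*z) *# (B*B*C + B*C*B + C*B*B) + (y*z^2) *# (B*C*C + C*B*C + C*C*B) +
      (x*y*z) *# (A*B*C + A*C*B + B*A*C + B*C*A + C*A*B + C*B*A)"
      unfolding cube_of_trinomial 1
      by (simp only: sm_simps(2) power3_eq_cube power2_eq_square mult_ac)
    moreover have "weierstrass a b x y z *# 1 = (x^3) *# 1 + (x * z^2) *# (a *# 1) + (z^3) *# (b *# 1)
      - (y^2 * z) *# (1 :: 'k m3)"
      by (simp add: weierstrass_def sm_simps mult_ac)
    moreover have "s1 + s2 + s3 + s4 + s5 + s6 + s7 + s8 + s9 + s0 - (t1 + t7 + t3 - t8) =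
      (s1 - t1) + s2 + (s3 - t3) + s4 + s5 + s6 + (s7 - t7) + (s8 + t8) + s9 + s0"
      for s1 s2 s3 s4 s5 s6 s7 s8 s9 s0 t1 t3 t7 t8 :: "'k m3"
      by (simp add: algebra_simps)
    moreover have "r *# (B*B*C + B*C*B + C*B*B + 1) = r *# (B*B*C + B*C*B + C*B*B) + r *# 1" for r
      by (rule sm_simps)
    ultimately show ?thesis by (simp only: sm_simps(4))
  qed
  have "(A, B, C) \<in> triples (weierstrass a b) \<longleftrightarrow> (\<forall>x y z. ?E x y z = 0)"
    unfolding eq[symmetric] by (simp add: triples_def)
  also have "\<dots> \<longleftrightarrow> ?R"
  proof
    assume "\<forall>x y z. ?E x y z = 0"
    then have "\<And>x y z. ?E x y z = 0" by blast
    from ternary_cubic_m3_eq_0[OF this] show ?R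
      unfolding right_minus_eq eq_neg_iff_add_eq_0 by (intro conjI)
  next
    assume ?R then show "\<forall>x y z. ?E x y z = 0" by simp
  qed
  finally show ?thesis .
qed

section \<open>Roots\<close>

text \<open>The multiset of linear factors has size \<open>degree p\<close>; since every root has
  order 1, it is the set of roots.\<close>

lemma card_roots_separable:
  fixes p :: "'k::{alg_closed_field, field_char_0} poly"
  assumes "p \<noteq> 0" "\<And>x. poly p x = 0 \<Longrightarrow> poly (pderiv p) x \<noteq> 0"
  shows "card {x. poly p x = 0} = degree p"
proof -
  obtain A where A: "size A = degree p" "p = smult (lead_coeff p) (\<Prod>x\<in>#A. [:-x, 1:])"
    using alg_closed_imp_factorization[OF assms(1)] by metis
  have "lead_coeff p \<noteq> 0" using assms(1) by simp
  have "(\<Sum>x\<in>#A. {#x#}) = A" by (induction A) auto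
  then have "proots p = A"
    using A(2) \<open>lead_coeff p \<noteq> 0\<close> proots_smult[of "lead_coeff p" "\<Prod>x\<in>#A. [:-x, 1:]"]
      proots_prod_mset[of "image_mset (\<lambda>x. [:-x, 1:]) A"]
    by (auto simp: image_mset.compositionality comp_def image_iff)
  have "rsquarefree p" using assms(2) by (auto simp: rsquarefree_roots)
  then have "order x p = (if poly p x = 0 then 1 else 0)" for x
    using assms(1) by (auto simp: rsquarefree_root_order order_0I)
  then have "proots p = mset_set {x. poly p x = 0}"
    using assms(1) by (intro multiset_eqI) (simp add: poly_roots_finite count_mset_set')
  then show ?thesis
    using A(1) \<open>proots p = A\<close> by simp
qed

lemma card_roots_of_power:
  fixes c :: "'k::{alg_closed_field, field_char_0}"
  assumes "c \<noteq> 0" "n > 0"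
  shows "card {x. x ^ n = c} = n"
proof -
  define p where "p = monom 1 n + [:-c:]"
  have p: "poly p x = x ^ n - c" for x by (simp add: p_def poly_monom)
  have deg: "degree p = n"
    using assms(2) unfolding p_def by (subst degree_add_eq_left) (simp_all add: degree_monom_eq)
  have "poly (pderiv p) x \<noteq> 0" if "poly p x = 0" for x
  proof -
    have "pderiv p = monom (of_nat n) (n - 1)"
      by (simp add: p_def pderiv_add pderiv_monom pderiv_pCons)
    then show ?thesis using that assms by (auto simp: p poly_monom power_0_left)
  qed
  then have "card {x. poly p x = 0} = degree p"
    using deg assms(2) by (intro card_roots_separable) auto
  then show ?thesis by (simp add: p deg)
qed

lemma quadratic_has_root:
  fixes p q :: "'k::alg_closed_field"
  obtains x where "x ^ 2 + p * x + q = 0"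
proof -
  have "degree [:q, p, 1:] > 0" by simp
  from alg_closed_imp_poly_has_root[OF this] obtain x where "poly [:q, p, 1:] x = 0" by blast
  then show thesis using that[of x] by (simp add: power2_eq_square algebra_simps)
qed

definition prim_cbrt :: "'k::comm_ring_1 \<Rightarrow> bool"
  where "prim_cbrt \<eta> \<longleftrightarrow> \<eta> * \<eta> + \<eta> + 1 = 0"

lemma prim_cbrt:
  fixes \<eta> :: "'k::field_char_0"
  assumes "prim_cbrt \<eta>"
  shows "\<eta> * \<eta> = - 1 - \<eta>" "\<eta> * (\<eta> * z) = - z - \<eta> * z" "\<eta> \<noteq> 0" "\<eta> \<noteq> 1" "\<eta> ^ 3 = 1"
    "\<eta> * \<eta> \<noteq> \<eta>" "\<eta> * \<eta> \<noteq> 1" "\<eta> \<noteq> - 1" "\<eta> * (\<eta> * \<eta>) = 1"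
proof -
  have *: "\<eta> * \<eta> + \<eta> + 1 = 0" using assms by (simp add: prim_cbrt_def)
  show 1: "\<eta> * \<eta> = - 1 - \<eta>" using * by Groebner_Basis.algebra
  show "\<eta> * (\<eta> * z) = - z - \<eta> * z" using * by Groebner_Basis.algebra
  show 0: "\<eta> \<noteq> 0" using * by auto
  show 3: "\<eta> \<noteq> 1"
  proof
    assume "\<eta> = 1"
    then have "(3 :: 'k) = 0" using * by simp
    then show False by simp
  qed
  show "\<eta> ^ 3 = 1" "\<eta> * (\<eta> * \<eta>) = 1" using * by Groebner_Basis.algebra+
  show "\<eta> * \<eta> \<noteq> \<eta>" using 0 3 by simp
  show 2: "\<eta> \<noteq> - 1" using * by auto
  show "\<eta> * \<eta> \<noteq> 1" using 2 3 by (metis mult_1_right square_eq_1_iff)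
qed

lemma prim_cbrt_exists: obtains \<eta> :: "'k::alg_closed_field" where "prim_cbrt \<eta>"
proof -
  obtain x :: 'k where "x ^ 2 + 1 * x + 1 = 0" by (rule quadratic_has_root)
  then show thesis using that by (simp add: prim_cbrt_def power2_eq_square)
qed

lemma card_prim_cbrt: "card {\<eta> :: 'k::{alg_closed_field, field_char_0}. prim_cbrt \<eta>} = 2"
proof -
  obtain \<eta> :: 'k where \<eta>: "prim_cbrt \<eta>" by (rule prim_cbrt_exists)
  have "{\<eta> :: 'k. prim_cbrt \<eta>} = {\<eta>, \<eta> * \<eta>}"
  proof (intro equalityI subsetI)
    fix x assume "x \<in> {\<eta> :: 'k. prim_cbrt \<eta>}"
    then have "(x - \<eta>) * (x - \<eta> * \<eta>) = 0"
      using \<eta> unfolding prim_cbrt_def mem_Collect_eq by Groebner_Basis.algebra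
    then show "x \<in> {\<eta>, \<eta> * \<eta>}" by auto
  next
    fix x assume "x \<in> {\<eta>, \<eta> * \<eta>}"
    then consider "x = \<eta>" | "x = \<eta> * \<eta>" by blast
    then show "x \<in> {\<eta> :: 'k. prim_cbrt \<eta>}"
    proof cases
      case 2
      then show ?thesis using \<eta> unfolding prim_cbrt_def mem_Collect_eq by Groebner_Basis.algebra
    qed (use \<eta> in simp)
  qed
  moreover have "\<eta> \<noteq> \<eta> * \<eta>" using prim_cbrt(6)[OF \<eta>] by metis
  ultimately show ?thesis by (simp only: card_2_iff) blast
qed

section \<open>Diagonalization of the first matrix\<close>

text \<open>\<open>E\<close> and \<open>F\<close> are complementary eigenprojections. Both
  \<open>B\<close> and \<open>C\<close> are odd for the grading they define, hence so is any product
  of three of them, whereas \<open>-1\<close> is even. One of \<open>E\<close>, \<open>F\<close> may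
  be zero, so a scalar \<open>A\<close> is covered as well.\<close>

lemma no_two_eigenspaces:
  fixes A :: "'k::field_char_0 m3"
  assumes E: "A * E = \<nu> *# E" "E * A = \<nu> *# E" and F: "A * F = \<kappa> *# F" "F * A = \<kappa> *# F"
    and "E + F = 1" "\<nu> \<noteq> \<kappa>" "\<nu> \<noteq> 0" "\<kappa> \<noteq> 0"
    and B: "A*A*B + A*B*A + B*A*A = 0" and C: "A*A*C + A*C*A + C*A*A = 0"
    and BC: "B*B*C + B*C*B + C*B*B = -1"
  shows False
proof -
  \<comment> \<open>Between two copies of the projection \<open>G\<close>, each of the three
    summands becomes \<open>l^2\<close> times \<open>G * M * G\<close>; the factor 3 is
    nonzero.\<close>
  have sand: "G * M * G = 0"
    if "A * G = l *# G" "G * A = l *# G" "l \<noteq> 0" "A*A*M + A*M*A + M*A*A = 0" for G M l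
  proof -
    have 1: "G * A * N = l *# (G * N)" "N * (A * G) = l *# (N * G)" for N
      using that(1,2) by (simp_all add: sm_simps)
    have "G * (A*A*M + A*M*A + M*A*A) * G = (G * A) * (A * M * G) + (G * A) * (M * (A * G)) + G * M * (A * (A * G))"
      by (simp only: distrib_left distrib_right mult.assoc)
    also have "G * A = l *# G" by (rule that)
    also have "(l *# G) * (A * M * G) = l *# ((G * A) * (M * G))" by (simp add: sm_simps mult.assoc)
    finally have "G * (A*A*M + A*M*A + M*A*A) * G = (3 * l^2) *# (G * M * G)"
      by (simp add: that(1,2) sm_simps mult.assoc power2_eq_square flip: sm_simps(1))
    with that(3,4) show ?thesis by (simp add: sm_eq_0)
  qed
  have F': "F = 1 - E" using \<open>E + F = 1\<close> by (simp add: algebra_simps)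
  have EF: "E * F = 0"
  proof -
    have "\<nu> *# (E * F) = \<kappa> *# (E * F)"
      using E(2) F(1) by (metis mult.assoc sm_simps(5,6))
    then have "(\<nu> - \<kappa>) *# (E * F) = 0" by (simp add: sm_simps)
    then show ?thesis using \<open>\<nu> \<noteq> \<kappa>\<close> by (simp add: sm_eq_0)
  qed
  have comm: "M * E = F * M" "E * M = M * F" if "A*A*M + A*M*A + M*A*A = 0" for M
  proof -
    have 1: "E * M * E = 0" using sand[OF E \<open>\<nu> \<noteq> 0\<close> that] .
    moreover have 2: "F * M * F = 0" using sand[OF F \<open>\<kappa> \<noteq> 0\<close> that] .
    ultimately have "M - M * E - E * M = 0" unfolding F' by (simp add: algebra_simps)
    then show "M * E = F * M" "E * M = M * F" unfolding F' by (simp_all add: algebra_simps)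
  qed
  have 3: "M1 * M2 * M3 * E = F * (M1 * M2 * M3)"
    if "M1 \<in> {B, C}" "M2 \<in> {B, C}" "M3 \<in> {B, C}" for M1 M2 M3
  proof -
    have *: "M * E = F * M" "E * M = M * F" if "M \<in> {B, C}" for M using comm B C that by blast+
    have "M1 * M2 * M3 * E = M1 * (M2 * F) * M3" by (simp add: mult.assoc *[OF that(3)])
    also have "\<dots> = (M1 * E) * M2 * M3" by (simp add: mult.assoc *(2)[OF that(2), symmetric])
    finally show ?thesis by (simp add: mult.assoc *[OF that(1)])
  qed
  have "(B*B*C + B*C*B + C*B*B) * E = F * (B*B*C + B*C*B + C*B*B)"
    unfolding distrib_left distrib_right by (simp only: 3 insert_iff simp_thms)
  then have "E = F" unfolding BC by simp
  have "F = (E + F) * F" using \<open>E + F = 1\<close> by simp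
  then have "F = 0" using EF \<open>E = F\<close> by (simp add: distrib_right)
  then show False using \<open>E = F\<close> \<open>E + F = 1\<close> by simp
qed

text \<open>Column vectors are represented by matrices with a single nonzero column.
  \<open>S1\<close>, \<open>S2\<close>, \<open>S3\<close> pick the same nonzero column of
  \<open>E\<close> and place it in position 1, 2 or 3.\<close>

lemma nonzero_column:
  fixes E :: "'k::field m3"
  assumes "E \<noteq> 0"
  obtains S1 S2 S3 where "S1 * diag3 1 0 0 = S1" "E * S1 \<noteq> 0" "S2 * diag3 0 1 0 = S2" "E * S2 \<noteq> 0"
    "S3 * diag3 0 0 1 = S3" "E * S3 \<noteq> 0"
proof -
  obtain a b c d e f g h i where E: "E = M3 a b c d e f g h i" by (cases E)
  with assms consider "(a, d, g) \<noteq> (0, 0, 0)" | "(b, e, h) \<noteq> (0, 0, 0)" | "(c, f, i) \<noteq> (0, 0, 0)"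
    by (auto simp: zero_m3_def)
  then show thesis
  proof cases
    case 1
    show thesis
      by (rule that[of "M3 1 0 0 0 0 0 0 0 0" "M3 0 1 0 0 0 0 0 0 0" "M3 0 0 1 0 0 0 0 0 0"])
        (use 1 in \<open>auto simp: E diag3_def zero_m3_def\<close>)
  next
    case 2
    show thesis
      by (rule that[of "M3 0 0 0 1 0 0 0 0 0" "M3 0 0 0 0 1 0 0 0 0" "M3 0 0 0 0 0 1 0 0 0"])
        (use 2 in \<open>auto simp: E diag3_def zero_m3_def\<close>)
  next
    case 3
    show thesis
      by (rule that[of "M3 0 0 0 0 0 0 1 0 0" "M3 0 0 0 0 0 0 0 1 0" "M3 0 0 0 0 0 0 0 0 1"])
        (use 3 in \<open>auto simp: E diag3_def zero_m3_def\<close>)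
  qed
qed

text \<open>If only column \<open>i\<close> of \<open>U\<close> is nonzero, then
  \<open>U * V\<close> is the outer product of that column with row \<open>i\<close> of
  \<open>V\<close>.\<close>

lemma column_times_eq_0:
  fixes U V :: "'k::field m3"
  assumes "U \<noteq> 0" "U * V = 0"
  shows "U * diag3 1 0 0 = U \<Longrightarrow> e11 V = 0 \<and> e12 V = 0 \<and> e13 V = 0"
    and "U * diag3 0 1 0 = U \<Longrightarrow> e21 V = 0 \<and> e22 V = 0 \<and> e23 V = 0"
    and "U * diag3 0 0 1 = U \<Longrightarrow> e31 V = 0 \<and> e32 V = 0 \<and> e33 V = 0"
  using assms by (cases U; cases V; auto simp: diag3_def zero_m3_def)+

lemma diagonalize:
  fixes A :: "'k::field_char_0 m3"
  assumes \<eta>: "prim_cbrt \<eta>" and A3: "A*A*A = 1"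
    and B: "A*A*B + A*B*A + B*A*A = 0" and C: "A*A*C + A*C*A + C*A*A = 0"
    and BC: "B*B*C + B*C*B + C*B*B = -1"
  obtains \<theta> \<theta>' where "\<theta> * \<theta>' = 1" "\<theta>' * \<theta> = 1" "A * \<theta> = \<theta> * diag3 1 \<eta> (\<eta> * \<eta>)"
proof -
  note \<eta>' = prim_cbrt[OF \<eta>]
  define th :: 'k where "th = 1/3"
  have th: "th + th + th = 1" by (simp add: th_def)
  \<comment> \<open>The projection onto the eigenspace of a cube root of unity \<open>\<nu>\<close>,
    as the average of the powers of \<open>\<nu>\<^sup>-\<^sup>1 A\<close>, with
    \<open>\<nu>\<^sup>-\<^sup>1 = \<nu>\<^sup>2\<close>.\<close>
  define E where "E \<nu> = th *# (1 + (\<nu>*\<nu>) *# A + \<nu> *# (A*A))" for \<nu> :: 'k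
  have AE: "A * E \<nu> = \<nu> *# E \<nu>" "E \<nu> * A = \<nu> *# E \<nu>" if "\<nu> * (\<nu> * \<nu>) = 1" for \<nu>
  proof -
    have "\<nu> *# E \<nu> = th *# (\<nu> *# 1 + (\<nu> * (\<nu>*\<nu>)) *# A + (\<nu>*\<nu>) *# (A*A))"
      by (simp add: E_def sm_simps mult_ac)
    also have "\<dots> = th *# (A + (\<nu>*\<nu>) *# (A*A) + \<nu> *# (A*A*A))"
      by (simp add: that A3 add_ac)
    finally have *: "\<nu> *# E \<nu> = th *# (A + (\<nu>*\<nu>) *# (A*A) + \<nu> *# (A*A*A))" .
    show "A * E \<nu> = \<nu> *# E \<nu>" "E \<nu> * A = \<nu> *# E \<nu>"
      unfolding * by (simp_all add: E_def sm_simps distrib_left distrib_right mult.assoc)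
  qed
  have sum: "E 1 + E \<eta> + E (\<eta>*\<eta>) = 1"
  proof -
    have "E 1 + E \<eta> + E (\<eta>*\<eta>) = (th + th + th) *# 1 + (th * (1 + \<eta>*\<eta> + \<eta>*\<eta>*(\<eta>*\<eta>))) *# A
        + (th * (1 + \<eta> + \<eta>*\<eta>)) *# (A*A)"
      unfolding E_def by (simp only: sm_simps distrib_left mult_1_right mult_1_left sm_01 add_ac)
    moreover have "1 + \<eta>*\<eta> + \<eta>*\<eta>*(\<eta>*\<eta>) = 0" "1 + \<eta> + \<eta>*\<eta> = 0"
      using \<eta> unfolding prim_cbrt_def by Groebner_Basis.algebra+
    ultimately show ?thesis by (simp only: th mult_zero_right sm_01 add_0_right)
  qed
  have cube: "\<eta>*\<eta> * (\<eta>*\<eta> * (\<eta>*\<eta>)) = 1" using \<eta> unfolding prim_cbrt_def by Groebner_Basis.algebra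
  note AE1 = AE[of 1, simplified] and AE2 = AE[OF \<eta>'(9)] and AE3 = AE[OF cube]
  have nz: "E 1 \<noteq> 0" "E \<eta> \<noteq> 0" "E (\<eta>*\<eta>) \<noteq> 0"
  proof -
    show "E (\<eta>*\<eta>) \<noteq> 0"
    proof
      assume "E (\<eta>*\<eta>) = 0"
      then have "E 1 + E \<eta> = 1" using sum by simp
      from no_two_eigenspaces[OF _ _ AE2 this _ _ _ B C BC, of 1] show False using AE1 \<eta>' by auto
    qed
    show "E \<eta> \<noteq> 0"
    proof
      assume "E \<eta> = 0"
      then have "E 1 + E (\<eta>*\<eta>) = 1" using sum by simp
      from no_two_eigenspaces[OF _ _ AE3 this _ _ _ B C BC, of 1] show False using AE1 \<eta>' by auto
    qed
    show "E 1 \<noteq> 0"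
    proof
      assume "E 1 = 0"
      then have "E \<eta> + E (\<eta>*\<eta>) = 1" using sum by simp
      from no_two_eigenspaces[OF AE2 AE3 this _ _ _ B C BC] show False using \<eta>' by auto
    qed
  qed
  have orth: "E l * E m = 0" if "E l * A = l *# E l" "A * E m = m *# E m" "l \<noteq> m" for l m
  proof -
    have "l *# (E l * E m) = m *# (E l * E m)"
      using that(1,2) by (metis mult.assoc sm_simps(5,6))
    then have "(l - m) *# (E l * E m) = 0" by (simp add: sm_simps)
    then show ?thesis using \<open>l \<noteq> m\<close> by (simp add: sm_eq_0)
  qed
  have o: "E 1 * E \<eta> = 0" "E 1 * E (\<eta>*\<eta>) = 0" "E \<eta> * E 1 = 0" "E \<eta> * E (\<eta>*\<eta>) = 0"
    "E (\<eta>*\<eta>) * E 1 = 0" "E (\<eta>*\<eta>) * E \<eta> = 0"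
    by (rule orth; use AE1 AE2 AE3 \<eta>' in simp)+
  have idem: "E 1 * E 1 = E 1" "E \<eta> * E \<eta> = E \<eta>" "E (\<eta>*\<eta>) * E (\<eta>*\<eta>) = E (\<eta>*\<eta>)"
  proof -
    have "E l = E l * E 1 + E l * E \<eta> + E l * E (\<eta>*\<eta>)" for l
      using arg_cong[OF sum, of "\<lambda>M. E l * M"] by (simp add: distrib_left)
    from this[of 1] this[of \<eta>] this[of "\<eta>*\<eta>"]
    show "E 1 * E 1 = E 1" "E \<eta> * E \<eta> = E \<eta>" "E (\<eta>*\<eta>) * E (\<eta>*\<eta>) = E (\<eta>*\<eta>)"
      unfolding o by simp_all
  qed
  obtain S1 where S1: "S1 * diag3 1 0 0 = S1" "E 1 * S1 \<noteq> 0" using nonzero_column[OF nz(1)] .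
  obtain S2 where S2: "S2 * diag3 0 1 0 = S2" "E \<eta> * S2 \<noteq> 0" using nonzero_column[OF nz(2)] .
  obtain S3 where S3: "S3 * diag3 0 0 1 = S3" "E (\<eta>*\<eta>) * S3 \<noteq> 0" using nonzero_column[OF nz(3)] .
  \<comment> \<open>The columns of \<open>\<theta>\<close> are eigenvectors for the eigenvalues
    \<open>1\<close>, \<open>\<eta>\<close>, \<open>\<eta> * \<eta>\<close>.\<close>
  define \<theta> where "\<theta> = E 1 * S1 + E \<eta> * S2 + E (\<eta>*\<eta>) * S3"
  have SD: "S1 * diag3 1 \<eta> (\<eta>*\<eta>) = S1" "S2 * diag3 1 \<eta> (\<eta>*\<eta>) = \<eta> *# S2"
    "S3 * diag3 1 \<eta> (\<eta>*\<eta>) = (\<eta>*\<eta>) *# S3"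
    using S1(1) S2(1) S3(1) by (cases S1; cases S2; cases S3; auto simp: diag3_def mult_ac)+
  have A\<theta>: "A * \<theta> = \<theta> * diag3 1 \<eta> (\<eta>*\<eta>)"
    unfolding \<theta>_def distrib_left distrib_right mult.assoc SD
    by (simp add: AE1 AE2 AE3 sm_simps flip: mult.assoc)
  have "V = 0" if "\<theta> * V = 0" for V
  proof -
    \<comment> \<open>Each projection isolates one column of \<open>\<theta>\<close>, so
      \<open>\<theta> * V = 0\<close> forces the rows of \<open>V\<close> to vanish one at a
      time.\<close>
    have "E 1 * \<theta> = E 1 * S1" "E \<eta> * \<theta> = E \<eta> * S2" "E (\<eta>*\<eta>) * \<theta> = E (\<eta>*\<eta>) * S3"
      by (simp_all add: \<theta>_def distrib_left o idem flip: mult.assoc)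
    then have "(E 1 * S1) * V = 0" "(E \<eta> * S2) * V = 0" "(E (\<eta>*\<eta>) * S3) * V = 0"
      using that by (metis mult.assoc mult_zero_right)+
    from column_times_eq_0(1)[OF S1(2) this(1)] column_times_eq_0(2)[OF S2(2) this(2)]
      column_times_eq_0(3)[OF S3(2) this(3)]
    show "V = 0" using S1(1) S2(1) S3(1) by (cases V) (simp add: mult.assoc zero_m3_def)
  qed
  then obtain \<theta>' where "\<theta> * \<theta>' = 1" "\<theta>' * \<theta> = 1"
    by (metis m3_inverse_or_kernel)
  then show thesis using A\<theta> that by blast
qed

section \<open>Normal forms for a Weierstrass cubic\<close>

lemmas m3_unfold = diag3_def one_m3_def zero_m3_def uminus_m3.simps sm.simps times_m3.simps plus_m3.simps

text \<open>On the diagonal, the relation linear in \<open>B\<close> multiplies each entry by three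
  times the square of an eigenvalue, so the diagonal of \<open>B\<close> vanishes; off the diagonal
  its factor is \<open>l\<^sub>i\<^sup>2 + l\<^sub>i l\<^sub>j + l\<^sub>j\<^sup>2 = 0\<close> for
  distinct cube roots of unity. The same holds for \<open>C\<close>. The relations linear in
  \<open>A\<close> then link the products of opposite entries, and those free of \<open>A\<close>
  are polarizations of the sum of the two 3-cycles. The equation for \<open>a\<close> avoids a
  quotient, so that it can serve in ideal membership proofs.\<close>

lemma diag_equations:
  fixes \<eta> :: "'k::field_char_0"
  assumes \<eta>: "prim_cbrt \<eta>" and a: "(1 - \<eta>) * \<mu> * k = a"
    and T: "(diag3 \<mu> (\<mu>*\<eta>) (\<mu>*(\<eta>*\<eta>)), M3 a11 a12 a13 a21 a22 a23 a31 a32 a33,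
      M3 b11 b12 b13 b21 b22 b23 b31 b32 b33) \<in> triples (weierstrass a b)"
  shows "\<mu> ^ 3 = 1"
    and "a11 = 0" "a22 = 0" "a33 = 0" "b11 = 0" "b22 = 0" "b33 = 0"
    and "a23 * a32 = \<eta> * (a12 * a21)" "a31 * a13 = \<eta> * \<eta> * (a12 * a21)"
    and "a23 * b32 + b23 * a32 = \<eta> * (a12 * b21 + b12 * a21)"
      "a31 * b13 + b31 * a13 = \<eta> * \<eta> * (a12 * b21 + b12 * a21)"
    and "b23 * b32 = \<eta> * (b12 * b21) - k" "b31 * b13 = \<eta> * \<eta> * (b12 * b21) + k"
    and "a12 * a23 * a31 + a13 * a21 * a32 = 0"
    and "a12 * a23 * b31 + a12 * b23 * a31 + b12 * a23 * a31 +
      a13 * a21 * b32 + a13 * b21 * a32 + b13 * a21 * a32 = -1"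
    and "a12 * b23 * b31 + b12 * a23 * b31 + b12 * b23 * a31 +
      a13 * b21 * b32 + b13 * a21 * b32 + b13 * b21 * a32 = 0"
    and "b12 * b23 * b31 + b13 * b21 * b32 = b"
proof -
  define A where "A = diag3 \<mu> (\<mu>*\<eta>) (\<mu>*(\<eta>*\<eta>))"
  define B where "B = M3 a11 a12 a13 a21 a22 a23 a31 a32 a33"
  define C where "C = M3 b11 b12 b13 b21 b22 b23 b31 b32 b33"
  have e: "\<eta> * \<eta> + \<eta> + 1 = 0" using \<eta> by (simp add: prim_cbrt_def)
  have eq: "A*A*A = 1" "B*B*B = 0" "C*C*C = b *# 1"
    "A*A*B + A*B*A + B*A*A = 0" "A*B*B + B*A*B + B*B*A = 0"
    "A*A*C + A*C*A + C*A*A = 0" "A*C*C + C*A*C + C*C*A = a *# 1"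
    "B*B*C + B*C*B + C*B*B = -1" "B*C*C + C*B*C + C*C*B = 0"
    "A*B*C + A*C*B + B*A*C + B*C*A + C*A*B + C*B*A = 0"
    using T unfolding triples_weierstrass_iff A_def B_def C_def by simp_all
  note eqs = eq[unfolded A_def B_def C_def m3_unfold]
  have "\<mu> * \<mu> * \<mu> = 1" using arg_cong[OF eqs(1), of e11, unfolded m3.sel] by Groebner_Basis.algebra
  then show "\<mu> ^ 3 = 1" by (simp add: power3_eq_cube)
  have \<mu>0: "\<mu> \<noteq> 0" using \<open>\<mu> * \<mu> * \<mu> = 1\<close> by auto
  note \<eta>' = prim_cbrt[OF \<eta>]
  have nz: "3 * (\<mu> * \<mu>) \<noteq> 0" "3 * (\<mu> * \<eta> * (\<mu> * \<eta>)) \<noteq> 0" "3 * (\<mu> * (\<eta> * \<eta>) * (\<mu> * (\<eta> * \<eta>))) \<noteq> 0"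
    "\<mu> * (1 - \<eta>) \<noteq> 0"
    using \<mu>0 \<eta>'(3,4) by simp_all
  have "3 * (\<mu> * \<mu>) * a11 = 0" using arg_cong[OF eqs(4), of e11, unfolded m3.sel] by Groebner_Basis.algebra
  then show a11: "a11 = 0" using nz by simp
  have "3 * (\<mu> * \<eta> * (\<mu> * \<eta>)) * a22 = 0" using arg_cong[OF eqs(4), of e22, unfolded m3.sel] by Groebner_Basis.algebra
  then show a22: "a22 = 0" using nz by simp
  have "3 * (\<mu> * (\<eta> * \<eta>) * (\<mu> * (\<eta> * \<eta>))) * a33 = 0" using arg_cong[OF eqs(4), of e33, unfolded m3.sel] by Groebner_Basis.algebra
  then show a33: "a33 = 0" using nz by simp
  have "3 * (\<mu> * \<mu>) * b11 = 0" using arg_cong[OF eqs(6), of e11, unfolded m3.sel] by Groebner_Basis.algebra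
  then show b11: "b11 = 0" using nz by simp
  have "3 * (\<mu> * \<eta> * (\<mu> * \<eta>)) * b22 = 0" using arg_cong[OF eqs(6), of e22, unfolded m3.sel] by Groebner_Basis.algebra
  then show b22: "b22 = 0" using nz by simp
  have "3 * (\<mu> * (\<eta> * \<eta>) * (\<mu> * (\<eta> * \<eta>))) * b33 = 0" using arg_cong[OF eqs(6), of e33, unfolded m3.sel] by Groebner_Basis.algebra
  then show b33: "b33 = 0" using nz by simp
  note eqs' = eqs[unfolded a11 a22 a33 b11 b22 b33]
  \<comment> \<open>Differences of eigenvalues leave the common factor
    \<open>\<mu> * (1 - \<eta>)\<close> in the diagonal entries of the relations linear in
    \<open>A\<close>.\<close>
  have cancel: "x = y" if "\<mu> * (1 - \<eta>) * (x - y) = 0" for x y using that nz(4) by simp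
  show "a23 * a32 = \<eta> * (a12 * a21)"
    by (rule cancel) (use arg_cong[OF eqs'(5), of e22, unfolded m3.sel] e in Groebner_Basis.algebra)
  show "a31 * a13 = \<eta> * \<eta> * (a12 * a21)"
    by (rule cancel) (use arg_cong[OF eqs'(5), of e11, unfolded m3.sel] e in Groebner_Basis.algebra)
  show "a23 * b32 + b23 * a32 = \<eta> * (a12 * b21 + b12 * a21)"
    by (rule cancel) (use arg_cong[OF eqs'(10), of e22, unfolded m3.sel] e in Groebner_Basis.algebra)
  show "a31 * b13 + b31 * a13 = \<eta> * \<eta> * (a12 * b21 + b12 * a21)"
    by (rule cancel) (use arg_cong[OF eqs'(10), of e11, unfolded m3.sel] e in Groebner_Basis.algebra)
  show "b23 * b32 = \<eta> * (b12 * b21) - k"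
    by (rule cancel) (use arg_cong[OF eqs'(7), of e22, unfolded m3.sel] e a in Groebner_Basis.algebra)
  show "b31 * b13 = \<eta> * \<eta> * (b12 * b21) + k"
    by (rule cancel) (use arg_cong[OF eqs'(7), of e11, unfolded m3.sel] e a in Groebner_Basis.algebra)
  show "a12 * a23 * a31 + a13 * a21 * a32 = 0"
    using arg_cong[OF eqs'(2), of e11, unfolded m3.sel] by Groebner_Basis.algebra
  show "a12 * a23 * b31 + a12 * b23 * a31 + b12 * a23 * a31 +
      a13 * a21 * b32 + a13 * b21 * a32 + b13 * a21 * a32 = -1"
    using arg_cong[OF eqs'(8), of e11, unfolded m3.sel] by Groebner_Basis.algebra
  show "a12 * b23 * b31 + b12 * a23 * b31 + b12 * b23 * a31 +
      a13 * b21 * b32 + b13 * a21 * b32 + b13 * b21 * a32 = 0"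
    using arg_cong[OF eqs'(9), of e11, unfolded m3.sel] by Groebner_Basis.algebra
  show "b12 * b23 * b31 + b13 * b21 * b32 = b"
    using arg_cong[OF eqs'(3), of e11, unfolded m3.sel] by Groebner_Basis.algebra
qed

text \<open>The two normal forms, for nonzero and for vanishing \<open>B\<^sub>1\<^sub>2 B\<^sub>2\<^sub>1\<close>. The parameter \<open>k\<close> of \<open>sol1\<close>,
  \<open>rep2\<close> and \<open>sol2\<close> is \<open>a / ((1 - \<eta>) \<mu>)\<close>, with \<open>\<mu> = 1\<close> in the first case.\<close>

definition rep1 :: "'k::comm_ring_1 \<Rightarrow> 'k \<Rightarrow> 'k \<Rightarrow> 'k \<Rightarrow> 'k \<Rightarrow> 'k triple"
  where "rep1 \<eta> d g1 g2 g3 = (diag3 1 \<eta> (\<eta>*\<eta>),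
    M3 0 d (-(\<eta>*\<eta>*d)) (-d) 0 d d (-(\<eta>*d)) 0,
    M3 0 g1 (\<eta>*\<eta>*g3) g1 0 g2 g3 (\<eta>*g2) 0)"

definition sol1 :: "'k::comm_ring_1 \<Rightarrow> 'k \<Rightarrow> 'k \<Rightarrow> 'k \<Rightarrow> 'k \<Rightarrow> 'k \<Rightarrow> 'k \<Rightarrow> bool"
  where "sol1 \<eta> k b d g1 g2 g3 \<longleftrightarrow> g2^2 = g1^2 - \<eta>*\<eta>*k \<and> g3^2 = g1^2 + \<eta>*k \<and> 2*(g1*g2*g3) = b
    \<and> 2*(d^2*(g1+g2+g3)) = -1"

definition rep2 :: "'k::comm_ring_1 \<Rightarrow> 'k \<Rightarrow> 'k \<Rightarrow> 'k \<Rightarrow> 'k \<Rightarrow> 'k triple"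
  where "rep2 \<eta> k \<mu> v w = (diag3 \<mu> (\<mu>*\<eta>) (\<mu>*(\<eta>*\<eta>)),
    M3 0 1 (-(\<eta>*\<eta>*v)) 0 0 1 0 0 0,
    M3 0 w (-(\<eta>*\<eta>*(v*w))-k) v 0 (-(v^3)-w) (-1) (\<eta>*v) 0)"

definition sol2 :: "'k::comm_ring_1 \<Rightarrow> 'k \<Rightarrow> 'k \<Rightarrow> 'k \<Rightarrow> 'k \<Rightarrow> bool"
  where "sol2 \<eta> k b v w \<longleftrightarrow> 2*(v*w) = \<eta>*\<eta>*k - v^4 \<and> w^2 = b + \<eta>*k*v^2"

lemma rep1_triples:
  fixes \<eta> :: "'k::field_char_0"
  assumes \<eta>: "prim_cbrt \<eta>" and a: "(1 - \<eta>) * k = a" and "sol1 \<eta> k b d g1 g2 g3"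
  shows "rep1 \<eta> d g1 g2 g3 \<in> triples (weierstrass a b)"
proof -
  have e: "\<eta> * \<eta> + \<eta> + 1 = 0" using \<eta> by (simp add: prim_cbrt_def)
  have s: "g2^2 = g1^2 - \<eta>*\<eta>*k" "g3^2 = g1^2 + \<eta>*k" "b = 2*(g1*g2*g3)" "2*(d^2*(g1+g2+g3)) = -1"
    using assms(3) by (auto simp: sol1_def)
  show ?thesis
    unfolding rep1_def triples_weierstrass_iff m3_unfold m3.inject a[symmetric] s(3)
    by (intro conjI; (use e s(1,2,4) in Groebner_Basis.algebra | simp add: algebra_simps))
qed

lemma rep2_triples:
  fixes \<eta> :: "'k::field_char_0"
  assumes \<eta>: "prim_cbrt \<eta>" and a: "(1 - \<eta>) * \<mu> * k = a" and \<mu>: "\<mu>^3 = 1" and "sol2 \<eta> k b v w"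
  shows "rep2 \<eta> k \<mu> v w \<in> triples (weierstrass a b)"
proof -
  have e: "\<eta> * \<eta> + \<eta> + 1 = 0" using \<eta> by (simp add: prim_cbrt_def)
  have s: "2*(v*w) = \<eta>*\<eta>*k - v^4" "b = w^2 - \<eta>*k*v^2"
    using assms(4) by (auto simp: sol2_def)
  show ?thesis
    unfolding rep2_def triples_weierstrass_iff m3_unfold m3.inject a[symmetric] s(2)
    by (intro conjI; (use e s(1) \<mu> in Groebner_Basis.algebra | simp add: algebra_simps))
qed

section \<open>Scaling the eigenbasis and reduction to the two normal forms\<close>

lemma conj3_diag:
  fixes t1 :: "'k::field"
  assumes "t1 \<noteq> 0" "t2 \<noteq> 0" "t3 \<noteq> 0"
  shows "conj3 (diag3 l1 l2 l3, M3 0 a12 a13 a21 0 a23 a31 a32 0, M3 0 b12 b13 b21 0 b23 b31 b32 0)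
    (diag3 l1 l2 l3,
     M3 0 (a12*t2/t1) (a13*t3/t1) (a21*t1/t2) 0 (a23*t3/t2) (a31*t1/t3) (a32*t2/t3) 0,
     M3 0 (b12*t2/t1) (b13*t3/t1) (b21*t1/t2) 0 (b23*t3/t2) (b31*t1/t3) (b32*t2/t3) 0)"
  by (rule conj3I[of "diag3 t1 t2 t3" "diag3 (1/t1) (1/t2) (1/t3)"])
    (use assms in \<open>simp_all add: m3_unfold\<close>)

text \<open>After the scaling of \<open>B\<close>, each entry of \<open>C\<close> below the diagonal
  differs from its expected partner by the same defect \<open>c\<close>. The relation quadratic in
  \<open>C\<close> then forces \<open>c = 0\<close>, which makes \<open>C\<close> symmetric up to
  the powers of \<open>\<eta>\<close> in \<open>rep1\<close>.\<close>

lemma rep1_normal_aux: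
  fixes \<eta> :: "'k::field_char_0"
  assumes \<eta>: "prim_cbrt \<eta>" and a: "(1 - \<eta>) * k = a" and "d \<noteq> 0" "a21 \<noteq> 0"
    and T: "(diag3 1 \<eta> (\<eta>*\<eta>), M3 0 d a13 a21 0 d (- a21) a32 0, M3 0 b12 b13 b21 0 b23 b31 b32 0)
      \<in> triples (weierstrass a b)"
  shows "sol1 \<eta> k b d b12 b23 b31 \<and>
    (diag3 1 \<eta> (\<eta>*\<eta>), M3 0 d a13 a21 0 d (- a21) a32 0, M3 0 b12 b13 b21 0 b23 b31 b32 0) =
    rep1 \<eta> d b12 b23 b31"
proof -
  have e: "\<eta> * \<eta> + \<eta> + 1 = 0" using \<eta> by (simp add: prim_cbrt_def)
  have a': "(1 - \<eta>) * 1 * k = a" using a by simp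
  note D = diag_equations(2-)[OF \<eta> a', unfolded mult_1_left, OF T]
  have a32: "a32 = \<eta> * a21" using D(7) \<open>d \<noteq> 0\<close> by simp
  have a13: "a13 = - (\<eta> * \<eta> * d)"
  proof -
    have "a21 * (a13 + \<eta> * \<eta> * d) = 0" using D(8) by Groebner_Basis.algebra
    then show ?thesis using \<open>a21 \<noteq> 0\<close> by (simp add: eq_neg_iff_add_eq_0)
  qed
  have a21: "a21 = - d"
  proof -
    have "d * a21 * (d + a21) = 0" using D(13) e unfolding a32 a13 by Groebner_Basis.algebra
    then show ?thesis using \<open>a21 \<noteq> 0\<close> \<open>d \<noteq> 0\<close> by (simp add: eq_neg_iff_add_eq_0 add.commute)
  qed
  define c where "c = b21 - b12"
  have b21: "b21 = b12 + c" by (simp add: c_def)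
  have b32: "b32 = \<eta> * (b23 + c)"
  proof -
    have "d * (b32 - \<eta> * (b23 + c)) = 0" using D(9) unfolding a32 a21 b21 by Groebner_Basis.algebra
    then show ?thesis using \<open>d \<noteq> 0\<close> by simp
  qed
  have b13: "b13 = \<eta> * \<eta> * (b31 + c)"
  proof -
    have "d * (b13 - \<eta> * \<eta> * (b31 + c)) = 0" using D(10) unfolding a21 a13 b21 by Groebner_Basis.algebra
    then show ?thesis using \<open>d \<noteq> 0\<close> by simp
  qed
  \<comment> \<open>The bracket is nonzero by this equation and reappears as a factor in the
    relation quadratic in \<open>C\<close>, whose other factor is \<open>c\<close>.\<close>
  have s: "d^2 * (2 * (b12 + b23 + b31) + 3 * c) = -1"
    using D(14) e unfolding a32 a13 a21 b21 b32 b13 by Groebner_Basis.algebra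
  have "c = 0"
  proof -
    have "d * c * (2 * (b12 + b23 + b31) + 3 * c) = 0"
      using D(15) e unfolding a32 a13 a21 b21 b32 b13 by Groebner_Basis.algebra
    then show ?thesis using s \<open>d \<noteq> 0\<close> by auto
  qed
  have "b23^2 = b12^2 - \<eta>*\<eta>*k" "b31^2 = b12^2 + \<eta>*k"
    using D(11,12) e unfolding b21 b32 b13 \<open>c = 0\<close> by Groebner_Basis.algebra+
  moreover have "2 * (b12 * b23 * b31) - b = 0"
    using iffD2[OF right_minus_eq D(16)] e unfolding b21 b32 b13 \<open>c = 0\<close> by Groebner_Basis.algebra
  moreover have "2 * (d^2 * (b12 + b23 + b31)) = -1"
    using s unfolding \<open>c = 0\<close> by Groebner_Basis.algebra
  ultimately show ?thesis
    by (simp add: sol1_def rep1_def a32 a13 a21 b21 b32 b13 \<open>c = 0\<close>)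
qed

lemma rep1_normal:
  fixes \<eta> :: "'k::field_char_0"
  assumes \<eta>: "prim_cbrt \<eta>" and a: "(1 - \<eta>) * k = a" and p: "a12 * a21 \<noteq> 0"
    and T: "(diag3 1 \<eta> (\<eta>*\<eta>), M3 a11 a12 a13 a21 a22 a23 a31 a32 a33,
      M3 b11 b12 b13 b21 b22 b23 b31 b32 b33) \<in> triples (weierstrass a b)" (is "?T \<in> _")
  shows "\<exists>d g1 g2 g3. sol1 \<eta> k b d g1 g2 g3 \<and> conj3 ?T (rep1 \<eta> d g1 g2 g3)"
proof -
  have a': "(1 - \<eta>) * 1 * k = a" using a by simp
  note D = diag_equations(2-)[OF \<eta> a', unfolded mult_1_left, OF T]
  note [simp] = D(1-6)
  have nz: "a12 \<noteq> 0" "a21 \<noteq> 0" "a23 \<noteq> 0" using p D(7) prim_cbrt(3)[OF \<eta>] by auto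
  have e: "\<eta> * \<eta> + \<eta> + 1 = 0" using \<eta> by (simp add: prim_cbrt_def)
  \<comment> \<open>The two 3-cycles of \<open>B\<close> have sum zero, and their product is the
    product of the three opposite pairs, namely \<open>(a12 * a21) ^ 3\<close>.\<close>
  have "(a12 * a23 * a31) ^ 2 = - ((a12 * a21) ^ 3)" using D(7,8,13) e by Groebner_Basis.algebra
  then have "a12 * a23 * a31 \<noteq> 0" using p by auto
  then have a31: "a31 \<noteq> 0" by auto
  \<comment> \<open>Diagonal scaling preserves the 3-cycle \<open>a12 * a23 * a31\<close> and the
    product \<open>a12 * a21\<close>. In \<open>rep1\<close> they are \<open>d^3\<close> and
    \<open>- (d^2)\<close>, so \<open>d\<close> must be minus their quotient.\<close>
  define d where "d = - (a12 * a23 * a31) / (a12 * a21)"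
  have d: "d \<noteq> 0" using nz a31 by (simp add: d_def)
  have da: "d * a21 = - (a23 * a31)" using nz by (simp add: d_def)
  define t2 t3 where "t2 = d / a12" and "t3 = d * t2 / a23"
  have t: "t2 \<noteq> 0" "t3 \<noteq> 0" using d nz by (simp_all add: t2_def t3_def)
  obtain a13' a21' a31' a32' b12' b13' b21' b23' b31' b32' where
    *: "conj3 ?T (diag3 1 \<eta> (\<eta>*\<eta>), M3 0 d a13' a21' 0 d a31' a32' 0, M3 0 b12' b13' b21' 0 b23' b31' b32' 0)"
    and a': "a21' = a21 / t2" "a31' = a31 / t3"
  proof -
    have "a12 * t2 / 1 = d" "a23 * t3 / t2 = d" using nz t by (simp_all add: t2_def t3_def)
    then show thesis
      using that conj3_diag[OF _ t, of 1 1 \<eta> "\<eta>*\<eta>" a12 a13 a21 a23 a31 a32 b12 b13 b21 b23 b31 b32] by simp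
  qed
  have "a31' = - a21'"
  proof -
    have "a31' = a31 * a23 / (d * t2)" by (simp add: a' t3_def)
    also have "\<dots> = - a21 / t2" using da d t by (simp add: field_simps)
    finally show ?thesis by (simp add: a')
  qed
  moreover have "a21' \<noteq> 0" using nz t a' by simp
  ultimately show ?thesis
    using rep1_normal_aux[OF \<eta> a d, of a21' a13' a32' b12' b13' b21' b23' b31' b32' b]
      * conj3_triples[OF conj3_sym[OF *] T] by metis
qed

text \<open>With \<open>B\<close> upper triangular and two entries scaled to 1, the relations can be
  solved successively for the other entries: \<open>b31\<close>, \<open>b32\<close>,
  \<open>a13\<close>, \<open>b23\<close> and \<open>b13\<close> follow, and the two relations left
  over are \<open>sol2\<close>.\<close>

lemma rep2_normal_aux:
  fixes \<eta> :: "'k::field_char_0"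
  assumes \<eta>: "prim_cbrt \<eta>" and a: "(1 - \<eta>) * \<mu> * k = a"
    and T: "(diag3 \<mu> (\<mu>*\<eta>) (\<mu>*(\<eta>*\<eta>)), M3 0 1 a13 0 0 1 0 0 0, M3 0 b12 b13 b21 0 b23 b31 b32 0)
      \<in> triples (weierstrass a b)"
  shows "sol2 \<eta> k b b21 b12 \<and>
    (diag3 \<mu> (\<mu>*\<eta>) (\<mu>*(\<eta>*\<eta>)), M3 0 1 a13 0 0 1 0 0 0, M3 0 b12 b13 b21 0 b23 b31 b32 0) =
    rep2 \<eta> k \<mu> b21 b12"
proof -
  have e: "\<eta> * \<eta> + \<eta> + 1 = 0" using \<eta> by (simp add: prim_cbrt_def)
  note D = diag_equations[OF \<eta> a T]
  have b31: "b31 = - 1" using D(15) by simp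
  have b32: "b32 = \<eta> * b21" using D(10) by simp
  have a13: "a13 = - (\<eta> * \<eta> * b21)" using D(11) unfolding b31 by Groebner_Basis.algebra
  have b23: "b23 = - (b21^3) - b12" using D(16) e unfolding b31 b32 a13 by Groebner_Basis.algebra
  have b13: "b13 = - (\<eta> * \<eta> * (b21 * b12)) - k" using D(13) unfolding b31 by Groebner_Basis.algebra
  have "\<eta> * (2 * (b21 * b12) - (\<eta>*\<eta>*k - b21^4)) = 0"
    using D(12) e unfolding b32 b23 by Groebner_Basis.algebra
  then have "2 * (b21 * b12) = \<eta>*\<eta>*k - b21^4" using prim_cbrt(3)[OF \<eta>] by simp
  moreover have "b12^2 - (b + \<eta> * k * b21^2) = 0"
    using iffD2[OF right_minus_eq D(17)] e unfolding b31 b32 b23 b13 by Groebner_Basis.algebra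
  ultimately show ?thesis
    by (simp add: sol2_def rep2_def b31 b32 a13 b23 b13)
qed

lemma rep2_normal:
  fixes \<eta> :: "'k::field_char_0"
  assumes \<eta>: "prim_cbrt \<eta>" and p: "a12 * a21 = 0" "a12 \<noteq> 0" "a23 \<noteq> 0"
    and T: "(diag3 \<mu> (\<mu>*\<eta>) (\<mu>*(\<eta>*\<eta>)), M3 a11 a12 a13 a21 a22 a23 a31 a32 a33,
      M3 b11 b12 b13 b21 b22 b23 b31 b32 b33) \<in> triples (weierstrass a b)" (is "?T \<in> _")
  shows "\<exists>v w. \<mu>^3 = 1 \<and> sol2 \<eta> (a / ((1 - \<eta>) * \<mu>)) b v w \<and>
    conj3 ?T (rep2 \<eta> (a / ((1 - \<eta>) * \<mu>)) \<mu> v w)"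
proof -
  define k where "k = a / ((1 - \<eta>) * \<mu>)"
  have "\<mu>^3 = 1"
  \<comment> \<open>The quotient defining \<open>k\<close> satisfies its equation only for nonzero
    \<open>\<mu>\<close>, so \<open>A = 0\<close> has to be excluded before
    \<open>diag_equations\<close> applies.\<close>
  proof (cases "\<mu> = 0")
    case True
    have "(0 :: 'k m3) * 0 * 0 = 1" using T unfolding triples_weierstrass_iff True
      by (simp add: diag3_def zero_m3_def)
    then show ?thesis by simp
  next
    case False
    then have "(1 - \<eta>) * \<mu> * k = a" using prim_cbrt(4)[OF \<eta>] by (simp add: k_def)
    from diag_equations(1)[OF \<eta> this T] show ?thesis .
  qed
  then have a: "(1 - \<eta>) * \<mu> * k = a" using prim_cbrt(4)[OF \<eta>] by (auto simp: k_def)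
  note D = diag_equations[OF \<eta> a T]
  note [simp] = D(2-7)
  \<comment> \<open>All products of opposite entries vanish with \<open>a12 * a21\<close>. The
    vanishing sum of the 3-cycles then kills \<open>a31\<close>, and \<open>B\<close> is strictly
    upper triangular.\<close>
  have [simp]: "a21 = 0" "a32 = 0" using p D(8) by auto
  have [simp]: "a31 = 0" using p D(14) by simp
  define t2 t3 where "t2 = 1 / a12" and "t3 = t2 / a23"
  have t: "t2 \<noteq> 0" "t3 \<noteq> 0" using p by (simp_all add: t2_def t3_def)
  obtain a13' b12' b13' b21' b23' b31' b32' where
    *: "conj3 ?T (diag3 \<mu> (\<mu>*\<eta>) (\<mu>*(\<eta>*\<eta>)), M3 0 1 a13' 0 0 1 0 0 0, M3 0 b12' b13' b21' 0 b23' b31' b32' 0)"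
  proof -
    have "a12 * t2 / 1 = 1" "a23 * t3 / t2 = 1" using p t by (simp_all add: t2_def t3_def)
    then show thesis
      using that conj3_diag[OF _ t, of 1 \<mu> "\<mu>*\<eta>" "\<mu>*(\<eta>*\<eta>)" a12 a13 a21 a23 a31 a32 b12 b13 b21 b23 b31 b32] by simp
  qed
  then show ?thesis
    using rep2_normal_aux[OF \<eta> a, of a13' b12' b13' b21' b23' b31' b32' b] \<open>\<mu>^3 = 1\<close>
      * conj3_triples[OF conj3_sym[OF *] T] unfolding k_def by metis
qed

section \<open>Reordering the eigenbasis; every triple has a normal form\<close>

lemma conj3_rotate:
  "conj3 (diag3 l1 l2 l3, M3 a11 a12 a13 a21 a22 a23 a31 a32 a33, M3 b11 b12 b13 b21 b22 b23 b31 b32 b33)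
    (diag3 l2 l3 l1, M3 a22 a23 a21 a32 a33 a31 a12 a13 a11, M3 b22 b23 b21 b32 b33 b31 b12 b13 (b11 :: 'k::field))"
  by (rule conj3I[of "M3 0 0 1 1 0 0 0 1 0" "M3 0 1 0 0 0 1 1 0 0"]) (simp_all add: m3_unfold)

lemma conj3_swap:
  "conj3 (diag3 l1 l2 l3, M3 a11 a12 a13 a21 a22 a23 a31 a32 a33, M3 b11 b12 b13 b21 b22 b23 b31 b32 b33)
    (diag3 l2 l1 l3, M3 a22 a21 a23 a12 a11 a13 a32 a31 a33, M3 b22 b21 b23 b12 b11 b13 b32 b31 (b33 :: 'k::field))"
  by (rule conj3I[of "M3 0 1 0 1 0 0 0 0 1" "M3 0 1 0 1 0 0 0 0 1"]) (simp_all add: m3_unfold)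

text \<open>The entries of \<open>B\<close> distinguish no order of the eigenbasis here, so one
  fixed \<open>\<eta>\<close> serves to number it.\<close>

definition reps1 :: "'k::field \<Rightarrow> 'k \<Rightarrow> 'k \<Rightarrow> 'k triple set"
  where "reps1 a b \<eta> = {rep1 \<eta> d g1 g2 g3 | d g1 g2 g3. sol1 \<eta> (a / (1 - \<eta>)) b d g1 g2 g3}"

text \<open>The nilpotent \<open>B\<close> determines the order of the eigenbasis. The pair of
  \<open>\<mu>\<close> and \<open>\<eta>\<close> encodes it: \<open>\<mu>\<close> is the first
  eigenvalue and \<open>\<eta>\<close> the cyclic direction of the other two.\<close>

definition reps2 :: "'k::field \<Rightarrow> 'k \<Rightarrow> 'k triple set"
  where "reps2 a b = {rep2 \<eta> (a / ((1 - \<eta>) * \<mu>)) \<mu> v w | \<eta> \<mu> v w. prim_cbrt \<eta> \<and> \<mu>^3 = 1 \<and>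
    sol2 \<eta> (a / ((1 - \<eta>) * \<mu>)) b v w}"

text \<open>A rotation of the basis multiplies \<open>\<mu>\<close> by a power of
  \<open>\<eta>\<close> and keeps \<open>\<eta>\<close>, so it reaches the three orders of one
  cyclic direction. Two consecutive nonzero entries on the 3-cycle can thereby be moved to positions
  12 and 23.\<close>

lemma rep2_normal_rotated:
  fixes \<eta> :: "'k::field_char_0"
  assumes \<eta>: "prim_cbrt \<eta>" and p: "a12 * a21 = 0" "a23 * a32 = 0" "a31 * a13 = 0"
    and nz: "a12 * a23 \<noteq> 0 \<or> a23 * a31 \<noteq> 0 \<or> a31 * a12 \<noteq> 0"
    and T: "(diag3 \<mu> (\<mu>*\<eta>) (\<mu>*(\<eta>*\<eta>)), M3 a11 a12 a13 a21 a22 a23 a31 a32 a33,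
      M3 b11 b12 b13 b21 b22 b23 b31 b32 b33) \<in> triples (weierstrass a b)" (is "?T \<in> _")
  shows "\<exists>r\<in>reps2 a b. conj3 ?T r"
proof -
  have *: "\<exists>r\<in>reps2 a b. conj3 (diag3 \<nu> (\<nu>*\<eta>) (\<nu>*(\<eta>*\<eta>)), M3 c11 c12 c13 c21 c22 c23 c31 c32 c33,
      M3 d11 d12 d13 d21 d22 d23 d31 d32 d33) r"
    if "c12 * c21 = 0" "c12 * c23 \<noteq> 0" "(diag3 \<nu> (\<nu>*\<eta>) (\<nu>*(\<eta>*\<eta>)), M3 c11 c12 c13 c21 c22 c23 c31 c32 c33,
      M3 d11 d12 d13 d21 d22 d23 d31 d32 d33) \<in> triples (weierstrass a b)"
    for \<nu> c11 c12 c13 c21 c22 c23 c31 c32 c33 d11 d12 d13 d21 d22 d23 d31 d32 d33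
    using rep2_normal[OF \<eta> that(1) _ _ that(3)] that(2) \<eta> unfolding reps2_def by fastforce
  have e3: "x * (\<eta> * (\<eta> * \<eta>)) = x" "x * \<eta> * (\<eta> * \<eta>) = x" "x * (\<eta> * \<eta>) * \<eta> = x"
    "x * (\<eta> * \<eta>) * (\<eta> * \<eta>) = x * \<eta>" for x
    using prim_cbrt(9)[OF \<eta>] by (simp_all add: mult.assoc)
  let ?T1 = "(diag3 (\<mu>*\<eta>) (\<mu>*(\<eta>*\<eta>)) \<mu>, M3 a22 a23 a21 a32 a33 a31 a12 a13 a11,
    M3 b22 b23 b21 b32 b33 b31 b12 b13 b11)"
  let ?T2 = "(diag3 (\<mu>*(\<eta>*\<eta>)) \<mu> (\<mu>*\<eta>), M3 a33 a31 a32 a13 a11 a12 a23 a21 a22,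
    M3 b33 b31 b32 b13 b11 b12 b23 b21 b22)"
  have c1: "conj3 ?T ?T1" by (rule conj3_rotate)
  have c2: "conj3 ?T ?T2" by (rule conj3_trans[OF c1]) (rule conj3_rotate)
  from nz consider "a12 * a23 \<noteq> 0" | "a23 * a31 \<noteq> 0" | "a31 * a12 \<noteq> 0" by blast
  then show ?thesis
  proof cases
    case 1
    show ?thesis by (rule *[OF p(1) 1 T])
  next
    case 2
    have "?T1 \<in> triples (weierstrass a b)" by (rule conj3_triples[OF conj3_sym[OF c1] T])
    then have "\<exists>r\<in>reps2 a b. conj3 ?T1 r"
      using *[OF p(2) 2, of "\<mu>*\<eta>"] by (simp add: e3 mult.assoc)
    then show ?thesis using conj3_trans[OF c1] by blast
  next
    case 3
    have "?T2 \<in> triples (weierstrass a b)" by (rule conj3_triples[OF conj3_sym[OF c2] T])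
    then have "\<exists>r\<in>reps2 a b. conj3 ?T2 r"
      using *[OF p(3) 3, of "\<mu>*(\<eta>*\<eta>)"] by (simp add: e3)
    then show ?thesis using conj3_trans[OF c2] by blast
  qed
qed

lemma exists_normal_form:
  fixes a :: "'k::field_char_0"
  assumes \<eta>: "prim_cbrt \<eta>" and S: "S \<in> triples (weierstrass a b)"
  shows "\<exists>r \<in> reps1 a b \<eta> \<union> reps2 a b. conj3 S r"
proof -
  obtain A B C where S_def: "S = (A, B, C)" by (metis prod_cases3)
  have eq: "A*A*A = 1" "A*A*B + A*B*A + B*A*A = 0" "A*A*C + A*C*A + C*A*A = 0" "B*B*C + B*C*B + C*B*B = -1"
    using S unfolding S_def triples_weierstrass_iff by simp_all
  obtain \<theta> \<theta>' where \<theta>: "\<theta> * \<theta>' = 1" "\<theta>' * \<theta> = 1" "A * \<theta> = \<theta> * diag3 1 \<eta> (\<eta> * \<eta>)"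
    by (rule diagonalize[OF \<eta> eq])
  obtain a11 a12 a13 a21 a22 a23 a31 a32 a33 where B: "\<theta>' * B * \<theta> = M3 a11 a12 a13 a21 a22 a23 a31 a32 a33"
    by (cases "\<theta>' * B * \<theta>")
  obtain b11 b12 b13 b21 b22 b23 b31 b32 b33 where C: "\<theta>' * C * \<theta> = M3 b11 b12 b13 b21 b22 b23 b31 b32 b33"
    by (cases "\<theta>' * C * \<theta>")
  define T where "T = (diag3 1 \<eta> (\<eta> * \<eta>), M3 a11 a12 a13 a21 a22 a23 a31 a32 a33,
    M3 b11 b12 b13 b21 b22 b23 b31 b32 b33)"
  have "conj3 S T"
    unfolding S_def T_def
    by (rule conj3I[OF \<theta>]) (simp_all add: \<theta>(1) flip: B C mult.assoc)
  then have T: "T \<in> triples (weierstrass a b)" using conj3_triples conj3_sym S by blast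
  have a: "(1 - \<eta>) * (a / (1 - \<eta>)) = a" using prim_cbrt(4)[OF \<eta>] by simp
  have "\<exists>r \<in> reps1 a b \<eta> \<union> reps2 a b. conj3 T r"
  proof (cases "a12 * a21 = 0")
    case False
    from rep1_normal[OF \<eta> a False T[unfolded T_def]] show ?thesis
      unfolding reps1_def T_def by blast
  next
    case p: True
    have T1: "(diag3 1 (1 * \<eta>) (1 * (\<eta> * \<eta>)), M3 a11 a12 a13 a21 a22 a23 a31 a32 a33,
      M3 b11 b12 b13 b21 b22 b23 b31 b32 b33) \<in> triples (weierstrass a b)"
      using T by (simp add: T_def)
    have a': "(1 - \<eta>) * 1 * (a / (1 - \<eta>)) = a" using a by simp
    note D = diag_equations[OF \<eta> a' T1]
    have q: "a23 * a32 = 0" "a31 * a13 = 0" using D(8,9) p by simp_all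
    show ?thesis
    proof (cases "a12 * a23 \<noteq> 0 \<or> a23 * a31 \<noteq> 0 \<or> a31 * a12 \<noteq> 0")
      case True
      from rep2_normal_rotated[OF \<eta> p q True T1] show ?thesis by (simp add: T_def) blast
    next
      case False
      \<comment> \<open>The relation with value \<open>-1\<close> is a sum of terms containing two
        entries of \<open>B\<close> from the same 3-cycle. If all these pairs vanish for one cycle,
        some pair on the reverse cycle is nonzero.\<close>
      then have "a21 * a13 \<noteq> 0 \<or> a13 * a32 \<noteq> 0 \<or> a32 * a21 \<noteq> 0"
        using D(15) by (auto simp: mult_ac)
      moreover have \<eta>2: "prim_cbrt (\<eta> * \<eta>)"
        using \<eta> unfolding prim_cbrt_def by Groebner_Basis.algebra
      \<comment> \<open>Swapping two basis vectors reverses the cyclic direction: the new parameters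
        are \<open>\<mu> = \<eta>\<close> and the primitive root
        \<open>\<eta> * \<eta>\<close>.\<close>
      let ?T' = "(diag3 \<eta> 1 (\<eta> * \<eta>), M3 a22 a21 a23 a12 a11 a13 a32 a31 a33,
        M3 b22 b21 b23 b12 b11 b13 b32 b31 b33)"
      have c: "conj3 T ?T'" unfolding T_def by (rule conj3_swap)
      have e: "\<eta> * (\<eta> * \<eta>) = 1" "\<eta> * (\<eta> * \<eta> * (\<eta> * \<eta>)) = \<eta> * \<eta>"
        using \<eta> unfolding prim_cbrt_def by Groebner_Basis.algebra+
      have "?T' \<in> triples (weierstrass a b)" by (rule conj3_triples[OF conj3_sym[OF c] T])
      then have "\<exists>r\<in>reps2 a b. conj3 ?T' r"
        using rep2_normal_rotated[OF \<eta>2, of a21 a12 a13 a31 a32 a23 \<eta> a22 a11 a33] p q calculation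
        by (simp add: e mult_ac)
      then show ?thesis using conj3_trans[OF c] by blast
    qed
  qed
  then show ?thesis using conj3_trans[OF \<open>conj3 S T\<close>] by blast
qed

lemma reps_triples:
  fixes a :: "'k::field_char_0"
  assumes \<eta>: "prim_cbrt \<eta>"
  shows "reps1 a b \<eta> \<union> reps2 a b \<subseteq> triples (weierstrass a b)"
proof
  fix r assume "r \<in> reps1 a b \<eta> \<union> reps2 a b"
  then consider d g1 g2 g3 where "r = rep1 \<eta> d g1 g2 g3" "sol1 \<eta> (a / (1 - \<eta>)) b d g1 g2 g3"
    | \<zeta> \<mu> v w where "r = rep2 \<zeta> (a / ((1 - \<zeta>) * \<mu>)) \<mu> v w" "prim_cbrt \<zeta>" "\<mu>^3 = 1"
      "sol2 \<zeta> (a / ((1 - \<zeta>) * \<mu>)) b v w"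
    unfolding reps1_def reps2_def by blast
  then show "r \<in> triples (weierstrass a b)"
  proof cases
    case 1
    have "(1 - \<eta>) * (a / (1 - \<eta>)) = a" using prim_cbrt(4)[OF \<eta>] by simp
    from rep1_triples[OF \<eta> this 1(2)] 1(1) show ?thesis by simp
  next
    case 2
    have "\<mu> \<noteq> 0" using 2(3) by auto
    then have "(1 - \<zeta>) * \<mu> * (a / ((1 - \<zeta>) * \<mu>)) = a" using prim_cbrt(4)[OF 2(2)] by simp
    from rep2_triples[OF 2(2) this 2(3,4)] 2(1) show ?thesis by simp
  qed
qed

section \<open>The normal forms are pairwise inequivalent\<close>

text \<open>When \<open>A\<close> and \<open>B\<close> already force the intertwiner to be scalar,
  conjugate triples coincide. Thus no freedom is left to identify different matrices
  \<open>C\<close>.\<close>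

lemma conj3_scalar:
  assumes "conj3 (A, B, C) (A', B', C')" "\<And>\<theta> \<theta>'. \<theta> * \<theta>' = 1 \<Longrightarrow> \<theta>' * \<theta> = 1 \<Longrightarrow> A * \<theta> = \<theta> * A' \<Longrightarrow>
    B * \<theta> = \<theta> * B' \<Longrightarrow> \<exists>s. \<theta> = s *# 1"
  shows "(A, B, C) = (A', B', C' :: 'k::field m3)"
proof -
  obtain \<theta> \<theta>' where \<theta>: "\<theta> * \<theta>' = 1" "\<theta>' * \<theta> = 1" "A * \<theta> = \<theta> * A'" "B * \<theta> = \<theta> * B'" "C * \<theta> = \<theta> * C'"
    using conj3E[OF assms(1)] .
  obtain s where s: "\<theta> = s *# 1" using assms(2)[OF \<theta>(1-4)] by blast
  have "s \<noteq> 0" using \<theta>(1) s by auto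
  have "M = M'" if "M * \<theta> = \<theta> * M'" for M M'
  proof -
    have "s *# (M - M') = 0" using that by (simp add: s sm_simps)
    then show ?thesis using \<open>s \<noteq> 0\<close> by (simp add: sm_eq_0)
  qed
  then show ?thesis using \<theta> by blast
qed

text \<open>Commuting with a matrix with distinct eigenvalues makes \<open>\<theta>\<close>
  diagonal, and the entries of \<open>B\<close> equate its three diagonal entries. The opposite
  signs at positions 21 and 31 rule out replacing \<open>d\<close> by \<open>- d\<close>.\<close>

lemma rep1_conj:
  fixes \<eta> :: "'k::field_char_0"
  assumes \<eta>: "prim_cbrt \<eta>" and d: "d \<noteq> 0"
    and "conj3 (rep1 \<eta> d g1 g2 g3) (rep1 \<eta> d' g1' g2' g3')"
  shows "rep1 \<eta> d g1 g2 g3 = rep1 \<eta> d' g1' g2' g3'"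
  unfolding rep1_def
proof (rule conj3_scalar[OF assms(3)[unfolded rep1_def]])
  fix \<theta> \<theta>' :: "'k m3"
  assume i: "\<theta> * \<theta>' = 1" "\<theta>' * \<theta> = 1"
    and A: "diag3 1 \<eta> (\<eta> * \<eta>) * \<theta> = \<theta> * diag3 1 \<eta> (\<eta> * \<eta>)"
    and B: "M3 0 d (-(\<eta>*\<eta>*d)) (-d) 0 d d (-(\<eta>*d)) 0 * \<theta> = \<theta> * M3 0 d' (-(\<eta>*\<eta>*d')) (-d') 0 d' d' (-(\<eta>*d')) 0"
  obtain t11 t12 t13 t21 t22 t23 t31 t32 t33 where \<theta>: "\<theta> = M3 t11 t12 t13 t21 t22 t23 t31 t32 t33" by (cases \<theta>)
  have off: "t12 = 0" "t13 = 0" "t21 = 0" "t23 = 0" "t31 = 0" "t32 = 0"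
  proof -
    have "t12 * (1 - \<eta>) = 0" "t13 * (1 - \<eta> * \<eta>) = 0" "t21 * (1 - \<eta>) = 0" "\<eta> * (t23 * (1 - \<eta>)) = 0"
      "t31 * (1 - \<eta> * \<eta>) = 0" "\<eta> * (t32 * (1 - \<eta>)) = 0"
      using A unfolding \<theta> diag3_def times_m3.simps m3.inject by (auto simp: algebra_simps)
    then show "t12 = 0" "t13 = 0" "t21 = 0" "t23 = 0" "t31 = 0" "t32 = 0"
      using prim_cbrt(3,4,7)[OF \<eta>] by auto
  qed
  have nz: "t11 \<noteq> 0" "t22 \<noteq> 0" "t33 \<noteq> 0"
    using i(1) by (cases \<theta>'; auto simp: \<theta> off one_m3_def)+
  have B: "d * t22 = t11 * d'" "d * t33 = t22 * d'" "d * t11 = t33 * d'" "d * t11 = t22 * d'"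
    using B[unfolded \<theta> off times_m3.simps m3.inject, simplified] by blast+
  have "t33 = t22" "t33 = t11" using B d by (metis mult_left_cancel mult.commute)+
  then show "\<exists>s. \<theta> = s *# 1" by (intro exI[of _ t11]) (simp add: \<theta> off one_m3_def)
qed

text \<open>An intertwiner of the two nilpotent matrices \<open>B\<close> is upper triangular with
  constant diagonal. Hence the eigenvalues agree in their order, and their distinctness removes the
  entries above the diagonal.\<close>

lemma rep2_conj:
  fixes \<eta> :: "'k::field_char_0"
  assumes \<eta>: "prim_cbrt \<eta>" and \<mu>: "\<mu>^3 = 1"
    and "conj3 (rep2 \<eta> k \<mu> v w) (rep2 \<eta>' k' \<mu>' v' w')"
  shows "rep2 \<eta> k \<mu> v w = rep2 \<eta>' k' \<mu>' v' w'"
  unfolding rep2_def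
proof (rule conj3_scalar[OF assms(3)[unfolded rep2_def]])
  fix \<theta> \<theta>' :: "'k m3"
  assume i: "\<theta> * \<theta>' = 1" "\<theta>' * \<theta> = 1"
    and A: "diag3 \<mu> (\<mu>*\<eta>) (\<mu>*(\<eta> * \<eta>)) * \<theta> = \<theta> * diag3 \<mu>' (\<mu>'*\<eta>') (\<mu>'*(\<eta>' * \<eta>'))"
    and B: "M3 0 1 (-(\<eta>*\<eta>*v)) 0 0 1 0 0 0 * \<theta> = \<theta> * M3 0 1 (-(\<eta>'*\<eta>'*v')) 0 0 1 0 0 0"
  have \<mu>0: "\<mu> \<noteq> 0" using \<mu> by auto
  obtain t11 t12 t13 t21 t22 t23 t31 t32 t33 where \<theta>: "\<theta> = M3 t11 t12 t13 t21 t22 t23 t31 t32 t33" by (cases \<theta>)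
  have t: "t21 = 0" "t31 = 0" "t32 = 0" "t22 = t11" "t33 = t11"
    using B by (auto simp: \<theta>)
  have nz: "t11 \<noteq> 0"
    using i(1) by (cases \<theta>'; auto simp: \<theta> t one_m3_def)
  have \<mu>': "\<mu> * \<eta> = \<mu>' * \<eta>'" "\<mu> * (\<eta> * \<eta>) = \<mu>' * (\<eta>' * \<eta>')"
    and t': "t12 = 0 \<or> \<mu> = \<mu>' * \<eta>'" "t13 = 0 \<or> \<mu> = \<mu>' * (\<eta>' * \<eta>')"
      "t23 = 0 \<or> \<mu> * \<eta> = \<mu>' * (\<eta>' * \<eta>')"
    using A nz unfolding \<theta> t diag3_def times_m3.simps m3.inject by (auto simp: mult.commute)
  have "t12 = 0" "t13 = 0" "t23 = 0"
    using t' \<mu>0 prim_cbrt(3-8)[OF \<eta>] unfolding \<mu>'[symmetric] by simp_all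
  then show "\<exists>s. \<theta> = s *# 1" by (intro exI[of _ t11]) (simp add: \<theta> t one_m3_def)
qed

text \<open>The last row of \<open>B\<close> in \<open>rep2\<close> is zero, so the last row of
  \<open>\<theta>\<close> is a left kernel vector of \<open>B\<close> in \<open>rep1\<close>, hence
  proportional to \<open>(\<eta>, 1, 1)\<close>. It would also have to be a left eigenvector of
  \<open>diag3 1 \<eta> (\<eta>*\<eta>)\<close>.\<close>

lemma rep1_rep2_not_conj:
  fixes \<eta> :: "'k::field_char_0"
  assumes \<eta>: "prim_cbrt \<eta>" and \<zeta>: "prim_cbrt \<zeta>" and d: "d \<noteq> 0"
  shows "\<not> conj3 (rep2 \<zeta> k \<mu> v w) (rep1 \<eta> d g1 g2 g3)"
proof
  assume "conj3 (rep2 \<zeta> k \<mu> v w) (rep1 \<eta> d g1 g2 g3)"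
  then obtain \<theta> \<theta>' where \<theta>: "\<theta> * \<theta>' = 1"
    "diag3 \<mu> (\<mu>*\<zeta>) (\<mu>*(\<zeta> * \<zeta>)) * \<theta> = \<theta> * diag3 1 \<eta> (\<eta>*\<eta>)"
    "M3 0 1 (-(\<zeta>*\<zeta>*v)) 0 0 1 0 0 0 * \<theta> = \<theta> * M3 0 d (-(\<eta>*\<eta>*d)) (-d) 0 d d (-(\<eta>*d)) 0"
    unfolding rep1_def rep2_def by (elim conj3E)
  obtain t11 t12 t13 t21 t22 t23 t31 t32 t33 where t: "\<theta> = M3 t11 t12 t13 t21 t22 t23 t31 t32 t33" by (cases \<theta>)
  have "t32 * d = t33 * d" "t31 * d = t33 * \<eta> * d" using \<theta>(3) by (auto simp: t algebra_simps)
  then have 1: "t32 = t33" "t31 = t33 * \<eta>" using d by auto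
  have "t33 \<noteq> 0"
    using \<theta>(1) by (cases \<theta>'; auto simp: t 1 one_m3_def)
  moreover have "\<mu> * (\<zeta> * \<zeta>) * t33 = t33 * \<eta>" "\<mu> * (\<zeta> * \<zeta>) * t33 = t33 * (\<eta> * \<eta>)"
    using \<theta>(2) by (auto simp: t 1 diag3_def)
  ultimately show False using prim_cbrt(6)[OF \<eta>] by simp
qed

lemma reps1E:
  fixes a :: "'k::field_char_0"
  assumes "r \<in> reps1 a b \<eta>"
  obtains d g1 g2 g3 where "r = rep1 \<eta> d g1 g2 g3" "d \<noteq> 0"
proof -
  obtain d g1 g2 g3 where *: "r = rep1 \<eta> d g1 g2 g3" "sol1 \<eta> (a / (1 - \<eta>)) b d g1 g2 g3"
    using assms unfolding reps1_def by blast
  moreover have "d \<noteq> 0" using *(2) by (auto simp: sol1_def)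
  ultimately show thesis using that by blast
qed

lemma reps2E:
  assumes "r \<in> reps2 a b"
  obtains \<eta> k \<mu> v w where "r = rep2 \<eta> k \<mu> v w" "prim_cbrt \<eta>" "\<mu>^3 = 1"
  using assms unfolding reps2_def by blast

lemma reps1_reps2_not_conj:
  fixes a :: "'k::field_char_0"
  assumes "prim_cbrt \<eta>" "r \<in> reps1 a b \<eta>" "s \<in> reps2 a b"
  shows "\<not> conj3 s r"
  using assms(2,3) rep1_rep2_not_conj[OF assms(1)] by (elim reps1E reps2E) simp

lemma reps_transversal:
  fixes a :: "'k::field_char_0"
  assumes \<eta>: "prim_cbrt \<eta>" and r: "r \<in> reps1 a b \<eta> \<union> reps2 a b" "s \<in> reps1 a b \<eta> \<union> reps2 a b"
    and c: "conj3 r s"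
  shows "r = s"
proof -
  consider "r \<in> reps1 a b \<eta>" "s \<in> reps1 a b \<eta>" | "r \<in> reps2 a b" "s \<in> reps2 a b"
    using r c conj3_sym[OF c] reps1_reps2_not_conj[OF \<eta>] by blast
  then show ?thesis
  proof cases
    case 1
    with c show ?thesis using rep1_conj[OF \<eta>] by (elim reps1E) simp
  next
    case 2
    with c show ?thesis using rep2_conj by (elim reps2E) simp
  qed
qed

section \<open>Counting the normal forms\<close>

text \<open>The positivity conditions supply finiteness, since infinite sets have cardinality
  0.\<close>

lemma card_Sigma_const:
  assumes "card A = m" "m > 0" "\<And>x. x \<in> A \<Longrightarrow> card (B x) = n" "n > 0"
  shows "card (Sigma A B) = m * n"
proof -
  have "finite A" using assms(1,2) card_ge_0_finite by blast
  moreover have "\<forall>x\<in>A. finite (B x)" using assms(3,4) card_ge_0_finite by metis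
  ultimately have "card (Sigma A B) = (\<Sum>x\<in>A. card (B x))" by (rule card_SigmaI)
  also have "\<dots> = m * n" using assms(1,3) by simp
  finally show ?thesis .
qed

text \<open>At most one \<open>e\<^sub>i\<close> vanishes, so the four sign patterns with a given product are distinct.\<close>

lemma card_signed_roots:
  fixes e1 :: "'k::{alg_closed_field, field_char_0}"
  assumes "4 * (e1 * e2 * e3) = b^2" and "e1 \<noteq> 0 \<or> e2 \<noteq> 0" "e2 \<noteq> 0 \<or> e3 \<noteq> 0" "e1 \<noteq> 0 \<or> e3 \<noteq> 0"
  shows "card {(g1, g2, g3). g1^2 = e1 \<and> g2^2 = e2 \<and> g3^2 = e3 \<and> 2*(g1*g2*g3) = b} = 4"
proof -
  obtain h1 h2 h3 where h: "h1^2 = e1" "h2^2 = e2" "h3^2 = e3"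
    using nth_root_exists[of 2] by (metis zero_less_numeral)
  have "(2*(h1*h2*h3))^2 = b^2"
    using assms(1) h by (auto simp: power_mult_distrib)
  then have "2*(h1*h2*h3) = b \<or> 2*(h1*h2*h3) = - b" by (simp only: power2_eq_iff)
  then obtain g1 g2 g3 where g: "g1^2 = e1" "g2^2 = e2" "g3^2 = e3" "2*(g1*g2*g3) = b"
  proof
    assume "2*(h1*h2*h3) = - b"
    then have "2*((-h1)*h2*h3) = b" by simp
    then show thesis using that[of "-h1" h2 h3] h by simp
  qed (use that h in blast)
  have nz: "g1 \<noteq> 0 \<or> g2 \<noteq> 0" "g2 \<noteq> 0 \<or> g3 \<noteq> 0" "g1 \<noteq> 0 \<or> g3 \<noteq> 0" using g assms by auto
  have neg: "u = - u \<longleftrightarrow> u = 0" "- u = u \<longleftrightarrow> u = 0" for u :: 'k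
  proof -
    have "u + u = 0 \<longleftrightarrow> u = 0" by (simp flip: mult_2)
    then show "u = - u \<longleftrightarrow> u = 0" "- u = u \<longleftrightarrow> u = 0"
      by (simp_all add: eq_neg_iff_add_eq_0 neg_eq_iff_add_eq_0)
  qed
  have "{(x1, x2, x3). x1^2 = e1 \<and> x2^2 = e2 \<and> x3^2 = e3 \<and> 2*(x1*x2*x3) = b} =
    {(g1, g2, g3), (g1, -g2, -g3), (-g1, g2, -g3), (-g1, -g2, g3)}" (is "?L = ?R")
  proof
    show "?R \<subseteq> ?L" using g by auto
    show "?L \<subseteq> ?R"
    proof
      fix x assume "x \<in> ?L"
      then obtain x1 x2 x3 where [simp]: "x = (x1, x2, x3)"
        and x: "x1^2 = g1^2" "x2^2 = g2^2" "x3^2 = g3^2" "2*(x1*x2*x3) = 2*(g1*g2*g3)"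
        using g by auto
      have "x1 = g1 \<or> x1 = - g1" "x2 = g2 \<or> x2 = - g2" "x3 = g3 \<or> x3 = - g3"
        using x by (simp_all only: power2_eq_iff)
      moreover have "g1*g2*g3 = x1*x2*x3" using x(4) by simp
      ultimately show "x \<in> ?R" by (elim disjE) (auto simp: neg)
    qed
  qed
  moreover have "card ?R = 4" using nz by (auto simp: neg card_insert_if)
  ultimately show ?thesis by simp
qed

lemma card_reps1:
  fixes a :: "'k::{alg_closed_field, field_char_0}"
  assumes \<eta>: "prim_cbrt \<eta>" and disc: "4 * a^3 + 27 * b^2 \<noteq> 0"
  shows "card (reps1 a b \<eta>) = 24"
proof -
  have e: "\<eta> * \<eta> + \<eta> + 1 = 0" using \<eta> by (simp add: prim_cbrt_def)
  define k where "k = a / (1 - \<eta>)"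
  have a: "a = (1 - \<eta>) * k" using prim_cbrt(4)[OF \<eta>] by (simp add: k_def)
  \<comment> \<open>With this \<open>t\<close> the squares of \<open>g1\<close>, \<open>g2\<close>,
    \<open>g3\<close> become \<open>c + t\<close>, \<open>c + \<eta> * t\<close>,
    \<open>c + \<eta> * \<eta> * t\<close>, whose product is \<open>c^3 + t^3\<close>.\<close>
  define t where "t = - (\<eta> * a) / 3"
  have t: "3 * t = - (\<eta> * a)" by (simp add: t_def)
  have t': "\<eta> * \<eta> * k = (1 - \<eta>) * t" "\<eta> * k = (\<eta> * \<eta> - 1) * t"
  proof -
    have "3 * (\<eta> * \<eta> * k - (1 - \<eta>) * t) = 0" "3 * (\<eta> * k - (\<eta> * \<eta> - 1) * t) = 0"
      using t a e by Groebner_Basis.algebra+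
    then show "\<eta> * \<eta> * k = (1 - \<eta>) * t" "\<eta> * k = (\<eta> * \<eta> - 1) * t" by simp_all
  qed
  \<comment> \<open>The condition on the product of the \<open>g\<close>'s fixes
    \<open>c^3 = K\<close>. Here \<open>108 * K\<close> is
    \<open>4 * a^3 + 27 * b^2\<close>.\<close>
  define K where "K = b^2 / 4 - t^3"
  have K: "4 * (K + t^3) = b^2" by (simp add: K_def)
  have "K \<noteq> 0"
  proof
    assume "K = 0"
    then have "4 * a^3 + 27 * b^2 = 0" using K t e by Groebner_Basis.algebra
    then show False using disc by simp
  qed
  define G where "G c = {(g1, g2, g3). g1^2 = c + t \<and> g2^2 = c + \<eta> * t \<and> g3^2 = c + \<eta> * \<eta> * t \<and> 2*(g1*g2*g3) = b}" for c
  define D :: "'k \<times> 'k \<times> 'k \<Rightarrow> 'k set" where "D = (\<lambda>(g1, g2, g3). {d. 2 * (d^2 * (g1 + g2 + g3)) = -1})"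
  define S where "S = Sigma {c. c^3 = K} (\<lambda>c. Sigma (G c) D)"
  have cG: "card (G c) = 4" if "c^3 = K" for c
    unfolding G_def
  proof (rule card_signed_roots)
    have c0: "c \<noteq> 0" using that \<open>K \<noteq> 0\<close> by auto
    show "4 * ((c + t) * (c + \<eta> * t) * (c + \<eta> * \<eta> * t)) = b^2"
    proof -
      have "(c + t) * (c + \<eta> * t) * (c + \<eta> * \<eta> * t) = c^3 + t^3"
        using e by Groebner_Basis.algebra
      then show ?thesis using that K by simp
    qed
    have "t = 0" if "u \<noteq> v" "c + u * t = 0" "c + v * t = 0" for u v
    proof -
      have "(u - v) * t = 0" using that(2,3) by Groebner_Basis.algebra
      then show ?thesis using that(1) by simp
    qed
    from this[of 1 \<eta>] this[of \<eta> "\<eta>*\<eta>"] this[of 1 "\<eta>*\<eta>"] c0 prim_cbrt(3-8)[OF \<eta>]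
    show "c + t \<noteq> 0 \<or> c + \<eta> * t \<noteq> 0" "c + \<eta> * t \<noteq> 0 \<or> c + \<eta> * \<eta> * t \<noteq> 0"
      "c + t \<noteq> 0 \<or> c + \<eta> * \<eta> * t \<noteq> 0"
      by (metis mult_1_left mult_zero_right add_0_right)+
  qed
  have cD: "card (D g) = 2" if "c^3 = K" "g \<in> G c" for c g
  proof -
    obtain g1 g2 g3 where g: "g = (g1, g2, g3)" by (metis prod_cases3)
    have g': "g1^2 = c + t" "g2^2 = c + \<eta> * t" "g3^2 = c + \<eta> * \<eta> * t"
      using that(2) by (auto simp: G_def g)
    define s where "s = g1 + g2 + g3"
    have "s \<noteq> 0"
    proof
      assume "s = 0"
      then have g3: "g3 = - g1 - g2" by (simp add: s_def eq_neg_iff_add_eq_0 algebra_simps)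
      \<comment> \<open>If three numbers sum to zero, their squares \<open>x, y, z\<close> satisfy
        \<open>(x + y + z)^2 = 4 * (x*y + y*z + z*x)\<close>. For the present squares the two sides
        are \<open>9 * c^2\<close> and \<open>12 * c^2\<close>.\<close>
      have "3 * c^2 = 0" using g' e unfolding g3 by Groebner_Basis.algebra
      then show False using that(1) \<open>K \<noteq> 0\<close> by auto
    qed
    have "D g = {d. 2 * (d^2 * s) = -1}" by (simp add: D_def g s_def)
    also have "\<dots> = {d. d^2 = - 1 / (2 * s)}"
      using \<open>s \<noteq> 0\<close> by (auto simp: field_simps)
    finally have "D g = {d. d^2 = - 1 / (2 * s)}" .
    then show ?thesis using \<open>s \<noteq> 0\<close> by (simp add: card_roots_of_power)
  qed
  have "card (Sigma (G c) D) = 4 * 2" if "c^3 = K" for c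
    by (rule card_Sigma_const) (use cG cD that in auto)
  then have "card S = 3 * (4 * 2)"
    unfolding S_def using \<open>K \<noteq> 0\<close>
    by (intro card_Sigma_const[where n = "4 * 2"]) (simp_all add: card_roots_of_power)
  moreover define f where "f = (\<lambda>(c :: 'k, (g1, g2, g3), d). rep1 \<eta> d g1 g2 g3)"
  moreover have "inj_on f S"
  proof (rule inj_onI)
    fix x y assume "x \<in> S" "y \<in> S" "f x = f y"
    then show "x = y"
      by (auto simp: S_def G_def f_def rep1_def)
  qed
  moreover have "f ` S = reps1 a b \<eta>"
  proof (intro equalityI subsetI)
    fix r assume "r \<in> f ` S"
    then obtain c g1 g2 g3 d where r: "r = rep1 \<eta> d g1 g2 g3" and c: "c^3 = K"
      and g: "g1^2 = c + t" "g2^2 = c + \<eta> * t" "g3^2 = c + \<eta> * \<eta> * t" "2*(g1*g2*g3) = b"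
      and d: "2 * (d^2 * (g1 + g2 + g3)) = -1"
      by (auto simp: S_def G_def D_def f_def)
    have "g2^2 = g1^2 - \<eta>*\<eta>*k" "g3^2 = g1^2 + \<eta>*k"
      unfolding g t' by (simp_all add: algebra_simps)
    then show "r \<in> reps1 a b \<eta>"
      unfolding reps1_def sol1_def r k_def[symmetric] using g(4) d by blast
  next
    fix r assume "r \<in> reps1 a b \<eta>"
    then obtain d g1 g2 g3 where r: "r = rep1 \<eta> d g1 g2 g3" "sol1 \<eta> k b d g1 g2 g3"
      unfolding reps1_def k_def by blast
    define c where "c = g1^2 - t"
    have g: "g1^2 = c + t" "g2^2 = c + \<eta> * t" "g3^2 = c + \<eta> * \<eta> * t" "2*(g1*g2*g3) = b"
      "2 * (d^2 * (g1 + g2 + g3)) = -1"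
      using r(2) unfolding sol1_def t' c_def by (simp_all add: algebra_simps)
    have "4 * (g1^2 * g2^2 * g3^2) = b^2" unfolding g(4)[symmetric] by (simp add: power_mult_distrib)
    then have "4 * (c^3 - K) = 0" using K e unfolding g(1-3) by Groebner_Basis.algebra
    then have "c^3 = K" by simp
    then have "(c, (g1, g2, g3), d) \<in> S" using g by (simp add: S_def G_def D_def)
    then show "r \<in> f ` S" unfolding r(1) by (intro image_eqI) (auto simp: f_def)
  qed
  ultimately show ?thesis using card_image[of f S] by simp
qed

lemma card_sol2:
  fixes k :: "'k::{alg_closed_field, field_char_0}"
  assumes \<eta>: "prim_cbrt \<eta>" and disc: "4 * ((1 - \<eta>) * k)^3 + 27 * b^2 \<noteq> 0"
  shows "card {(v, w). sol2 \<eta> k b v w} = 8"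
proof -
  have e: "\<eta> * \<eta> + \<eta> + 1 = 0" using \<eta> by (simp add: prim_cbrt_def)
  \<comment> \<open>Eliminating \<open>w\<close> from \<open>sol2\<close> by
    \<open>(2 * (v * w))^2 = 4 * v^2 * w^2\<close> gives \<open>poly h (v^2) = 0\<close>. Up to the
    factor 3 and the sign of the variable, \<open>h\<close> is the 3-division polynomial of
    \<open>y^2 = x^3 + (1 - \<eta>) * k * x + b\<close>.\<close>
  define h where "h = [:\<eta> * k^2, - (4 * b), 2 * ((1 - \<eta>) * k), 0, 1:]"
  have h: "poly h u = u^4 + 2 * ((1 - \<eta>) * k) * u^2 - 4 * b * u + \<eta> * k^2" for u
    by (simp add: h_def power2_eq_square power4_eq_xxxx algebra_simps)
  have h': "poly (pderiv h) u = 4 * u^3 + 4 * ((1 - \<eta>) * k) * u - 4 * b" for u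
    by (simp add: h_def pderiv_pCons power3_eq_cube algebra_simps)
  have sep: "poly (pderiv h) u \<noteq> 0" if "poly h u = 0" for u
  proof
    assume d: "poly (pderiv h) u = 0"
    define A where "A = (1 - \<eta>) * k"
    have "4 * (b - (u^3 + A * u)) = 0" using d by (simp add: h' A_def algebra_simps)
    then have b: "b = u^3 + A * u" by (simp only: mult_eq_0_iff right_minus_eq) simp
    \<comment> \<open>With \<open>b\<close> taken from \<open>h' = 0\<close>, this turns
      \<open>3 * h\<close> into \<open>- ((3 * u^2 + A)^2)\<close>: at a multiple root,
      \<open>A = - 3 * u^2\<close> and \<open>b = - 2 * u^3\<close>.\<close>
    have "3 * (\<eta> * k^2) = - (A^2)" using e unfolding A_def by Groebner_Basis.algebra
    then have "(3 * u^2 + A)^2 = 0"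
      using that unfolding h A_def[symmetric] b by Groebner_Basis.algebra
    then have A: "A = - (3 * u^2)" by (simp add: eq_neg_iff_add_eq_0 add.commute)
    have "4 * A^3 + 27 * b^2 = 0" unfolding b A by (simp add: power2_eq_square power3_eq_cube algebra_simps)
    then show False using disc by (simp add: A_def)
  qed
  have ch: "card {u. poly h u = 0} = 4"
    using card_roots_separable[OF _ sep] by (simp add: h_def)
  \<comment> \<open>Each root \<open>u\<close> carries exactly the two solutions
    \<open>(v, w)\<close> and \<open>(-v, -w)\<close>. For \<open>u = 0\<close> one has
    \<open>v = 0\<close>, and they are distinguished by \<open>w\<close>.\<close>
  define F where "F u = {(v, w). v^2 = u \<and> sol2 \<eta> k b v w}" for u
  have neg: "u = - u \<longleftrightarrow> u = 0" for u :: 'k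
  proof -
    have "u + u = 0 \<longleftrightarrow> u = 0" by (simp flip: mult_2)
    then show ?thesis by (simp add: eq_neg_iff_add_eq_0)
  qed
  have cF: "card (F u) = 2" if u: "poly h u = 0" for u
  proof -
    have hu: "(\<eta>*\<eta>*k - u^2)^2 = 4 * u * (b + \<eta>*k*u)"
      using u e unfolding h by Groebner_Basis.algebra
    have "\<exists>v w. v^2 = u \<and> sol2 \<eta> k b v w"
    proof (cases "u = 0")
      case True
      then have "k = 0" using hu prim_cbrt(3)[OF \<eta>] by simp
      obtain w where "w^2 = b" using nth_root_exists[of 2 b] by auto
      then show ?thesis using True \<open>k = 0\<close> by (intro exI[of _ 0] exI[of _ w]) (simp add: sol2_def)
    next
      case False
      obtain v where v: "v^2 = u" using nth_root_exists[of 2 u] by auto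
      then have "v \<noteq> 0" using False by auto
      define w where "w = (\<eta>*\<eta>*k - u^2) / (2 * v)"
      have w: "2 * (v * w) = \<eta>*\<eta>*k - u^2" using \<open>v \<noteq> 0\<close> by (simp add: w_def)
      have "4 * u * w^2 = (2 * (v * w))^2" using v by (simp add: power_mult_distrib)
      also have "\<dots> = 4 * u * (b + \<eta>*k*u)" unfolding w hu ..
      finally have "w^2 = b + \<eta>*k*u" using False by simp
      then show ?thesis using v w by (intro exI[of _ v] exI[of _ w]) (auto simp: sol2_def)
    qed
    then obtain v w where vw: "v^2 = u" "sol2 \<eta> k b v w" by blast
    have nz: "v \<noteq> 0 \<or> w \<noteq> 0"
    proof (rule ccontr)
      assume "\<not> (v \<noteq> 0 \<or> w \<noteq> 0)"
      then have "k = 0" "b = 0" using vw prim_cbrt(3)[OF \<eta>] by (auto simp: sol2_def)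
      then show False using disc by simp
    qed
    have "F u = {(v, w), (-v, -w)}"
    proof
      show "{(v, w), (-v, -w)} \<subseteq> F u" using vw by (auto simp: F_def sol2_def)
      show "F u \<subseteq> {(v, w), (-v, -w)}"
      proof
        fix p assume "p \<in> F u"
        then obtain v' w' where p: "p = (v', w')" "v'^2 = u" "sol2 \<eta> k b v' w'" by (auto simp: F_def)
        have v': "v' = v \<or> v' = - v" using p(2) vw(1) by (simp flip: power2_eq_iff)
        have v4: "v'^4 = v^4" using v' by auto
        have "2 * (v' * w') = 2 * (v * w)"
          using p(3) vw(2) v4 unfolding sol2_def by metis
        then have "v' * w' = v * w" by simp
        moreover have "w' = w \<or> w' = - w"
          using p(2,3) vw by (simp add: sol2_def flip: power2_eq_iff)
        ultimately have ww: "w' = w \<or> w' = - w" "v' * w' = v * w" by blast+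
        then show "p \<in> {(v, w), (-v, -w)}"
          using v' unfolding p(1) by (cases "v = 0") auto
      qed
    qed
    then show ?thesis using nz by (auto simp: neg card_insert_if)
  qed
  have "card (Sigma {u. poly h u = 0} F) = 4 * 2"
    using ch cF by (intro card_Sigma_const) auto
  moreover have "inj_on snd (Sigma {u. poly h u = 0} F)"
    by (rule inj_onI) (auto simp: F_def)
  moreover have "snd ` Sigma {u. poly h u = 0} F = {(v, w). sol2 \<eta> k b v w}"
  proof
    show "{(v, w). sol2 \<eta> k b v w} \<subseteq> snd ` Sigma {u. poly h u = 0} F"
    proof clarify
      fix v w assume s: "sol2 \<eta> k b v w"
      have "poly h (v^2) = 0"
        using s e unfolding h sol2_def by Groebner_Basis.algebra
      then have "(v^2, (v, w)) \<in> Sigma {u. poly h u = 0} F" using s by (simp add: F_def)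
      then show "(v, w) \<in> snd ` Sigma {u. poly h u = 0} F" by force
    qed
  qed (auto simp: F_def)
  ultimately show ?thesis using card_image by fastforce
qed

lemma card_reps2:
  fixes a :: "'k::{alg_closed_field, field_char_0}"
  assumes disc: "4 * a^3 + 27 * b^2 \<noteq> 0"
  shows "card (reps2 a b) = 48"
proof -
  define k where "k \<eta> \<mu> = a / ((1 - \<eta>) * \<mu>)" for \<eta> \<mu>
  define S where "S = Sigma {\<eta> :: 'k. prim_cbrt \<eta>} (\<lambda>\<eta>. Sigma {\<mu>. \<mu>^3 = 1} (\<lambda>\<mu>. {(v, w). sol2 \<eta> (k \<eta> \<mu>) b v w}))"
  have "card {(v, w). sol2 \<eta> (k \<eta> \<mu>) b v w} = 8" if "prim_cbrt \<eta>" "\<mu>^3 = 1" for \<eta> \<mu>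
  proof (rule card_sol2[OF that(1)])
    \<comment> \<open>Its cube is \<open>a^3\<close> because \<open>\<mu>^3 = 1\<close>, so all
      choices of \<open>\<mu>\<close> and \<open>\<eta>\<close> give the same discriminant.\<close>
    have "(1 - \<eta>) * k \<eta> \<mu> = a / \<mu>" using prim_cbrt(4)[OF that(1)] by (simp add: k_def)
    then show "4 * ((1 - \<eta>) * k \<eta> \<mu>)^3 + 27 * b^2 \<noteq> 0" using disc that(2) by (simp add: power_divide)
  qed
  then have "card (Sigma {\<mu>. \<mu>^3 = 1} (\<lambda>\<mu>. {(v, w). sol2 \<eta> (k \<eta> \<mu>) b v w})) = 3 * 8" if "prim_cbrt \<eta>" for \<eta>
    using that by (intro card_Sigma_const) (auto simp: card_roots_of_power)
  then have "card S = 2 * (3 * 8)"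
    unfolding S_def by (rule card_Sigma_const[rotated 2]) (simp_all add: card_prim_cbrt)
  moreover define f where "f = (\<lambda>(\<eta>, \<mu>, v, w). rep2 \<eta> (k \<eta> \<mu>) \<mu> v w)"
  moreover have "inj_on f S"
    by (rule inj_onI) (auto simp: S_def f_def rep2_def diag3_def)
  moreover have "f ` S = reps2 a b"
    unfolding reps2_def S_def f_def k_def by (force simp: image_iff)
  ultimately show ?thesis using card_image[of f S] by simp
qed

section \<open>Irreducibility\<close>

definition generating :: "'k::comm_ring_1 triple \<Rightarrow> bool"
  where "generating T \<longleftrightarrow> (\<forall>S. 1 \<in> S \<and> (\<forall>M\<in>S. \<forall>N\<in>S. M + N \<in> S \<and> M * N \<in> S) \<and> (\<forall>c. \<forall>M\<in>S. c *# M \<in> S) \<and>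
    fst T \<in> S \<and> fst (snd T) \<in> S \<and> snd (snd T) \<in> S \<longrightarrow> S = UNIV)"

lemma generating_conj3:
  assumes "conj3 T U" "generating U"
  shows "generating T"
  unfolding generating_def
proof (intro allI impI)
  fix S assume S: "1 \<in> S \<and> (\<forall>M\<in>S. \<forall>N\<in>S. M + N \<in> S \<and> M * N \<in> S) \<and> (\<forall>c. \<forall>M\<in>S. c *# M \<in> S) \<and>
    fst T \<in> S \<and> fst (snd T) \<in> S \<and> snd (snd T) \<in> S"
  obtain \<theta> \<theta>' where \<theta>: "\<theta> * \<theta>' = 1" "\<theta>' * \<theta> = 1"
    "T = (\<theta> * fst U * \<theta>', \<theta> * fst (snd U) * \<theta>', \<theta> * snd (snd U) * \<theta>')"
    using assms(1) unfolding conj3_def by blast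
  define S' where "S' = {M. \<theta> * M * \<theta>' \<in> S}"
  have 1: "\<theta> * (M + N) * \<theta>' = \<theta> * M * \<theta>' + \<theta> * N * \<theta>'" "\<theta> * (c *# M) * \<theta>' = c *# (\<theta> * M * \<theta>')" for M N c
    by (simp_all only: distrib_left distrib_right sm_simps(5,6))
  have 2: "\<theta> * (M * N) * \<theta>' = (\<theta> * M * \<theta>') * (\<theta> * N * \<theta>')" for M N
  proof -
    have "(\<theta> * M * \<theta>') * (\<theta> * N * \<theta>') = \<theta> * M * (\<theta>' * \<theta>) * N * \<theta>'" by (simp only: mult.assoc)
    then show ?thesis by (simp add: \<theta>(2) mult.assoc)
  qed
  have "1 \<in> S'" "\<forall>M\<in>S'. \<forall>N\<in>S'. M + N \<in> S' \<and> M * N \<in> S'" "\<forall>c. \<forall>M\<in>S'. c *# M \<in> S'"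
    "fst U \<in> S'" "fst (snd U) \<in> S'" "snd (snd U) \<in> S'"
    using S unfolding S'_def mem_Collect_eq 1 2 by (simp_all add: \<theta>)
  then have "S' = UNIV" using assms(2) unfolding generating_def by blast
  show "S = UNIV"
  proof (intro equalityI subsetI UNIV_I)
    fix M
    have "\<theta>' * M * \<theta> \<in> S'" using \<open>S' = UNIV\<close> by simp
    then have "\<theta> * (\<theta>' * M * \<theta>) * \<theta>' \<in> S" by (simp add: S'_def)
    moreover have "\<theta> * (\<theta>' * M * \<theta>) * \<theta>' = (\<theta> * \<theta>') * M * (\<theta> * \<theta>')" by (simp only: mult.assoc)
    ultimately show "M \<in> S" by (simp add: \<theta>(1))
  qed
qed

text \<open>Interpolation at the distinct eigenvalues puts the diagonal matrix units into the
  algebra. They cut the units at 12, 23 and 31 out of \<open>B\<close> and \<open>C\<close>, and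
  products along this 3-cycle give the rest.\<close>

lemma generating_cycle:
  fixes l1 :: "'k::field"
  assumes l: "l1 \<noteq> l2" "l2 \<noteq> l3" "l1 \<noteq> l3" and B: "e12 B \<noteq> 0" "e23 B \<noteq> 0" and C: "e31 B \<noteq> 0 \<or> e31 C \<noteq> 0"
  shows "generating (diag3 l1 l2 l3, B, C)"
  unfolding generating_def
proof (intro allI impI)
  fix S assume "1 \<in> S \<and> (\<forall>M\<in>S. \<forall>N\<in>S. M + N \<in> S \<and> M * N \<in> S) \<and> (\<forall>c. \<forall>M\<in>S. c *# M \<in> S) \<and>
    fst (diag3 l1 l2 l3, B, C) \<in> S \<and> fst (snd (diag3 l1 l2 l3, B, C)) \<in> S \<and> snd (snd (diag3 l1 l2 l3, B, C)) \<in> S"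
  then have S: "1 \<in> S" "\<And>M N. M \<in> S \<Longrightarrow> N \<in> S \<Longrightarrow> M + N \<in> S" "\<And>M N. M \<in> S \<Longrightarrow> N \<in> S \<Longrightarrow> M * N \<in> S"
    "\<And>c M. M \<in> S \<Longrightarrow> c *# M \<in> S" "diag3 l1 l2 l3 \<in> S" "B \<in> S" "C \<in> S" by auto
  have D: "diag3 l1 l2 l3 + c *# 1 \<in> S" for c using S by blast
  have P: "diag3 1 0 0 \<in> S" "diag3 0 1 0 \<in> S" "diag3 0 0 1 \<in> S"
  proof -
    have "diag3 1 0 0 = (1 / ((l1 - l2) * (l1 - l3))) *# ((diag3 l1 l2 l3 + (-l2) *# 1) * (diag3 l1 l2 l3 + (-l3) *# 1))"
      "diag3 0 1 0 = (1 / ((l2 - l1) * (l2 - l3))) *# ((diag3 l1 l2 l3 + (-l1) *# 1) * (diag3 l1 l2 l3 + (-l3) *# 1))"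
      "diag3 0 0 1 = (1 / ((l3 - l1) * (l3 - l2))) *# ((diag3 l1 l2 l3 + (-l1) *# 1) * (diag3 l1 l2 l3 + (-l2) *# 1))"
      using l by (simp_all add: m3_unfold)
    then show "diag3 1 0 0 \<in> S" "diag3 0 1 0 \<in> S" "diag3 0 0 1 \<in> S" using D S(3,4) by metis+
  qed
  have E12: "M3 0 1 0 0 0 0 0 0 0 \<in> S"
  proof -
    have "M3 0 1 0 0 0 0 0 0 0 = (1 / e12 B) *# (diag3 1 0 0 * B * diag3 0 1 0)"
      using B by (cases B) (simp add: m3_unfold)
    then show ?thesis using P S by metis
  qed
  have E23: "M3 0 0 0 0 0 1 0 0 0 \<in> S"
  proof -
    have "M3 0 0 0 0 0 1 0 0 0 = (1 / e23 B) *# (diag3 0 1 0 * B * diag3 0 0 1)"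
      using B by (cases B) (simp add: m3_unfold)
    then show ?thesis using P S by metis
  qed
  have E31: "M3 0 0 0 0 0 0 1 0 0 \<in> S"
  proof -
    have "M3 0 0 0 0 0 0 1 0 0 = (1 / e31 M) *# (diag3 0 0 1 * M * diag3 1 0 0)" if "e31 M \<noteq> 0" for M :: "'k m3"
      using that by (cases M) (simp add: m3_unfold)
    then show ?thesis using C P S by metis
  qed
  have E13: "M3 0 0 1 0 0 0 0 0 0 \<in> S" using S(3)[OF E12 E23] by simp
  have E21: "M3 0 0 0 1 0 0 0 0 0 \<in> S" using S(3)[OF E23 E31] by simp
  have E32: "M3 0 0 0 0 0 0 0 1 0 \<in> S" using S(3)[OF E31 E12] by simp
  show "S = UNIV"
  proof (intro equalityI subsetI UNIV_I)
    fix M :: "'k m3"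
    obtain a b c d e f g h i where M: "M = M3 a b c d e f g h i" by (cases M)
    have "M = a *# diag3 1 0 0 + b *# M3 0 1 0 0 0 0 0 0 0 + c *# M3 0 0 1 0 0 0 0 0 0 +
      d *# M3 0 0 0 1 0 0 0 0 0 + e *# diag3 0 1 0 + f *# M3 0 0 0 0 0 1 0 0 0 +
      g *# M3 0 0 0 0 0 0 1 0 0 + h *# M3 0 0 0 0 0 0 0 1 0 + i *# diag3 0 0 1"
      by (simp add: M diag3_def)
    also have "\<dots> \<in> S"
      by (intro S(2) S(4) P E12 E13 E21 E23 E31 E32)
    finally show "M \<in> S" .
  qed
qed

lemma generating_reps:
  fixes a :: "'k::field_char_0"
  assumes \<eta>: "prim_cbrt \<eta>" and r: "r \<in> reps1 a b \<eta> \<union> reps2 a b"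
  shows "generating r"
  using r
proof
  assume "r \<in> reps1 a b \<eta>"
  then show ?thesis
    using prim_cbrt(4,6,7)[OF \<eta>] by (elim reps1E) (auto simp: rep1_def intro!: generating_cycle)
next
  assume "r \<in> reps2 a b"
  then obtain \<zeta> k \<mu> v w where r: "r = rep2 \<zeta> k \<mu> v w" and \<zeta>: "prim_cbrt \<zeta>" and "\<mu>^3 = 1" by (rule reps2E)
  have "\<mu> \<noteq> 0" using \<open>\<mu>^3 = 1\<close> by auto
  then show ?thesis
    unfolding r rep2_def using prim_cbrt(3,4,6,7)[OF \<zeta>] by (intro generating_cycle) auto
qed

text \<open>Irreducibility and the transversal are bundled so that both are transported together
  through the linear change of variables.\<close>

definition seventy_two_classes :: "('k::comm_ring_1 \<Rightarrow> 'k \<Rightarrow> 'k \<Rightarrow> 'k) \<Rightarrow> bool"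
  where "seventy_two_classes F \<longleftrightarrow> (\<forall>T\<in>triples F. generating T) \<and>
    (\<exists>R \<subseteq> triples F. card R = 72 \<and> (\<forall>T\<in>triples F. \<exists>r\<in>R. conj3 T r) \<and>
      (\<forall>r\<in>R. \<forall>s\<in>R. conj3 r s \<longrightarrow> r = s))"

lemma seventy_two_classes_weierstrass:
  fixes a :: "'k::{alg_closed_field, field_char_0}"
  assumes disc: "4 * a^3 + 27 * b^2 \<noteq> 0"
  shows "seventy_two_classes (weierstrass a b)"
proof -
  obtain \<eta> :: 'k where \<eta>: "prim_cbrt \<eta>" by (rule prim_cbrt_exists)
  let ?R = "reps1 a b \<eta> \<union> reps2 a b"
  have "card ?R = 72"
  proof -
    have "reps1 a b \<eta> \<inter> reps2 a b = {}" using reps1_reps2_not_conj[OF \<eta>] conj3_refl by blast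
    moreover have "finite (reps1 a b \<eta>)" "finite (reps2 a b)"
      by (rule card_ge_0_finite; simp add: card_reps1[OF \<eta> disc] card_reps2[OF disc])+
    ultimately show ?thesis using card_reps1[OF \<eta> disc] card_reps2[OF disc] by (simp add: card_Un_disjoint)
  qed
  then show ?thesis
    unfolding seventy_two_classes_def
    using exists_normal_form[OF \<eta>] reps_triples[OF \<eta>] reps_transversal[OF \<eta>] generating_reps[OF \<eta>]
      generating_conj3 by (intro conjI ballI exI[of _ ?R]) blast+
qed

section \<open>Linear changes of variables\<close>

definition lin_sub :: "'k::comm_ring_1 m3 \<Rightarrow> ('k \<Rightarrow> 'k \<Rightarrow> 'k \<Rightarrow> 'a) \<Rightarrow> 'k \<Rightarrow> 'k \<Rightarrow> 'k \<Rightarrow> 'a"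
  where "lin_sub g F x y z = F (e11 g * x + e12 g * y + e13 g * z) (e21 g * x + e22 g * y + e23 g * z)
    (e31 g * x + e32 g * y + e33 g * z)"

lemma lin_sub_lin_sub: "lin_sub g (lin_sub h F) = lin_sub (h * g) F"
  by (intro ext, cases g; cases h) (simp add: lin_sub_def algebra_simps)

lemma lin_sub_1 [simp]: "lin_sub 1 F = F"
  by (intro ext) (simp add: lin_sub_def one_m3_def)

text \<open>The coefficients of the linear pencil \<open>x *# A + y *# B + z *# C\<close> after the
  substitution \<open>g\<close>. They are formed from the columns of \<open>g\<close>, so
  composition is in the opposite order.\<close>

definition act :: "'k::comm_ring_1 m3 \<Rightarrow> 'k triple \<Rightarrow> 'k triple"
  where "act g = (\<lambda>(A, B, C). (e11 g *# A + e21 g *# B + e31 g *# C, e12 g *# A + e22 g *# B + e32 g *# C,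
    e13 g *# A + e23 g *# B + e33 g *# C))"

lemma act_act: "act h (act g T) = act (g * h) T"
  by (cases T; cases g; cases h) (simp add: act_def sm_simps algebra_simps)

lemma act_1 [simp]: "act 1 T = T"
  by (cases T) (simp add: act_def one_m3_def)

lemma act_triples: "T \<in> triples F \<Longrightarrow> act g T \<in> triples (lin_sub g F)"
proof (cases T)
  case (fields A B C)
  assume T: "T \<in> triples F"
  have "x *# (e11 g *# A + e21 g *# B + e31 g *# C) + y *# (e12 g *# A + e22 g *# B + e32 g *# C) +
    z *# (e13 g *# A + e23 g *# B + e33 g *# C) =
    (e11 g * x + e12 g * y + e13 g * z) *# A + (e21 g * x + e22 g * y + e23 g * z) *# B +
    (e31 g * x + e32 g * y + e33 g * z) *# C" for x y z
    by (simp add: sm_simps algebra_simps)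
  then show ?thesis using T by (simp add: fields act_def triples_def lin_sub_def)
qed

lemma conj3_act: assumes "conj3 S T" shows "conj3 (act g S) (act g T)"
proof -
  obtain \<theta> \<theta>' where \<theta>: "\<theta> * \<theta>' = 1" "\<theta>' * \<theta> = 1"
    "S = (\<theta> * fst T * \<theta>', \<theta> * fst (snd T) * \<theta>', \<theta> * snd (snd T) * \<theta>')"
    using assms unfolding conj3_def by blast
  have "\<theta> * (a *# A + b *# B + c *# C) * \<theta>' = a *# (\<theta> * A * \<theta>') + b *# (\<theta> * B * \<theta>') + c *# (\<theta> * C * \<theta>')"
    for a b c A B C
    by (simp only: distrib_left distrib_right sm_simps(5,6))
  then show ?thesis
    unfolding conj3_def using \<theta> by (intro exI[of _ \<theta>] exI[of _ \<theta>']) (cases T, simp add: act_def)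
qed

lemma generating_act: assumes "generating (act g T)" shows "generating T"
  unfolding generating_def
proof (intro allI impI)
  fix S assume S: "1 \<in> S \<and> (\<forall>M\<in>S. \<forall>N\<in>S. M + N \<in> S \<and> M * N \<in> S) \<and> (\<forall>c. \<forall>M\<in>S. c *# M \<in> S) \<and>
    fst T \<in> S \<and> fst (snd T) \<in> S \<and> snd (snd T) \<in> S"
  then have "fst (act g T) \<in> S \<and> fst (snd (act g T)) \<in> S \<and> snd (snd (act g T)) \<in> S"
    by (cases T) (simp add: act_def)
  then show "S = UNIV" using assms S unfolding generating_def by blast
qed

lemma seventy_two_classes_lin_sub:
  assumes gh: "g * h = 1" "h * g = 1" and G: "seventy_two_classes (lin_sub g F)"
  shows "seventy_two_classes F"
proof -
  from G have gen: "\<forall>T\<in>triples (lin_sub g F). generating T"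
    and "\<exists>R \<subseteq> triples (lin_sub g F). card R = 72 \<and> (\<forall>T\<in>triples (lin_sub g F). \<exists>r\<in>R. conj3 T r) \<and>
      (\<forall>r\<in>R. \<forall>s\<in>R. conj3 r s \<longrightarrow> r = s)"
    unfolding seventy_two_classes_def by (rule conjunct1, rule conjunct2)
  then obtain R where R: "R \<subseteq> triples (lin_sub g F)" "card R = 72"
    "\<forall>T\<in>triples (lin_sub g F). \<exists>r\<in>R. conj3 T r" "\<forall>r\<in>R. \<forall>s\<in>R. conj3 r s \<longrightarrow> r = s"
    by (elim exE conjE)
  have inv: "act g (act h T) = T" "act h (act g T) = T" for T by (simp_all add: act_act gh)
  have "lin_sub h (lin_sub g F) = F" by (simp add: lin_sub_lin_sub gh)
  then have sub: "act h ` R \<subseteq> triples F" using R(1) act_triples[of _ "lin_sub g F" h] by auto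
  have "card (act h ` R) = 72"
    using R(2) card_image[of "act h" R] inv(1) by (metis inj_onI)
  moreover have "\<exists>r\<in>act h ` R. conj3 T r" if T: "T \<in> triples F" for T
  proof -
    obtain r where "r \<in> R" "conj3 (act g T) r" using bspec[OF R(3) act_triples[OF T]] by (elim bexE)
    then show ?thesis using conj3_act[of "act g T" r h] inv(2) by auto
  qed
  moreover have "r = s" if rs: "r \<in> act h ` R" "s \<in> act h ` R" "conj3 r s" for r s
  proof -
    obtain r' s' where *: "r' \<in> R" "r = act h r'" "s' \<in> R" "s = act h s'" using rs(1,2) by blast
    have "conj3 r' s'" using conj3_act[OF rs(3), of g] by (simp add: * inv)
    then have "r' = s'" using R(4) *(1,3) by blast
    then show ?thesis by (simp add: *)
  qed
  moreover have "generating T" if "T \<in> triples F" for T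
    by (rule generating_act[OF bspec[OF gen act_triples[OF that]]])
  ultimately show ?thesis unfolding seventy_two_classes_def using sub
    by (intro conjI ballI exI[of _ "act h ` R"] impI) simp_all
qed

section \<open>Weierstrass form of a smooth ternary cubic\<close>

definition cub :: "'k::comm_ring_1 \<Rightarrow> 'k \<Rightarrow> 'k \<Rightarrow> 'k \<Rightarrow> 'k \<Rightarrow> 'k \<Rightarrow> 'k \<Rightarrow> 'k \<Rightarrow> 'k \<Rightarrow> 'k \<Rightarrow> 'k \<Rightarrow> 'k \<Rightarrow> 'k \<Rightarrow> 'k"
  where "cub c1 c2 c3 c4 c5 c6 c7 c8 c9 c0 x y z = c1*x^3 + c2*y^3 + c3*z^3 + c4*x^2*y + c5*x*y^2 +
    c6*x^2*z + c7*x*z^2 + c8*y^2*z + c9*y*z^2 + c0*x*y*z"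

definition is_cubic :: "('k::comm_ring_1 \<Rightarrow> 'k \<Rightarrow> 'k \<Rightarrow> 'k) \<Rightarrow> bool"
  where "is_cubic F \<longleftrightarrow> (\<exists>c1 c2 c3 c4 c5 c6 c7 c8 c9 c0. \<forall>x y z. F x y z = cub c1 c2 c3 c4 c5 c6 c7 c8 c9 c0 x y z)"

lemma is_cubicI: "(\<And>x y z. F x y z = cub c1 c2 c3 c4 c5 c6 c7 c8 c9 c0 x y z) \<Longrightarrow> is_cubic F"
  unfolding is_cubic_def by blast

lemma is_cubic_add:
  assumes "is_cubic F" "is_cubic G" shows "is_cubic (\<lambda>x y z. F x y z + G x y z)"
proof -
  obtain c1 c2 c3 c4 c5 c6 c7 c8 c9 c0 where F: "\<And>x y z. F x y z = cub c1 c2 c3 c4 c5 c6 c7 c8 c9 c0 x y z"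
    using assms(1) unfolding is_cubic_def by blast
  obtain d1 d2 d3 d4 d5 d6 d7 d8 d9 d0 where G: "\<And>x y z. G x y z = cub d1 d2 d3 d4 d5 d6 d7 d8 d9 d0 x y z"
    using assms(2) unfolding is_cubic_def by blast
  show ?thesis
    by (rule is_cubicI[of _ "c1+d1" "c2+d2" "c3+d3" "c4+d4" "c5+d5" "c6+d6" "c7+d7" "c8+d8" "c9+d9" "c0+d0"])
      (simp add: F G cub_def distrib_right)
qed

lemma is_cubic_scale:
  assumes "is_cubic F" shows "is_cubic (\<lambda>x y z. c * F x y z)"
proof -
  obtain c1 c2 c3 c4 c5 c6 c7 c8 c9 c0 where F: "\<And>x y z. F x y z = cub c1 c2 c3 c4 c5 c6 c7 c8 c9 c0 x y z"
    using assms(1) unfolding is_cubic_def by blast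
  show ?thesis
    by (rule is_cubicI[of _ "c*c1" "c*c2" "c*c3" "c*c4" "c*c5" "c*c6" "c*c7" "c*c8" "c*c9" "c*c0"])
      (simp add: F cub_def distrib_left mult.assoc)
qed

lemma is_cubic_prod:
  "is_cubic (\<lambda>x y z. (a1*x + b1*y + d1*z) * (a2*x + b2*y + d2*z) * (a3*x + b3*y + d3*z))"
  by (rule is_cubicI[of _ "a1*a2*a3" "b1*b2*b3" "d1*d2*d3" "a1*a2*b3 + a1*b2*a3 + b1*a2*a3"
    "a1*b2*b3 + b1*a2*b3 + b1*b2*a3" "a1*a2*d3 + a1*d2*a3 + d1*a2*a3" "a1*d2*d3 + d1*a2*d3 + d1*d2*a3"
    "b1*b2*d3 + b1*d2*b3 + d1*b2*b3" "b1*d2*d3 + d1*b2*d3 + d1*d2*b3"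
    "a1*b2*d3 + a1*d2*b3 + b1*a2*d3 + b1*d2*a3 + d1*a2*b3 + d1*b2*a3"])
   (simp add: cub_def power2_eq_square power3_eq_cube algebra_simps)

lemma is_cubic_lin_sub:
  assumes "is_cubic F" shows "is_cubic (lin_sub g F)"
proof -
  obtain c1 c2 c3 c4 c5 c6 c7 c8 c9 c0 where F: "\<And>x y z. F x y z = cub c1 c2 c3 c4 c5 c6 c7 c8 c9 c0 x y z"
    using assms(1) unfolding is_cubic_def by blast
  have "lin_sub g F = (\<lambda>x y z. let u = e11 g * x + e12 g * y + e13 g * z; v = e21 g * x + e22 g * y + e23 g * z;
      w = e31 g * x + e32 g * y + e33 g * z in c1*(u*u*u) + c2*(v*v*v) + c3*(w*w*w) + c4*(u*u*v) + c5*(u*v*v) +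
    c6*(u*u*w) + c7*(u*w*w) + c8*(v*v*w) + c9*(v*w*w) + c0*(u*v*w))"
    by (intro ext) (simp add: lin_sub_def F cub_def Let_def power2_eq_square power3_eq_cube mult.assoc)
  then show ?thesis
    by (simp only: Let_def) (intro is_cubic_add is_cubic_scale is_cubic_prod)
qed

text \<open>For cubics this is the Jacobian criterion, stated along lines so that its invariance under linear
  changes of variables is evident.\<close>

definition singular_at :: "('k::comm_ring_1 \<Rightarrow> 'k \<Rightarrow> 'k \<Rightarrow> 'k) \<Rightarrow> 'k \<Rightarrow> 'k \<Rightarrow> 'k \<Rightarrow> bool"
  where "singular_at F p q r \<longleftrightarrow> (\<forall>u v w. \<exists>a b. \<forall>s. F (p + s*u) (q + s*v) (r + s*w) = s^2 * (a + s*b))"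

definition smooth_cubic :: "('k::comm_ring_1 \<Rightarrow> 'k \<Rightarrow> 'k \<Rightarrow> 'k) \<Rightarrow> bool"
  where "smooth_cubic F \<longleftrightarrow> is_cubic F \<and> (\<forall>p q r. singular_at F p q r \<longrightarrow> p = 0 \<and> q = 0 \<and> r = 0)"

lemma smooth_cubic_lin_sub:
  fixes g :: "'k::comm_ring_1 m3"
  assumes gh: "g * h = 1" "h * g = 1" and F: "smooth_cubic F"
  shows "smooth_cubic (lin_sub g F)"
  unfolding smooth_cubic_def
proof (intro conjI allI impI)
  show "is_cubic (lin_sub g F)" using F is_cubic_lin_sub unfolding smooth_cubic_def by blast
  obtain g1 g2 g3 g4 g5 g6 g7 g8 g9 where g: "g = M3 g1 g2 g3 g4 g5 g6 g7 g8 g9" by (cases g)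
  obtain h1 h2 h3 h4 h5 h6 h7 h8 h9 where h: "h = M3 h1 h2 h3 h4 h5 h6 h7 h8 h9" by (cases h)
  note eqs = gh[unfolded g h one_m3_def times_m3.simps m3.inject]
  fix p q r assume sing: "singular_at (lin_sub g F) p q r"
  define p' q' r' where "p' = g1*p + g2*q + g3*r" and "q' = g4*p + g5*q + g6*r" and "r' = g7*p + g8*q + g9*r"
  have "singular_at F p' q' r'"
    unfolding singular_at_def
  proof (intro allI)
    fix u v w
    define u' v' w' where "u' = h1*u + h2*v + h3*w" and "v' = h4*u + h5*v + h6*w" and "w' = h7*u + h8*v + h9*w"
    have u: "u = g1*u' + g2*v' + g3*w'" "v = g4*u' + g5*v' + g6*w'" "w = g7*u' + g8*v' + g9*w'"
    proof -
      have "g1*u' + g2*v' + g3*w' = (g1*h1+g2*h4+g3*h7)*u + (g1*h2+g2*h5+g3*h8)*v + (g1*h3+g2*h6+g3*h9)*w"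
        "g4*u' + g5*v' + g6*w' = (g4*h1+g5*h4+g6*h7)*u + (g4*h2+g5*h5+g6*h8)*v + (g4*h3+g5*h6+g6*h9)*w"
        "g7*u' + g8*v' + g9*w' = (g7*h1+g8*h4+g9*h7)*u + (g7*h2+g8*h5+g9*h8)*v + (g7*h3+g8*h6+g9*h9)*w"
        unfolding u'_def v'_def w'_def by (simp_all add: algebra_simps)
      then show "u = g1*u' + g2*v' + g3*w'" "v = g4*u' + g5*v' + g6*w'" "w = g7*u' + g8*v' + g9*w'"
        using eqs by simp_all
    qed
    obtain a b where "\<forall>s. lin_sub g F (p + s*u') (q + s*v') (r + s*w') = s^2 * (a + s*b)"
      using sing unfolding singular_at_def by blast
    moreover have "lin_sub g F (p + s*u') (q + s*v') (r + s*w') = F (p' + s*u) (q' + s*v) (r' + s*w)" for s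
      unfolding u p'_def q'_def r'_def by (simp add: lin_sub_def g algebra_simps)
    ultimately show "\<exists>a b. \<forall>s. F (p' + s*u) (q' + s*v) (r' + s*w) = s^2 * (a + s*b)" by auto
  qed
  then have 0: "p' = 0" "q' = 0" "r' = 0" using F unfolding smooth_cubic_def by blast+
  have "h1*p' + h2*q' + h3*r' = (h1*g1+h2*g4+h3*g7)*p + (h1*g2+h2*g5+h3*g8)*q + (h1*g3+h2*g6+h3*g9)*r"
    "h4*p' + h5*q' + h6*r' = (h4*g1+h5*g4+h6*g7)*p + (h4*g2+h5*g5+h6*g8)*q + (h4*g3+h5*g6+h6*g9)*r"
    "h7*p' + h8*q' + h9*r' = (h7*g1+h8*g4+h9*g7)*p + (h7*g2+h8*g5+h9*g8)*q + (h7*g3+h8*g6+h9*g9)*r"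
    unfolding p'_def q'_def r'_def by (simp_all add: algebra_simps)
  then show "p = 0" "q = 0" "r = 0"
    using eqs by (simp_all add: 0)
qed

section \<open>From an inflection tangent, and then from an arbitrary point, to Weierstrass
  form\<close>

definition weierstrass_like :: "('k::comm_ring_1 \<Rightarrow> 'k \<Rightarrow> 'k \<Rightarrow> 'k) \<Rightarrow> bool"
  where "weierstrass_like F \<longleftrightarrow> (\<exists>g h a b. g * h = 1 \<and> h * g = 1 \<and> lin_sub g F = weierstrass a b)"

lemma weierstrass_like_lin_sub:
  assumes "g * h = 1" "h * g = 1" "weierstrass_like (lin_sub g F)"
  shows "weierstrass_like F"
proof -
  obtain g' h' a b where *: "g' * h' = 1" "h' * g' = 1" "lin_sub g' (lin_sub g F) = weierstrass a b"
    using assms(3) unfolding weierstrass_like_def by blast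
  have "(g * g') * (h' * h) = g * (g' * h') * h" "(h' * h) * (g * g') = h' * (h * g) * g'"
    by (simp_all only: mult.assoc)
  then have "(g * g') * (h' * h) = 1" "(h' * h) * (g * g') = 1" using assms(1,2) * by simp_all
  then show ?thesis using *(3) unfolding weierstrass_like_def lin_sub_lin_sub by blast
qed

lemma flex_weierstrass_like:
  fixes F :: "'k::{alg_closed_field, field_char_0} \<Rightarrow> 'k \<Rightarrow> 'k \<Rightarrow> 'k"
  assumes F: "smooth_cubic F" and flex: "\<And>x y. F x y 0 = x^3"
  shows "weierstrass_like F"
proof -
  obtain c1 c2 c3 c4 c5 c6 c7 c8 c9 c0 where c: "\<And>x y z. F x y z = cub c1 c2 c3 c4 c5 c6 c7 c8 c9 c0 x y z"
    using F unfolding smooth_cubic_def is_cubic_def by blast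
  have "(c1 - 1)*x^3 + c2*y^3 + 0*z^3 + c4*(x^2*y) + c5*(x*y^2) + 0*(x^2*z) + 0*(x*z^2) + 0*(y^2*z) + 0*(y*z^2) +
    0*(x*y*z) = 0" for x y z
    using flex[of x y] unfolding c cub_def by (simp add: algebra_simps)
  from ternary_cubic_eq_0[OF this] have c0: "c1 = 1" "c2 = 0" "c4 = 0" "c5 = 0" by simp_all
  have F': "F x y z = x^3 + c3*z^3 + c6*x^2*z + c7*x*z^2 + c8*y^2*z + c9*y*z^2 + c0*x*y*z" for x y z
    unfolding c cub_def c0 by simp
  have c8: "c8 \<noteq> 0"
  proof
    assume "c8 = 0"
    have "singular_at F 0 1 0"
      unfolding singular_at_def
    proof (intro allI)
      fix u v w
      show "\<exists>a b. \<forall>s. F (0 + s*u) (1 + s*v) (0 + s*w) = s^2 * (a + s*b)"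
        by (intro exI[of _ "c9*w^2 + c0*u*w"] exI[of _ "u^3 + c3*w^3 + c6*u^2*w + c7*u*w^2 + c9*v*w^2 + c0*u*v*w"])
          (simp add: F' \<open>c8 = 0\<close> power2_eq_square power3_eq_cube algebra_simps)
    qed
    then show False using F unfolding smooth_cubic_def by (metis zero_neq_one)
  qed
  \<comment> \<open>Scaling \<open>y\<close> by \<open>e\<close> turns the coefficient of
    \<open>y^2 * z\<close> into \<open>-1\<close>.\<close>
  obtain e where e: "e^2 = - 1 / c8" using nth_root_exists[of 2 "- 1 / c8"] by auto
  then have e': "c8 * e^2 = -1" using c8 by simp
  have "e \<noteq> 0" using e' by auto
  \<comment> \<open>\<open>\<alpha>\<close> and \<open>\<beta>\<close> complete the square in
    \<open>y\<close>, removing \<open>x*y*z\<close> and \<open>y*z^2\<close>; the shift of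
    \<open>x\<close> by \<open>\<gamma>\<close> then removes \<open>x^2 * z\<close>.\<close>
  define \<alpha> \<beta> \<gamma> where "\<alpha> = - c0 / (2*c8)" and "\<beta> = - c9 / (2*c8)" and "\<gamma> = (c6 - c8*\<alpha>^2) / 3"
  have "3*\<gamma> = c6 - c8*\<alpha>^2" by (simp add: \<gamma>_def)
  then have "c6 = 3*\<gamma> + c8*\<alpha>^2" by simp
  moreover have "c0 = - 2*c8*\<alpha>" "c9 = - 2*c8*\<beta>" using c8 by (simp_all add: \<alpha>_def \<beta>_def)
  ultimately have \<alpha>: "c0 = - 2*c8*\<alpha>" "c9 = - 2*c8*\<beta>" "c6 = 3*\<gamma> + c8*\<alpha>^2" by blast+
  define g where "g = M3 1 0 (-\<gamma>) \<alpha> e (\<beta> - \<alpha>*\<gamma>) 0 0 1"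
  define h where "h = M3 1 0 \<gamma> (-(\<alpha>/e)) (1/e) (-(\<beta>/e)) 0 0 1"
  have "g * h = 1" "h * g = 1"
    using \<open>e \<noteq> 0\<close> by (simp_all add: g_def h_def one_m3_def field_simps)
  moreover have "lin_sub g F = weierstrass (c7 - 2*c8*\<alpha>*\<beta> - 3*\<gamma>^2) (c3 - c8*\<beta>^2 - (c7 - 2*c8*\<alpha>*\<beta>)*\<gamma> + 2*\<gamma>^3)"
  proof (intro ext)
    fix x y z
    show "lin_sub g F x y z = weierstrass (c7 - 2*c8*\<alpha>*\<beta> - 3*\<gamma>^2) (c3 - c8*\<beta>^2 - (c7 - 2*c8*\<alpha>*\<beta>)*\<gamma> + 2*\<gamma>^3) x y z"
      using e' unfolding lin_sub_def g_def weierstrass_def F' m3.sel \<alpha> by Groebner_Basis.algebra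
  qed
  ultimately show ?thesis unfolding weierstrass_like_def by blast
qed

text \<open>A cubic that contains the line \<open>z = 0\<close> is singular where the residual conic
  meets this line.\<close>

lemma smooth_cubic_no_line:
  fixes F :: "'k::{alg_closed_field, field_char_0} \<Rightarrow> 'k \<Rightarrow> 'k \<Rightarrow> 'k"
  assumes F: "smooth_cubic F"
  shows "\<exists>x y. F x y 0 \<noteq> 0"
proof (rule ccontr)
  assume no: "\<not> (\<exists>x y. F x y 0 \<noteq> 0)"
  obtain c1 c2 c3 c4 c5 c6 c7 c8 c9 c0 where c: "\<And>x y z. F x y z = cub c1 c2 c3 c4 c5 c6 c7 c8 c9 c0 x y z"
    using F unfolding smooth_cubic_def is_cubic_def by blast
  have "c1*x^3 + c2*y^3 + 0*z^3 + c4*(x^2*y) + c5*(x*y^2) + 0*(x^2*z) + 0*(x*z^2) + 0*(y^2*z) + 0*(y*z^2) +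
    0*(x*y*z) = 0" for x y z
  proof -
    have "F x y 0 = 0" using no by blast
    then show ?thesis unfolding c cub_def by (simp add: mult.assoc)
  qed
  from ternary_cubic_eq_0[OF this] have z: "c1 = 0" "c2 = 0" "c4 = 0" "c5 = 0" by simp_all
  have F': "F x y z = z * (c3*z^2 + c6*x^2 + c7*x*z + c8*y^2 + c9*y*z + c0*x*y)" for x y z
    unfolding c cub_def z by (simp add: power2_eq_square power3_eq_cube algebra_simps)
  obtain p q where pq: "p \<noteq> 0 \<or> q \<noteq> 0" "c6*p^2 + c8*q^2 + c0*p*q = 0"
  proof (cases "c6 = 0")
    case True
    then show thesis using that[of 1 0] by simp
  next
    case False
    obtain x where "x^2 + (c0/c6) * x + c8/c6 = 0" by (rule quadratic_has_root)
    then have "c6 * (x^2 + (c0/c6) * x + c8/c6) = 0" by simp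
    then show thesis using False that[of x 1] by (simp add: distrib_left add_ac)
  qed
  have "singular_at F p q 0"
    unfolding singular_at_def
  proof (intro allI)
    fix u v w
    have "F (p + s*u) (q + s*v) (0 + s*w) =
      s^2 * (w * (2*c6*p*u + c7*p*w + 2*c8*q*v + c9*q*w + c0*(p*v + q*u)) +
      s * (w * (c3*w^2 + c6*u^2 + c7*u*w + c8*v^2 + c9*v*w + c0*u*v)))" for s
      using pq(2) unfolding F' by Groebner_Basis.algebra
    then show "\<exists>a b. \<forall>s. F (p + s*u) (q + s*v) (0 + s*w) = s^2 * (a + s*b)" by blast
  qed
  then show False using F pq(1) unfolding smooth_cubic_def by blast
qed

lemma line_weierstrass_like:
  fixes F :: "'k::{alg_closed_field, field_char_0} \<Rightarrow> 'k \<Rightarrow> 'k \<Rightarrow> 'k"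
  assumes F: "smooth_cubic F" and flex: "\<And>x y. F x y 0 = (\<alpha>*x + \<beta>*y)^3"
  shows "weierstrass_like F"
proof -
  consider "\<alpha> = 0" "\<beta> = 0" | "\<alpha> \<noteq> 0" | "\<alpha> = 0" "\<beta> \<noteq> 0" by blast
  then show ?thesis
  proof cases
    case 1
    then show ?thesis using smooth_cubic_no_line[OF F] flex by simp
  next
    case 2
    define g h where "g = M3 (1/\<alpha>) (-(\<beta>/\<alpha>)) 0 0 1 0 0 0 1" and "h = M3 \<alpha> \<beta> 0 0 1 0 0 0 1"
    have gh: "g * h = 1" "h * g = 1" using 2 by (simp_all add: g_def h_def one_m3_def)
    have "lin_sub g F x y 0 = x^3" for x y
      using 2 by (simp add: lin_sub_def g_def flex algebra_simps)
    then show ?thesis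
      using flex_weierstrass_like[OF smooth_cubic_lin_sub[OF gh F]] weierstrass_like_lin_sub[OF gh] by blast
  next
    case 3
    define g h where "g = M3 0 1 0 (1/\<beta>) 0 0 0 0 1" and "h = M3 0 \<beta> 0 1 0 0 0 0 1"
    have gh: "g * h = 1" "h * g = 1" using 3 by (simp_all add: g_def h_def one_m3_def)
    have "lin_sub g F x y 0 = x^3" for x y
      using 3 by (simp add: lin_sub_def g_def flex)
    then show ?thesis
      using flex_weierstrass_like[OF smooth_cubic_lin_sub[OF gh F]] weierstrass_like_lin_sub[OF gh] by blast
  qed
qed

text \<open>On \<open>y = m x + n z\<close> the cubic \<open>y\<^sup>2 z + y x\<^sup>2 + c\<^sub>6 x\<^sup>2 z + c\<^sub>7 x z\<^sup>2 + c\<^sub>3 z\<^sup>3\<close> becomes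
  \<open>m (x + s z)\<^sup>3\<close> iff \<open>n = 3 m s - m\<^sup>2 - c\<^sub>6\<close> and, with \<open>s = m + r\<close>, both \<open>3 m r\<^sup>2 = m\<^sup>3 - 2 c\<^sub>6 m + c\<^sub>7\<close> and
  a linear equation in \<open>r\<close> hold. Eliminating \<open>r\<close> leaves a monic equation of degree 9 for \<open>m\<close>,
  whose roots are the slopes of the nine inflection tangents.\<close>

lemma inflection_tangent_exists:
  fixes c3 :: "'k::{alg_closed_field, field_char_0}"
  shows "\<exists>m n \<alpha> \<beta>. \<forall>x z. (m*x + n*z)^2 * z + (m*x + n*z) * x^2 + c6*x^2*z + c7*x*z^2 + c3*z^3 = (\<alpha>*x + \<beta>*z)^3"
proof -
  define G where "G = [:c7, -2*c6, 0, 1:]"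
  define U where "U = [:c7, 16*c6, 0, -26:]"
  define V where "V = [:-(c6^2 + c3), -2*c7, 8*c6, 0, -5:]"
  define P where "P = G * (U * U) - [:0, 27:] * (V * V)"
  \<comment> \<open>The conditions on \<open>r\<close> read \<open>3 * m * r^2 = G\<close> and
    \<open>r * U = - 3 * V\<close>; eliminating \<open>r\<close> gives
    \<open>G * U^2 = 27 * m * V^2\<close>. The leading coefficient is
    \<open>26^2 - 27 * 5^2 = 1\<close>.\<close>
  have "coeff P 9 = 1"
    by (simp add: P_def G_def U_def V_def eval_nat_numeral)
  then have "degree P \<noteq> 0" by (metis coeff_eq_0 gr0I zero_neq_one zero_less_numeral)
  then obtain m where m: "poly P m = 0" using alg_closed_imp_poly_has_root[of P] by blast
  define G' U' V' where "G' = m^3 - 2*c6*m + c7" and "U' = -26*m^3 + 16*c6*m + c7"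
    and "V' = -5*m^4 + 8*c6*m^2 - 2*c7*m - (c6^2 + c3)"
  have root: "G' * U'^2 = 27 * m * V'^2"
    using m by (simp add: P_def G_def U_def V_def G'_def U'_def V'_def power2_eq_square power3_eq_cube power4_eq_xxxx algebra_simps)
  show ?thesis
  proof (cases "m = 0")
    \<comment> \<open>The inflection tangent is then \<open>y = - c6 * z\<close>, on which the form
      equals \<open>(c6^2 + c3) * z^3\<close>.\<close>
    case True
    then have "c7 = 0" using root by (simp add: G'_def U'_def)
    obtain \<beta> where "\<beta>^3 = c6^2 + c3" using nth_root_exists[of 3 "c6^2 + c3"] by auto
    then show ?thesis
      using \<open>c7 = 0\<close> 
      by - (rule exI[of _ 0], rule exI[of _ "-c6"], rule exI[of _ 0], rule exI[of _ \<beta>],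
        simp add: power_mult_distrib power2_eq_square power3_eq_cube algebra_simps)
  next
    case False
    have "\<exists>r. 3 * m * r^2 = G' \<and> r * U' = - (3 * V')"
    \<comment> \<open>The elimination is reversed: if \<open>U'\<close> vanishes then so does
      \<open>V'\<close>, and any root of the quadratic equation works; otherwise \<open>r\<close> is
      the quotient.\<close>
    proof (cases "U' = 0")
      case True
      then have "V' = 0" using root False by simp
      obtain r where "r^2 = G' / (3 * m)" using nth_root_exists[of 2 "G' / (3*m)"] by auto
      then show ?thesis using False True \<open>V' = 0\<close> by (intro exI[of _ r]) simp
    next
      case U: False
      have "3 * m * (- (3 * V') / U')^2 = (27 * m * V'^2) / U'^2" by (simp add: power_divide power_mult_distrib)
      also have "\<dots> = G'" using U by (simp flip: root)
      finally show ?thesis using U by (intro exI[of _ "- (3 * V') / U'"]) simp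
    qed
    then obtain r where r: "3 * m * r^2 = G'" "r * U' = - (3 * V')" by blast
    define s where "s = m + r"
    define n where "n = 3*m*s - m^2 - c6"
    have n: "m^2 + n + c6 = 3*m*s" by (simp add: n_def)
    have 1: "2*m*n + c7 = 3*m*s^2"
      using r(1) unfolding n_def s_def G'_def by Groebner_Basis.algebra
    have "3 * (n^2 + c3 - m*s^3) = 0"
      using r unfolding n_def s_def G'_def U'_def V'_def by Groebner_Basis.algebra
    then have 2: "n^2 + c3 = m*s^3" by (simp only: mult_eq_0_iff right_minus_eq) simp
    obtain \<alpha> where \<alpha>: "\<alpha>^3 = m" using nth_root_exists[of 3 m] by auto
    show ?thesis
    proof (rule exI[of _ m], rule exI[of _ n], rule exI[of _ \<alpha>], rule exI[of _ "\<alpha>*s"], intro allI)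
      fix x z
      have "(m*x + n*z)^2 * z + (m*x + n*z) * x^2 + c6*x^2*z + c7*x*z^2 + c3*z^3 =
        m * x^3 + (m^2 + n + c6) * x^2*z + (2*m*n + c7) * x*z^2 + (n^2 + c3) * z^3"
        by (simp add: power2_eq_square power3_eq_cube algebra_simps)
      also have "\<dots> = m * (x + s*z)^3" unfolding n 1 2
        by (simp add: power2_eq_square power3_eq_cube algebra_simps)
      also have "\<dots> = (\<alpha>*x + \<alpha>*s*z)^3" unfolding \<alpha>[symmetric]
        by (simp add: power_mult_distrib[symmetric] distrib_left mult.assoc)
      finally show "(m*x + n*z)^2 * z + (m*x + n*z) * x^2 + c6*x^2*z + c7*x*z^2 + c3*z^3 = (\<alpha>*x + \<alpha>*s*z)^3" .
    qed
  qed
qed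

text \<open>The cubic passes through \<open>(0:1:0)\<close> with tangent \<open>z = 0\<close>. If
  \<open>c4\<close> vanishes this is an inflection tangent; otherwise the equation is brought to the
  shape in which \<open>inflection_tangent_exists\<close> finds one.\<close>

lemma tangent_weierstrass_like:
  fixes F :: "'k::{alg_closed_field, field_char_0} \<Rightarrow> 'k \<Rightarrow> 'k \<Rightarrow> 'k"
  assumes F: "smooth_cubic F" and c: "\<And>x y z. F x y z = cub c1 0 c3 c4 0 c6 c7 1 c9 c0 x y z"
  shows "weierstrass_like F"
proof (cases "c4 = 0")
  case True
  obtain \<alpha> where "\<alpha>^3 = c1" using nth_root_exists[of 3 c1] by auto
  then have "F x y 0 = (\<alpha>*x + 0*y)^3" for x y
    by (simp add: c cub_def True power_mult_distrib)
  then show ?thesis by (rule line_weierstrass_like[OF F])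
next
  case False
  obtain e where e: "e^2 = c4" using nth_root_exists[of 2 c4] by auto
  then have "e \<noteq> 0" using False by auto
  define a c where "a = c1/e^3" and "c = c0/e"
  have c1: "c1 = a*e^3" and c0: "c0 = c*e" using \<open>e \<noteq> 0\<close> by (simp_all add: a_def c_def)
  define d6 d7 where "d6 = c6/e^2" and "d7 = c7/e"
  have c6: "c6 = d6*e^2" and c7: "c7 = d7*e" using \<open>e \<noteq> 0\<close> by (simp_all add: d6_def d7_def)
  \<comment> \<open>The parameter \<open>u\<close> removes \<open>x^3\<close>, the shift of
    \<open>x\<close> by \<open>\<mu>\<close> removes \<open>x*y*z\<close>, and \<open>v\<close>
    removes \<open>y*z^2\<close>.\<close>
  define \<mu> u v where "\<mu> = a - c/2" and "u = -a" and "v = - (\<mu>^2 + c*\<mu> + c9)/2"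
  have c2: "c = 2*(a - \<mu>)" by (simp add: \<mu>_def)
  have "2 * v = - (\<mu>^2 + c*\<mu> + c9)" by (simp add: v_def)
  then have c9: "c9 = - 2*v - \<mu>^2 - c*\<mu>" by Groebner_Basis.algebra
  define f6 f7 f3 where "f6 = 3*a*\<mu> + d6 + u^2 + v + u*(2*\<mu> + c)"
    and "f7 = 3*a*\<mu>^2 + 2*d6*\<mu> + d7 + 2*u*v + u*(\<mu>^2 + c*\<mu> + c9) + v*(2*\<mu> + c)"
    and "f3 = a*\<mu>^3 + d6*\<mu>^2 + d7*\<mu> + c3 + v^2 + v*(\<mu>^2 + c*\<mu> + c9)"
  obtain m n \<alpha> \<beta> where mn: "\<And>x z. (m*x + n*z)^2 * z + (m*x + n*z) * x^2 + f6*x^2*z + f7*x*z^2 + f3*z^3 = (\<alpha>*x + \<beta>*z)^3"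
    using inflection_tangent_exists[of f6 f7 f3] by blast
  define g1 h1 where "g1 = M3 (1/e) 0 (\<mu>/e) u 1 v 0 0 1" and "h1 = M3 e 0 (-\<mu>) (-(u*e)) 1 (u*\<mu>-v) 0 0 1"
  have gh1: "g1 * h1 = 1" "h1 * g1 = 1"
    using \<open>e \<noteq> 0\<close> by (simp_all add: g1_def h1_def one_m3_def field_simps)
  have F1: "lin_sub g1 F x y z = y^2*z + y*x^2 + f6*x^2*z + f7*x*z^2 + f3*z^3" for x y z
  proof -
    define x' z' where "x' = x + \<mu>*z" and "z' = z"
    have "lin_sub g1 F x y z = F (x'/e) (u*x + y + v*z) z"
      by (simp add: lin_sub_def g1_def x'_def add_divide_distrib)
    also have "\<dots> = a*x'^3 + c3*z^3 + x'^2*(u*x + y + v*z) + d6*x'^2*z + d7*x'*z^2 + (u*x + y + v*z)^2*z +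
      c9*(u*x + y + v*z)*z^2 + c*x'*(u*x + y + v*z)*z"
      using \<open>e \<noteq> 0\<close> unfolding c cub_def by (simp add: c1 c0 c6 c7 e[symmetric] power_divide)
    also have "\<dots> = y^2*z + y*x^2 + f6*x^2*z + f7*x*z^2 + f3*z^3"
      unfolding x'_def f6_def f7_def f3_def c9 c2 u_def by Groebner_Basis.algebra
    finally show ?thesis .
  qed
  \<comment> \<open>This substitution makes the line \<open>y = m*x + n*z\<close> the new line
    \<open>z = 0\<close>.\<close>
  define g2 h2 where "g2 = M3 1 0 0 m n 1 0 1 0" and "h2 = M3 1 0 0 0 0 1 (-m) 1 (-n)"
  have gh2: "g2 * h2 = 1" "h2 * g2 = 1"
    by (simp_all add: g2_def h2_def one_m3_def)
  have "lin_sub g2 (lin_sub g1 F) x y 0 = (\<alpha>*x + \<beta>*y)^3" for x y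
    unfolding mn[symmetric] by (subst lin_sub_def) (simp add: F1 g2_def)
  from line_weierstrass_like[OF smooth_cubic_lin_sub[OF gh2 smooth_cubic_lin_sub[OF gh1 F]] this]
  show ?thesis by (rule weierstrass_like_lin_sub[OF gh1 weierstrass_like_lin_sub[OF gh2]])
qed

text \<open>The tangent at \<open>(0:1:0)\<close> is \<open>c5*x + c8*z = 0\<close>. A change of
  variables fixing the point turns it into \<open>z = 0\<close>; if both coefficients vanish, the
  point is singular.\<close>

lemma point_weierstrass_like:
  fixes F :: "'k::{alg_closed_field, field_char_0} \<Rightarrow> 'k \<Rightarrow> 'k \<Rightarrow> 'k"
  assumes F: "smooth_cubic F" and pt: "F 0 1 0 = 0"
  shows "weierstrass_like F"
proof -
  have *: "weierstrass_like H"
    if H: "smooth_cubic H" and c: "\<And>x y z. H x y z = cub c1 0 c3 c4 c5 c6 c7 c8 c9 c0 x y z" "c8 \<noteq> 0"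
    for H and c1 c3 c4 c5 c6 c7 c8 c9 c0 :: 'k
  proof -
    define t where "t = c5 / c8"
    have c5: "c5 = t * c8" using c(2) by (simp add: t_def)
    define q where "q = 1 / c8"
    have q: "q * c8 = 1" using c(2) by (simp add: q_def)
    define g h where "g = M3 1 0 0 0 1 0 (-t) 0 q" and "h = M3 1 0 0 0 1 0 (t*c8) 0 c8"
    have gh: "g * h = 1" "h * g = 1"
      using q by (simp_all add: g_def h_def one_m3_def mult_ac)
    have "lin_sub g H x y z = cub (c1 - c3*t^3 - c6*t + c7*t^2) 0 (c3*q^3) (c4 + c9*t^2 - c0*t) 0
      ((c6 + 3*c3*t^2 - 2*c7*t)*q) ((c7 - 3*c3*t)*q^2) 1 (c9*q^2) ((c0 - 2*c9*t)*q) x y z" for x y z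
      using q unfolding lin_sub_def g_def m3.sel c(1) cub_def c5 by Groebner_Basis.algebra
    from tangent_weierstrass_like[OF smooth_cubic_lin_sub[OF gh H] this]
    show ?thesis by (rule weierstrass_like_lin_sub[OF gh])
  qed
  obtain c1 c2 c3 c4 c5 c6 c7 c8 c9 c0 where c: "\<And>x y z. F x y z = cub c1 c2 c3 c4 c5 c6 c7 c8 c9 c0 x y z"
    using F unfolding smooth_cubic_def is_cubic_def by blast
  have c2: "c2 = 0" using pt by (simp add: c cub_def)
  consider "c8 \<noteq> 0" | "c5 \<noteq> 0" | "c8 = 0" "c5 = 0" by blast
  then show ?thesis
  proof cases
    case 1
    then show ?thesis using *[OF F] c c2 by simp
  next
    case 2
    define g :: "'k m3" where "g = M3 0 0 1 0 1 0 1 0 0"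
    have gg: "g * g = 1" by (simp add: g_def one_m3_def)
    have "lin_sub g F x y z = cub c3 0 c1 c9 c8 c7 c6 c5 c4 c0 x y z" for x y z
      by (simp add: lin_sub_def g_def c c2 cub_def mult_ac)
    from *[OF smooth_cubic_lin_sub[OF gg gg F] this 2] show ?thesis
      by (rule weierstrass_like_lin_sub[OF gg gg])
  next
    case 3
    have "singular_at F 0 1 0"
      unfolding singular_at_def
    proof (intro allI)
      fix u v w
      have "F (0 + s*u) (1 + s*v) (0 + s*w) = s^2 * ((c4*u^2 + c9*w^2 + c0*u*w) + s * (c1*u^3 + c3*w^3 +
        c4*u^2*v + c6*u^2*w + c7*u*w^2 + c9*v*w^2 + c0*u*v*w))" for s
        by (simp add: c cub_def c2 3 power2_eq_square power3_eq_cube algebra_simps)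
      then show "\<exists>a b. \<forall>s. F (0 + s*u) (1 + s*v) (0 + s*w) = s^2 * (a + s*b)" by blast
    qed
    then show ?thesis using F unfolding smooth_cubic_def by (metis zero_neq_one)
  qed
qed

lemma smooth_cubic_weierstrass_like:
  fixes F :: "'k::{alg_closed_field, field_char_0} \<Rightarrow> 'k \<Rightarrow> 'k \<Rightarrow> 'k"
  assumes F: "smooth_cubic F"
  shows "weierstrass_like F"
proof -
  obtain c1 c2 c3 c4 c5 c6 c7 c8 c9 c0 where c: "\<And>x y z. F x y z = cub c1 c2 c3 c4 c5 c6 c7 c8 c9 c0 x y z"
    using F unfolding smooth_cubic_def is_cubic_def by blast
  show ?thesis
  proof (cases "c1 = 0")
    case True
    define g :: "'k m3" where "g = M3 0 1 0 1 0 0 0 0 1"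
    have gg: "g * g = 1" by (simp add: g_def one_m3_def)
    have "lin_sub g F 0 1 0 = 0" by (simp add: lin_sub_def g_def c cub_def True)
    from point_weierstrass_like[OF smooth_cubic_lin_sub[OF gg gg F] this] show ?thesis
      by (rule weierstrass_like_lin_sub[OF gg gg])
  next
    case False
    then have "degree [:c2, c5, c4, c1:] > 0" by simp
    \<comment> \<open>The polynomial is the restriction of \<open>F\<close> to the points
      \<open>(r, 1, 0)\<close>; its root gives a point that is moved to
      \<open>(0:1:0)\<close>.\<close>
    from alg_closed_imp_poly_has_root[OF this] obtain r where r: "poly [:c2, c5, c4, c1:] r = 0" by blast
    define g h where "g = M3 1 r 0 0 1 0 0 0 1" and "h = M3 1 (-r) 0 0 1 0 0 0 1"
    have gh: "g * h = 1" "h * g = 1" by (simp_all add: g_def h_def one_m3_def)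
    have "lin_sub g F 0 1 0 = 0"
      using r by (simp add: lin_sub_def g_def c cub_def power2_eq_square power3_eq_cube algebra_simps)
    from point_weierstrass_like[OF smooth_cubic_lin_sub[OF gh F] this] show ?thesis
      by (rule weierstrass_like_lin_sub[OF gh])
  qed
qed

lemma smooth_weierstrass_discriminant:
  fixes a :: "'k::field_char_0"
  assumes F: "smooth_cubic (weierstrass a b)"
  shows "4 * a^3 + 27 * b^2 \<noteq> 0"
proof
  assume disc: "4 * a^3 + 27 * b^2 = 0"
  obtain p where p: "3 * p^2 + a = 0" "p^3 + a*p + b = 0"
  proof (cases "a = 0")
    case True
    then show thesis using disc that[of 0] by simp
  next
    case False
    \<comment> \<open>The double root: from \<open>a = - 3 * p^2\<close> and
      \<open>b = 2 * p^3\<close>. It gives the singular point \<open>(p:0:1)\<close>.\<close>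
    define p where "p = - (3*b) / (2*a)"
    have ap: "2*a*p = - (3*b)" using False by (simp add: p_def)
    have "4 * a^2 * (3 * p^2 + a) = 0" using ap disc by Groebner_Basis.algebra
    then have 1: "3 * p^2 + a = 0" using False by simp
    have "3 * (p^3 + a*p + b) = 0" using 1 ap by Groebner_Basis.algebra
    then have "p^3 + a*p + b = 0" by (simp only: mult_eq_0_iff) simp
    with 1 show thesis by (rule that)
  qed
  have "singular_at (weierstrass a b) p 0 1"
    unfolding singular_at_def
  proof (intro allI)
    fix u v w
    have "weierstrass a b (p + s*u) (0 + s*v) (1 + s*w) = s^2 * ((3*p*u^2 + a*(p*w^2 + 2*u*w) + 3*b*w^2 - v^2) +
      s * (u^3 + a*u*w^2 + b*w^3 - v^2*w))" for s
      using p unfolding weierstrass_def by Groebner_Basis.algebra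
    then show "\<exists>a' b'. \<forall>s. weierstrass a b (p + s*u) (0 + s*v) (1 + s*w) = s^2 * (a' + s*b')" by blast
  qed
  then show False using F unfolding smooth_cubic_def by (metis zero_neq_one)
qed

lemma seventy_two_classes_smooth_cubic:
  fixes F :: "'k::{alg_closed_field, field_char_0} \<Rightarrow> 'k \<Rightarrow> 'k \<Rightarrow> 'k"
  assumes F: "smooth_cubic F"
  shows "seventy_two_classes F"
proof -
  obtain g h a b where *: "g * h = 1" "h * g = 1" "lin_sub g F = weierstrass a b"
    using smooth_cubic_weierstrass_like[OF F] unfolding weierstrass_like_def by blast
  have "4 * a^3 + 27 * b^2 \<noteq> 0"
    using smooth_cubic_lin_sub[OF *(1,2) F] smooth_weierstrass_discriminant unfolding *(3) by blast
  then have "seventy_two_classes (lin_sub g F)"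
    unfolding *(3) by (rule seventy_two_classes_weierstrass)
  then show ?thesis by (rule seventy_two_classes_lin_sub[OF *(1,2)])
qed

section \<open>Evaluation of polynomials in several variables\<close>

abbreviation lookup where "lookup \<equiv> Poly_Mapping.lookup"
abbreviation keys where "keys \<equiv> Poly_Mapping.keys"

lemma sum_lookup_superset:
  fixes p :: "'a \<Rightarrow>\<^sub>0 'b::zero" and G :: "'a \<Rightarrow> 'b \<Rightarrow> 'c::comm_monoid_add"
  assumes "finite S" "keys p \<subseteq> S" "\<And>m. G m 0 = 0"
  shows "(\<Sum>m\<in>keys p. G m (lookup p m)) = (\<Sum>m\<in>S. G m (lookup p m))"
  by (rule sum.mono_neutral_left) (use assms in \<open>auto simp: in_keys_iff\<close>)

lemma sum_lookup_add:
  fixes p q :: "'a \<Rightarrow>\<^sub>0 'b::comm_monoid_add" and G :: "'a \<Rightarrow> 'b \<Rightarrow> 'c::comm_monoid_add"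
  assumes "\<And>m. G m 0 = 0" "\<And>m x y. G m (x + y) = G m x + G m y"
  shows "(\<Sum>m\<in>keys (p + q). G m (lookup (p + q) m)) =
    (\<Sum>m\<in>keys p. G m (lookup p m)) + (\<Sum>m\<in>keys q. G m (lookup q m))"
proof -
  let ?S = "keys p \<union> keys q"
  have "(\<Sum>m\<in>keys (p + q). G m (lookup (p + q) m)) = (\<Sum>m\<in>?S. G m (lookup (p + q) m))"
    by (rule sum_lookup_superset) (use Poly_Mapping.keys_add[of p q] assms in auto)
  also have "\<dots> = (\<Sum>m\<in>?S. G m (lookup p m)) + (\<Sum>m\<in>?S. G m (lookup q m))"
    by (simp add: lookup_add assms sum.distrib)
  also have "(\<Sum>m\<in>?S. G m (lookup p m)) = (\<Sum>m\<in>keys p. G m (lookup p m))"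
    by (rule sum_lookup_superset[symmetric]) (use assms in auto)
  also have "(\<Sum>m\<in>?S. G m (lookup q m)) = (\<Sum>m\<in>keys q. G m (lookup q m))"
    by (rule sum_lookup_superset[symmetric]) (use assms in auto)
  finally show ?thesis .
qed

lemma poly_mapping_eq_sum_single: "p = (\<Sum>m\<in>keys p. Poly_Mapping.single m (lookup p m))"
proof (rule poly_mapping_eqI)
  fix m
  have "lookup (\<Sum>m\<in>keys p. Poly_Mapping.single m (lookup p m)) m =
    (\<Sum>n\<in>keys p. if n = m then lookup p n else 0)"
    by (simp add: Poly_Mapping.lookup_sum lookup_single when_def)
  then show "lookup p m = lookup (\<Sum>m\<in>keys p. Poly_Mapping.single m (lookup p m)) m"
    by (simp add: in_keys_iff)
qed

definition monomial_value :: "('v::finite \<Rightarrow> 'r::comm_semiring_1) \<Rightarrow> ('v \<Rightarrow>\<^sub>0 nat) \<Rightarrow> 'r"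
  where "monomial_value a m = (\<Prod>v\<in>UNIV. a v ^ lookup m v)"

lemma mpoly_hom_alt:
  fixes a :: "'v::finite \<Rightarrow> 'r::comm_semiring_1"
  shows "mpoly_hom h a p = (\<Sum>m\<in>keys p. h (lookup p m) * monomial_value a m)"
proof -
  have "(\<Prod>v\<in>keys m. a v ^ lookup m v) = monomial_value a m" for m
    unfolding monomial_value_def by (rule prod.mono_neutral_left) (auto simp: in_keys_iff)
  then show ?thesis by (simp add: mpoly_hom_def)
qed

lemma mpoly_eval_alt:
  fixes a :: "'v::finite \<Rightarrow> 'k::comm_semiring_1"
  shows "mpoly_eval p a = (\<Sum>m\<in>keys p. lookup p m * monomial_value a m)"
  by (simp add: mpoly_eval_def mpoly_hom_alt)

lemma mpoly_eval_add: "mpoly_eval (p + q) a = mpoly_eval p a + mpoly_eval q (a :: 'v::finite \<Rightarrow> 'k::comm_semiring_1)"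
  unfolding mpoly_eval_alt by (rule sum_lookup_add) (simp_all add: distrib_right)

lemma mpoly_eval_0 [simp]: "mpoly_eval 0 a = 0"
  by (simp add: mpoly_eval_def mpoly_hom_def)

lemma mpoly_eval_sum: "mpoly_eval (\<Sum>i\<in>I. p i) a = (\<Sum>i\<in>I. mpoly_eval (p i) (a :: 'v::finite \<Rightarrow> 'k::comm_semiring_1))"
  by (induction I rule: infinite_finite_induct) (simp_all add: mpoly_eval_add)

lemma mpoly_eval_minus:
  "mpoly_eval (p - q) a = mpoly_eval p a - mpoly_eval q (a :: 'v::finite \<Rightarrow> 'k::comm_ring_1)"
  using mpoly_eval_add[of "p - q" q a] by simp

lemma mpoly_eval_single:
  fixes a :: "'v::finite \<Rightarrow> 'k::comm_semiring_1"
  shows "mpoly_eval (Poly_Mapping.single m c) a = c * monomial_value a m"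
  by (simp add: mpoly_eval_alt)

lemma monomial_value_add: "monomial_value a (m + n) = monomial_value a m * monomial_value a n"
  by (simp add: monomial_value_def lookup_add power_add prod.distrib)

lemma mpoly_eval_mult:
  fixes a :: "'v::finite \<Rightarrow> 'k::comm_semiring_1"
  shows "mpoly_eval (p * q) a = mpoly_eval p a * mpoly_eval q a"
proof -
  have "p * q = (\<Sum>m\<in>keys p. \<Sum>n\<in>keys q. Poly_Mapping.single (m + n) (lookup p m * lookup q n))"
    by (subst (1) poly_mapping_eq_sum_single[of p], subst (1) poly_mapping_eq_sum_single[of q])
      (simp add: sum_product mult_single)
  then have "mpoly_eval (p * q) a = (\<Sum>m\<in>keys p. \<Sum>n\<in>keys q. (lookup p m * monomial_value a m) * (lookup q n * monomial_value a n))"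
    by (simp add: mpoly_eval_sum mpoly_eval_single monomial_value_add mult_ac)
  then show ?thesis by (simp add: mpoly_eval_alt sum_product)
qed

lemma mpoly_eval_1 [simp]: "mpoly_eval 1 a = 1" for a :: "'v::finite \<Rightarrow> 'k::comm_semiring_1"
  using mpoly_eval_single[of 0 1 a] by (simp add: monomial_value_def)

lemma mpoly_eval_power: "mpoly_eval (p ^ n) a = mpoly_eval p (a :: 'v::finite \<Rightarrow> 'k::comm_semiring_1) ^ n"
  by (induction n) (simp_all add: mpoly_eval_mult)

lemma mpoly_eval_prod: "mpoly_eval (\<Prod>i\<in>I. p i) a = (\<Prod>i\<in>I. mpoly_eval (p i) (a :: 'v::finite \<Rightarrow> 'k::comm_semiring_1))"
  by (induction I rule: infinite_finite_induct) (simp_all add: mpoly_eval_mult)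

lemma mpoly_eval_const [simp]: "mpoly_eval (mpoly_const c) a = c" for a :: "'v::finite \<Rightarrow> 'k::comm_semiring_1"
  by (simp add: mpoly_const_def mpoly_eval_single monomial_value_def)

lemma mpoly_eval_var [simp]: "mpoly_eval (mpoly_var v) a = (a :: 'v::finite \<Rightarrow> 'k::comm_semiring_1) v"
proof -
  have "monomial_value a (Poly_Mapping.single v 1) = (\<Prod>w\<in>UNIV. if w = v then a v else 1)"
    unfolding monomial_value_def by (rule prod.cong) (auto simp: lookup_single when_def)
  then show ?thesis by (simp add: mpoly_var_def mpoly_eval_single)
qed

lemma mpoly_eval_cubic_surface:
  "mpoly_eval (cubic_surface f) a = a None ^ 3 - mpoly_eval f (\<lambda>i. a (Some i))"
  by (simp add: cubic_surface_def mpoly_eval_minus mpoly_eval_power mpoly_hom_def mpoly_eval_sum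
      mpoly_eval_mult mpoly_eval_prod mpoly_eval_def[of f])

text \<open>The restriction of \<open>p\<close> to the line through \<open>a\<close> in direction
  \<open>u\<close>. It links the formal derivatives of \<open>nondegenerate\<close> with the
  criterion \<open>singular_at\<close>, which is stated along lines.\<close>

definition line_poly :: "('v::finite \<Rightarrow> 'k) \<Rightarrow> ('v \<Rightarrow> 'k) \<Rightarrow> ('v, 'k) mpoly \<Rightarrow> 'k::{comm_ring_1,idom} poly"
  where "line_poly a u p = (\<Sum>m\<in>keys p. smult (lookup p m) (\<Prod>v\<in>UNIV. [:a v, u v:] ^ lookup m v))"

lemma poly_line_poly: "poly (line_poly a u p) s = mpoly_eval p (\<lambda>v. a v + s * u v)"
  by (simp add: line_poly_def mpoly_eval_alt monomial_value_def poly_sum poly_prod)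

lemma pderiv_line_poly:
  fixes a :: "'v::finite \<Rightarrow> 'k::{field_char_0}"
  shows "poly (pderiv (line_poly a u p)) 0 = (\<Sum>v\<in>UNIV. u v * mpoly_eval (mpoly_deriv v p) a)"
proof -
  \<comment> \<open>The truncated subtraction is harmless: when \<open>v\<close> does not occur in
    \<open>m\<close>, the factor \<open>of_nat (lookup m v)\<close> is zero.\<close>
  have mono: "monomial_value a (m - Poly_Mapping.single v 1) * of_nat (lookup m v) =
    (\<Prod>w\<in>UNIV - {v}. a w ^ lookup m w) * (of_nat (lookup m v) * a v ^ (lookup m v - 1))" for m v
  proof -
    have "monomial_value a (m - Poly_Mapping.single v 1) =
      a v ^ (lookup m v - 1) * (\<Prod>w\<in>UNIV - {v}. a w ^ lookup (m - Poly_Mapping.single v 1) w)"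
      unfolding monomial_value_def by (subst prod.remove[of _ v]) (simp_all add: lookup_minus)
    also have "(\<Prod>w\<in>UNIV - {v}. a w ^ lookup (m - Poly_Mapping.single v 1) w) = (\<Prod>w\<in>UNIV - {v}. a w ^ lookup m w)"
      by (rule prod.cong) (auto simp: lookup_minus lookup_single when_def)
    finally show ?thesis by (simp add: mult_ac)
  qed
  have "poly (pderiv (\<Prod>v\<in>UNIV. [:a v, u v:] ^ lookup m v)) 0 =
    (\<Sum>v\<in>UNIV. u v * (monomial_value a (m - Poly_Mapping.single v 1) * of_nat (lookup m v)))" for m
    unfolding mono by (simp add: pderiv_prod poly_sum poly_prod pderiv_power pderiv_pCons mult_ac)
  then have "poly (pderiv (line_poly a u p)) 0 = (\<Sum>m\<in>keys p. lookup p m *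
    (\<Sum>v\<in>UNIV. u v * (monomial_value a (m - Poly_Mapping.single v 1) * of_nat (lookup m v))))"
    by (simp add: line_poly_def higher_pderiv_sum[of 1, simplified] pderiv_smult poly_sum)
  also have "\<dots> = (\<Sum>m\<in>keys p. \<Sum>v\<in>UNIV. u v * (of_nat (lookup m v) * lookup p m * monomial_value a (m - Poly_Mapping.single v 1)))"
    by (simp add: sum_distrib_left mult_ac)
  also have "\<dots> = (\<Sum>v\<in>UNIV. \<Sum>m\<in>keys p. u v * (of_nat (lookup m v) * lookup p m * monomial_value a (m - Poly_Mapping.single v 1)))"
    by (rule sum.swap)
  also have "\<dots> = (\<Sum>v\<in>UNIV. u v * mpoly_eval (mpoly_deriv v p) a)"
    by (simp add: mpoly_deriv_def mpoly_eval_sum mpoly_eval_single sum_distrib_left)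
  finally show ?thesis .
qed

section \<open>Smoothness of a nondegenerate form\<close>

lemma UNIV_three: "(UNIV :: 3 set) = {0, 1, 2}"
proof -
  have "card {0, 1, 2 :: 3} = 3" by simp
  then show ?thesis by (intro card_subset_eq[symmetric]) simp_all
qed

lemma three_neq [simp]: "(0::3) \<noteq> 1" "(0::3) \<noteq> 2" "(1::3) \<noteq> 2" "(1::3) \<noteq> 0" "(2::3) \<noteq> 0" "(2::3) \<noteq> 1"
  by simp_all

definition tri :: "'a \<Rightarrow> 'a \<Rightarrow> 'a \<Rightarrow> 3 \<Rightarrow> 'a"
  where "tri x y z i = (if i = 0 then x else if i = 1 then y else z)"

lemma tri_simps [simp]: "tri x y z 0 = x" "tri x y z 1 = y" "tri x y z 2 = z"
  by (simp_all add: tri_def)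

lemma all_three: "(\<forall>i::3. P i) \<longleftrightarrow> P 0 \<and> P 1 \<and> P 2"
proof -
  have "(\<forall>i::3. P i) \<longleftrightarrow> (\<forall>i\<in>UNIV. P i)" by simp
  then show ?thesis unfolding UNIV_three by simp
qed

lemma tri_eta: "tri (f 0) (f 1) (f 2) = f"
proof
  have "\<forall>i. tri (f 0) (f 1) (f 2) i = f i" unfolding all_three by simp
  then show "tri (f 0) (f 1) (f 2) i = f i" for i ..
qed

lemma sum_three: "(\<Sum>i\<in>UNIV. f i) = f 0 + f 1 + f (2 :: 3)" for f :: "3 \<Rightarrow> 'a::comm_monoid_add"
  unfolding UNIV_three by (simp add: add.assoc)

lemma prod_three: "(\<Prod>i\<in>UNIV. f i) = f 0 * f 1 * f (2 :: 3)" for f :: "3 \<Rightarrow> 'a::comm_monoid_mult"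
  unfolding UNIV_three by (simp add: mult.assoc)

lemma is_cubic_monomial:
  assumes "i + j + k = 3"
  shows "is_cubic (\<lambda>x y z :: 'k::comm_ring_1. x^i * y^j * z^k)"
proof -
  have "i = 0 \<or> i = 1 \<or> i = 2 \<or> i = 3" "j = 0 \<or> j = 1 \<or> j = 2 \<or> j = 3" using assms by linarith+
  then consider "i = 3" "j = 0" "k = 0" | "i = 0" "j = 3" "k = 0"
    | "i = 0" "j = 0" "k = 3" | "i = 2" "j = 1" "k = 0"
    | "i = 1" "j = 2" "k = 0" | "i = 2" "j = 0" "k = 1"
    | "i = 1" "j = 0" "k = 2" | "i = 0" "j = 2" "k = 1"
    | "i = 0" "j = 1" "k = 2" | "i = 1" "j = 1" "k = 1"
    using assms by (elim disjE) auto
  then show ?thesis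
  proof cases
    case 1
    then show ?thesis by (intro is_cubicI[of _ 1 0 0 0 0 0 0 0 0 0]) (simp add: cub_def)
  next
    case 2
    then show ?thesis by (intro is_cubicI[of _ 0 1 0 0 0 0 0 0 0 0]) (simp add: cub_def)
  next
    case 3
    then show ?thesis by (intro is_cubicI[of _ 0 0 1 0 0 0 0 0 0 0]) (simp add: cub_def)
  next
    case 4
    then show ?thesis by (intro is_cubicI[of _ 0 0 0 1 0 0 0 0 0 0]) (simp add: cub_def)
  next
    case 5
    then show ?thesis by (intro is_cubicI[of _ 0 0 0 0 1 0 0 0 0 0]) (simp add: cub_def)
  next
    case 6
    then show ?thesis by (intro is_cubicI[of _ 0 0 0 0 0 1 0 0 0 0]) (simp add: cub_def)
  next
    case 7
    then show ?thesis by (intro is_cubicI[of _ 0 0 0 0 0 0 1 0 0 0]) (simp add: cub_def)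
  next
    case 8
    then show ?thesis by (intro is_cubicI[of _ 0 0 0 0 0 0 0 1 0 0]) (simp add: cub_def)
  next
    case 9
    then show ?thesis by (intro is_cubicI[of _ 0 0 0 0 0 0 0 0 1 0]) (simp add: cub_def)
  next
    case 10
    then show ?thesis by (intro is_cubicI[of _ 0 0 0 0 0 0 0 0 0 1]) (simp add: cub_def)
  qed
qed

lemma is_cubic_mpoly_eval:
  fixes f :: "(3, 'k::comm_ring_1) mpoly"
  assumes "form_of_degree 3 f"
  shows "is_cubic (\<lambda>x y z. mpoly_eval f (tri x y z))"
proof -
  have "is_cubic (\<lambda>x y z. \<Sum>m\<in>S. lookup f m * monomial_value (tri x y z) m)" if "finite S" "S \<subseteq> keys f" for S
    using that
  proof (induction S)
    case empty
    show ?case by (rule is_cubicI[of _ 0 0 0 0 0 0 0 0 0 0]) (simp add: cub_def)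
  next
    case (insert m S)
    have "(\<Sum>v\<in>keys m. lookup m v) = 3" using assms insert.prems by (auto simp: form_of_degree_def)
    also have "(\<Sum>v\<in>keys m. lookup m v) = (\<Sum>v\<in>UNIV. lookup m v)"
      by (rule sum.mono_neutral_left) (auto simp: in_keys_iff)
    finally have "lookup m 0 + lookup m 1 + lookup m 2 = 3" by (simp only: sum_three)
    from is_cubic_scale[OF is_cubic_monomial[OF this], of "lookup f m"]
    have "is_cubic (\<lambda>x y z. lookup f m * monomial_value (tri x y z) m)"
      by (simp only: monomial_value_def prod_three tri_simps)
    with insert show ?case by (simp add: is_cubic_add)
  qed
  from this[OF finite_keys order_refl] show ?thesis by (simp only: mpoly_eval_alt)
qed

text \<open>A singular point of \<open>f = 0\<close> gives, with \<open>w = 0\<close>, a singular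
  point of the surface, because \<open>w^3\<close> contributes nothing to first order there.\<close>

lemma smooth_cubic_mpoly_eval:
  fixes f :: "(3, 'k::{alg_closed_field, field_char_0}) mpoly"
  assumes f: "form_of_degree 3 f" "nondegenerate f"
  shows "smooth_cubic (\<lambda>x y z. mpoly_eval f (tri x y z))"
  unfolding smooth_cubic_def
proof (intro conjI allI impI, rule is_cubic_mpoly_eval[OF f(1)])
  fix p q r assume sing: "singular_at (\<lambda>x y z. mpoly_eval f (tri x y z)) p q r"
  define P where "P = tri p q r"
  have line: "\<exists>a b. line_poly P u f = [:0, 0, a, b:]" for u
  proof -
    obtain a b where ab: "\<And>s. mpoly_eval f (tri (p + s * u 0) (q + s * u 1) (r + s * u 2)) = s^2 * (a + s*b)"
      using sing unfolding singular_at_def by meson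
    have "tri (p + s * u 0) (q + s * u 1) (r + s * u 2) = (\<lambda>v. P v + s * u v)" for s
      by (subst tri_eta[symmetric, of "\<lambda>v. P v + s * u v"]) (simp add: P_def)
    with ab have "poly (line_poly P u f) s = poly [:0, 0, a, b:] s" for s
      by (simp add: poly_line_poly power2_eq_square algebra_simps)
    then have "line_poly P u f = [:0, 0, a, b:]" by (intro poly_eq_poly_eq_iff[THEN iffD1]) (rule ext)
    then show ?thesis by blast
  qed
  define Q :: "3 option \<Rightarrow> 'k" where "Q = case_option 0 P"
  have fP: "mpoly_eval f P = 0"
  proof -
    obtain a b where "line_poly P (\<lambda>_. 0) f = [:0, 0, a, b:]" using line by blast
    then show ?thesis using poly_line_poly[of P "\<lambda>_. 0" f 0] by simp
  qed
  have surf: "line_poly Q u (cubic_surface f) = [:0, 0, 0, u None ^ 3:] - line_poly P (\<lambda>i. u (Some i)) f" for u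
  proof (intro poly_eq_poly_eq_iff[THEN iffD1] ext)
    fix s
    show "poly (line_poly Q u (cubic_surface f)) s = poly ([:0, 0, 0, u None ^ 3:] - line_poly P (\<lambda>i. u (Some i)) f) s"
      by (simp add: poly_line_poly mpoly_eval_cubic_surface Q_def power3_eq_cube mult_ac)
  qed
  have "mpoly_eval (mpoly_deriv v (cubic_surface f)) Q = 0" for v
  proof -
    \<comment> \<open>Along the unit vector for \<open>v\<close>, the linear coefficient of the
      restriction is the partial derivative with respect to \<open>v\<close>.\<close>
    define u where "u w = (if w = v then 1 else 0 :: 'k)" for w
    obtain a b where "line_poly P (\<lambda>i. u (Some i)) f = [:0, 0, a, b:]" using line by blast
    then have "poly (pderiv (line_poly Q u (cubic_surface f))) 0 = 0"
      unfolding surf by (simp add: pderiv_pCons)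
    then have "(\<Sum>w\<in>UNIV. u w * mpoly_eval (mpoly_deriv w (cubic_surface f)) Q) = 0"
      by (simp only: pderiv_line_poly)
    also have "(\<Sum>w\<in>UNIV. u w * mpoly_eval (mpoly_deriv w (cubic_surface f)) Q) =
      (\<Sum>w\<in>UNIV. if w = v then mpoly_eval (mpoly_deriv v (cubic_surface f)) Q else 0)"
      by (rule sum.cong) (auto simp: u_def)
    finally show ?thesis by simp
  qed
  moreover have "mpoly_eval (cubic_surface f) Q = 0"
    by (simp add: mpoly_eval_cubic_surface Q_def fP)
  ultimately have "Q v = 0" for v
    using f(2) unfolding nondegenerate_def nonsingular_hypersurface_def by blast
  from this[of "Some 0"] this[of "Some 1"] this[of "Some 2"]
  show "p = 0" "q = 0" "r = 0" by (simp_all add: Q_def P_def)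
qed

section \<open>Three by three matrices as elements of \<open>Mat 3\<close>\<close>

definition to_mat :: "'k m3 \<Rightarrow> 'k mat"
  where "to_mat M = mat 3 3 (\<lambda>(i, j). [[e11 M, e12 M, e13 M], [e21 M, e22 M, e23 M], [e31 M, e32 M, e33 M]] ! i ! j)"

definition from_mat :: "'k mat \<Rightarrow> 'k m3"
  where "from_mat A = M3 (A $$ (0,0)) (A $$ (0,1)) (A $$ (0,2)) (A $$ (1,0)) (A $$ (1,1)) (A $$ (1,2))
    (A $$ (2,0)) (A $$ (2,1)) (A $$ (2,2))"

lemma to_mat_carrier [simp]: "to_mat M \<in> carrier_mat 3 3"
  by (simp add: to_mat_def)

lemma to_mat_dim [simp]: "dim_row (to_mat M) = 3" "dim_col (to_mat M) = 3"
  by (simp_all add: to_mat_def)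

lemma less_three: "i < 3 \<longleftrightarrow> i = 0 \<or> i = 1 \<or> i = (2::nat)"
  by auto

lemma from_mat_to_mat [simp]: "from_mat (to_mat M) = M"
  by (cases M) (simp add: from_mat_def to_mat_def)

lemma mat3_eqI:
  assumes "A \<in> carrier_mat 3 3" "B \<in> carrier_mat 3 3" "from_mat A = from_mat B"
  shows "A = B"
  by (rule eq_matI) (use assms in \<open>auto simp: from_mat_def less_three\<close>)

lemma to_mat_from_mat [simp]: "A \<in> carrier_mat 3 3 \<Longrightarrow> to_mat (from_mat A) = A"
  by (rule mat3_eqI) simp_all

lemma from_mat_add:
  "A \<in> carrier_mat 3 3 \<Longrightarrow> B \<in> carrier_mat 3 3 \<Longrightarrow> from_mat (A + B) = from_mat A + from_mat (B :: 'k::comm_ring_1 mat)"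
  by (simp add: from_mat_def)

lemma from_mat_mult:
  "A \<in> carrier_mat 3 3 \<Longrightarrow> B \<in> carrier_mat 3 3 \<Longrightarrow> from_mat (A * B) = from_mat A * from_mat (B :: 'k::comm_ring_1 mat)"
  by (simp add: from_mat_def scalar_prod_def eval_nat_numeral)

lemma from_mat_smult: "A \<in> carrier_mat 3 3 \<Longrightarrow> from_mat (c \<cdot>\<^sub>m A) = c *# from_mat (A :: 'k::comm_ring_1 mat)"
  by (simp add: from_mat_def)

lemma from_mat_one [simp]: "from_mat (1\<^sub>m 3) = (1 :: 'k::comm_ring_1 m3)"
  by (simp add: from_mat_def one_m3_def)

lemma from_mat_zero [simp]: "from_mat (0\<^sub>m 3 3) = (0 :: 'k::comm_ring_1 m3)"
  by (simp add: from_mat_def zero_m3_def)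

lemma to_mat_add: "to_mat (M + N) = to_mat M + to_mat (N :: 'k::comm_ring_1 m3)"
  by (rule mat3_eqI) (simp_all add: from_mat_add)

lemma to_mat_mult: "to_mat (M * N) = to_mat M * to_mat (N :: 'k::comm_ring_1 m3)"
  by (rule mat3_eqI) (simp_all add: from_mat_mult mult_carrier_mat[of _ 3 3])

lemma to_mat_smult: "to_mat (c *# M) = c \<cdot>\<^sub>m to_mat (M :: 'k::comm_ring_1 m3)"
  by (rule mat3_eqI) (simp_all add: from_mat_smult)

lemma to_mat_one [simp]: "to_mat 1 = (1\<^sub>m 3 :: 'k::comm_ring_1 mat)"
  by (rule mat3_eqI) simp_all

section \<open>Homomorphisms from the free algebra\<close>

primrec letters :: "'v free_mon \<Rightarrow> 'v list" where "letters (Letters u) = u"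

lemma letters_add: "letters (u + v) = letters u @ letters v"
  by (cases u; cases v) simp

lemma letters_0 [simp]: "letters 0 = []"
  by (simp add: zero_free_mon_def)

definition fa_hom :: "('v \<Rightarrow> 'k::comm_ring_1 m3) \<Rightarrow> ('v, 'k) free_alg \<Rightarrow> 'k m3"
  where "fa_hom A p = (\<Sum>w\<in>keys p. lookup p w *# prod_list (map A (letters w)))"

lemma fa_hom_add: "fa_hom A (p + q) = fa_hom A p + fa_hom A q"
  unfolding fa_hom_def by (rule sum_lookup_add) (simp_all add: sm_simps)

lemma fa_hom_0 [simp]: "fa_hom A 0 = 0"
  by (simp add: fa_hom_def)

lemma fa_hom_sum: "fa_hom A (\<Sum>i\<in>I. p i) = (\<Sum>i\<in>I. fa_hom A (p i))"
  by (induction I rule: infinite_finite_induct) (simp_all add: fa_hom_add)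

lemma fa_hom_minus: "fa_hom A (p - q) = fa_hom A p - fa_hom A q"
  using fa_hom_add[of A "p - q" q] by simp

lemma fa_hom_single: "fa_hom A (Poly_Mapping.single w c) = c *# prod_list (map A (letters w))"
  by (simp add: fa_hom_def)

lemma fa_hom_mult: "fa_hom A (p * q) = fa_hom A p * fa_hom A q"
proof -
  have "p * q = (\<Sum>m\<in>keys p. \<Sum>n\<in>keys q. Poly_Mapping.single (m + n) (lookup p m * lookup q n))"
    by (subst (1) poly_mapping_eq_sum_single[of p], subst (1) poly_mapping_eq_sum_single[of q])
      (simp add: sum_product mult_single)
  then have "fa_hom A (p * q) = (\<Sum>m\<in>keys p. \<Sum>n\<in>keys q.
      (lookup p m *# prod_list (map A (letters m))) * (lookup q n *# prod_list (map A (letters n))))"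
    by (simp add: fa_hom_sum fa_hom_single letters_add sm_simps mult_ac)
  then show ?thesis by (simp add: fa_hom_def sum_product)
qed

lemma fa_hom_const: "fa_hom A (fa_const c) = c *# 1"
  by (simp add: fa_const_def fa_hom_single)

lemma fa_hom_1 [simp]: "fa_hom A 1 = 1"
  using fa_hom_const[of A 1] by (simp add: fa_const_def)

lemma fa_hom_gen [simp]: "fa_hom A (fa_gen i) = A i"
  by (simp add: fa_gen_def fa_hom_single)

lemma fa_hom_power: "fa_hom A (p ^ n) = fa_hom A p ^ n"
  by (induction n) (simp_all add: fa_hom_mult)

lemma fa_hom_conj:
  assumes "\<theta>' * \<theta> = 1" "\<theta> * \<theta>' = (1 :: 'k::comm_ring_1 m3)"
  shows "fa_hom (\<lambda>i. \<theta> * A i * \<theta>') p = \<theta> * fa_hom A p * \<theta>'"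
proof -
  define B where "B i = \<theta> * A i * \<theta>'" for i
  have "prod_list (map B u) = \<theta> * prod_list (map A u) * \<theta>'" for u
  proof (induction u)
    case (Cons i u)
    have "prod_list (map B (i # u)) = \<theta> * A i * (\<theta>' * \<theta>) * prod_list (map A u) * \<theta>'"
      by (simp only: list.map prod_list.Cons Cons.IH B_def mult.assoc)
    then show ?case by (simp add: assms mult.assoc)
  qed (simp add: assms)
  then have "fa_hom B p = \<theta> * fa_hom A p * \<theta>'"
    by (simp add: fa_hom_def sum_distrib_left sum_distrib_right sm_simps)
  then show ?thesis by (simp only: B_def[abs_def])
qed

text \<open>Words are products of generators and span the free algebra. Compatibility with scalars
  is phrased through \<open>fa_const\<close>, as in \<open>clifford_smult\<close>.\<close>

lemma fa_hom_unique:
  fixes h :: "('v, 'k::comm_ring_1) free_alg \<Rightarrow> 'k m3"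
  assumes add: "\<And>p q. h (p + q) = h p + h q" and mult: "\<And>p q. h (p * q) = h p * h q" and one: "h 1 = 1"
    and smult: "\<And>c p. h (fa_const c * p) = c *# h p"
  shows "h p = fa_hom (\<lambda>i. h (fa_gen i)) p"
proof -
  have "h 0 = 0" using add[of 0 0] by simp
  then have sum: "h (\<Sum>i\<in>I. q i) = (\<Sum>i\<in>I. h (q i))" for I and q :: "'v free_mon \<Rightarrow> ('v, 'k) free_alg"
    by (induction I rule: infinite_finite_induct) (simp_all add: add)
  have word: "h (Poly_Mapping.single (Letters u) 1) = prod_list (map (\<lambda>i. h (fa_gen i)) u)" for u
  proof (induction u)
    case Nil
    show ?case using one by (simp add: zero_free_mon_def[symmetric])
  next
    case (Cons i u)
    have "Poly_Mapping.single (Letters (i # u)) (1 :: 'k) = fa_gen i * Poly_Mapping.single (Letters u) 1"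
      by (simp add: fa_gen_def mult_single)
    then show ?case by (simp add: mult Cons.IH)
  qed
  have "h (Poly_Mapping.single w c) = c *# prod_list (map (\<lambda>i. h (fa_gen i)) (letters w))" for w c
  proof -
    have "Poly_Mapping.single w c = fa_const c * Poly_Mapping.single w (1 :: 'k)"
      by (simp add: fa_const_def mult_single)
    then have "h (Poly_Mapping.single w c) = c *# h (Poly_Mapping.single w 1)" by (simp only: smult)
    then show ?thesis by (cases w) (simp add: word)
  qed
  then show ?thesis
    by (subst poly_mapping_eq_sum_single[of p]) (simp add: sum fa_hom_def)
qed

section \<open>Representations of the Clifford algebra as triples\<close>

lemma ring_free_alg: "ring (free_alg_ring :: ('v, 'k::comm_ring_1) free_alg ring)"
proof -
  have "\<exists>y. x + y = 0" for x :: "('v, 'k) free_alg"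
    using add.right_inverse by blast
  then show ?thesis
    unfolding ring_of_type_algebra_def using add.right_inverse
    by unfold_locales (auto simp: algebra_simps Units_def)
qed

lemma free_alg_ring_simps [simp]:
  "carrier free_alg_ring = UNIV" "monoid.mult free_alg_ring = (*)" "monoid.one free_alg_ring = 1"
  "ring.zero free_alg_ring = 0" "ring.add free_alg_ring = (+)"
  by (simp_all add: ring_of_type_algebra_def fun_eq_iff)

lemma clifford_ideal: "ideal (clifford_ideal f) free_alg_ring"
  unfolding clifford_ideal_def by (rule ring.genideal_ideal[OF ring_free_alg]) simp

definition clifford_class :: "(3, 'k::comm_ring_1) mpoly \<Rightarrow> (3, 'k) free_alg \<Rightarrow> (3, 'k) free_alg set"
  where "clifford_class f p = clifford_ideal f +>\<^bsub>free_alg_ring\<^esub> p"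

lemma clifford_class_hom: "clifford_class f \<in> Ring.ring_hom free_alg_ring (clifford_algebra f)"
  using ideal.rcos_ring_hom[OF clifford_ideal[of f]]
  unfolding clifford_algebra_def clifford_class_def by (simp add: eta_contract_eq)

lemma clifford_class_simps:
  "clifford_class f p \<in> carrier (clifford_algebra f)"
  "clifford_class f (p * q) = clifford_class f p \<otimes>\<^bsub>clifford_algebra f\<^esub> clifford_class f q"
  "clifford_class f (p + q) = clifford_class f p \<oplus>\<^bsub>clifford_algebra f\<^esub> clifford_class f q"
  "clifford_class f 1 = \<one>\<^bsub>clifford_algebra f\<^esub>"
  using ring_hom_memE[OF clifford_class_hom[of f]] by simp_all

lemma clifford_smult_class: "clifford_smult f c (clifford_class f p) = clifford_class f (fa_const c * p)"
  by (simp add: clifford_smult_def clifford_class_simps flip: clifford_class_def)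

lemma carrier_clifford: "carrier (clifford_algebra f) = range (clifford_class f)"
  by (auto simp: clifford_algebra_def FactRing_def A_RCOSETS_def' clifford_class_def)

lemma clifford_relation_class:
  "r \<in> clifford_relations f \<Longrightarrow> clifford_class f r = clifford_class f 0"
proof -
  assume "r \<in> clifford_relations f"
  then have r: "r \<in> clifford_ideal f"
    unfolding clifford_ideal_def using ring.genideal_self[OF ring_free_alg, of "clifford_relations f"] by auto
  interpret ideal "clifford_ideal f" free_alg_ring by (rule clifford_ideal)
  have "clifford_ideal f +>\<^bsub>free_alg_ring\<^esub> s = clifford_ideal f" if "s \<in> clifford_ideal f" for s
    using that a_rcos_const by simp
  then show ?thesis using r zero_closed additive_subgroup.zero_closed[OF additive_subgroup_axioms]
    unfolding clifford_class_def by simp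
qed

definition rep_map :: "(3, 'k::comm_ring_1) mpoly \<Rightarrow> ((3, 'k) free_alg set \<Rightarrow> 'k mat) \<Rightarrow> (3, 'k) free_alg \<Rightarrow> 'k m3"
  where "rep_map f \<rho> p = from_mat (\<rho> (clifford_class f p))"

definition rep_triple :: "(3, 'k::comm_ring_1) mpoly \<Rightarrow> ((3, 'k) free_alg set \<Rightarrow> 'k mat) \<Rightarrow> 'k triple"
  where "rep_triple f \<rho> = (rep_map f \<rho> (fa_gen 0), rep_map f \<rho> (fa_gen 1), rep_map f \<rho> (fa_gen 2))"

context
  fixes f :: "(3, 'k::comm_ring_1) mpoly" and \<rho>
  assumes rep: "\<rho> \<in> clifford_rep f 3"
begin

lemma rep_carrier: "\<rho> (clifford_class f p) \<in> carrier_mat 3 3"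
  using rep ring_hom_memE(1)[of \<rho> "clifford_algebra f" "Mat 3"] clifford_class_simps(1)[of f p]
  by (auto simp: clifford_rep_def ring_mat_simps)

lemma rep_to_mat: "\<rho> (clifford_class f p) = to_mat (rep_map f \<rho> p)"
  by (simp add: rep_map_def rep_carrier)

lemma rep_map_hom:
  "rep_map f \<rho> (p + q) = rep_map f \<rho> p + rep_map f \<rho> q"
  "rep_map f \<rho> (p * q) = rep_map f \<rho> p * rep_map f \<rho> q"
  "rep_map f \<rho> 1 = 1"
  "rep_map f \<rho> (fa_const c * p) = c *# rep_map f \<rho> p"
proof -
  have hom: "\<rho> \<in> Ring.ring_hom (clifford_algebra f) (Mat 3)"
    and sm: "\<And>c p. \<rho> (clifford_smult f c (clifford_class f p)) = c \<cdot>\<^sub>m \<rho> (clifford_class f p)"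
    using rep clifford_class_simps(1) by (auto simp: clifford_rep_def)
  show "rep_map f \<rho> (p + q) = rep_map f \<rho> p + rep_map f \<rho> q"
    using ring_hom_memE(3)[OF hom clifford_class_simps(1) clifford_class_simps(1), of p q]
    by (simp add: rep_map_def clifford_class_simps ring_mat_simps from_mat_add rep_carrier)
  show "rep_map f \<rho> (p * q) = rep_map f \<rho> p * rep_map f \<rho> q"
    using ring_hom_memE(2)[OF hom clifford_class_simps(1) clifford_class_simps(1), of p q]
    by (simp add: rep_map_def clifford_class_simps ring_mat_simps from_mat_mult rep_carrier)
  show "rep_map f \<rho> 1 = 1"
    using ring_hom_memE(4)[OF hom] by (simp add: rep_map_def clifford_class_simps ring_mat_simps)
  show "rep_map f \<rho> (fa_const c * p) = c *# rep_map f \<rho> p"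
    using sm[of c p] by (simp add: rep_map_def clifford_smult_class from_mat_smult rep_carrier)
qed

lemma rep_map_eq: "rep_map f \<rho> p = fa_hom (\<lambda>i. rep_map f \<rho> (fa_gen i)) p"
  by (rule fa_hom_unique) (fact rep_map_hom)+

lemma rep_triple_triples: "rep_triple f \<rho> \<in> triples (\<lambda>x y z. mpoly_eval f (tri x y z))"
proof -
  have "(x *# rep_map f \<rho> (fa_gen 0) + y *# rep_map f \<rho> (fa_gen 1) + z *# rep_map f \<rho> (fa_gen 2)) ^ 3 =
    mpoly_eval f (tri x y z) *# 1" for x y z
  proof -
    let ?r = "(\<Sum>i\<in>UNIV. fa_const (tri x y z i) * fa_gen i) ^ 3 - fa_const (mpoly_eval f (tri x y z))"
    have "?r \<in> clifford_relations f" unfolding clifford_relations_def by blast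
    then have "rep_map f \<rho> ?r = rep_map f \<rho> 0" by (simp only: rep_map_def clifford_relation_class)
    then have "fa_hom (\<lambda>i. rep_map f \<rho> (fa_gen i)) ?r = 0"
      by (simp add: rep_map_eq[of ?r] rep_map_eq[of 0])
    then show ?thesis
      by (simp add: fa_hom_minus fa_hom_power fa_hom_add fa_hom_mult fa_hom_const sum_three sm_simps)
  qed
  then show ?thesis by (simp add: rep_triple_def triples_def)
qed

end

text \<open>Substituting the triple for the generators kills the relations, hence the two-sided
  ideal they generate, and so descends to the quotient.\<close>

lemma triple_is_rep:
  fixes f :: "(3, 'k::comm_ring_1) mpoly"
  assumes T: "T \<in> triples (\<lambda>x y z. mpoly_eval f (tri x y z))"
  shows "\<exists>\<rho>\<in>clifford_rep f 3. rep_triple f \<rho> = T"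
proof -
  obtain A0 A1 A2 where T_def: "T = (A0, A1, A2)" by (metis prod_cases3)
  define \<phi> where "\<phi> = fa_hom (tri A0 A1 A2)"
  have \<phi>: "\<phi> (p + q) = \<phi> p + \<phi> q" "\<phi> (p * q) = \<phi> p * \<phi> q" "\<phi> (p - q) = \<phi> p - \<phi> q" "\<phi> 1 = 1" "\<phi> 0 = 0"
    "\<phi> (fa_const c) = c *# 1" for p q c
    by (simp_all add: \<phi>_def fa_hom_add fa_hom_mult fa_hom_minus fa_hom_const)
  have ker: "ideal {p. \<phi> p = 0} free_alg_ring"
  proof (rule idealI[OF ring_free_alg])
    have "\<ominus>\<^bsub>free_alg_ring\<^esub> p = - p" for p :: "(3, 'k) free_alg"
      using abelian_group.minus_equality[OF ring.is_abelian_group[OF ring_free_alg], of "- p" p] by simp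
    then show "subgroup {p. \<phi> p = 0} (add_monoid free_alg_ring)"
      using \<phi> \<phi>(3)[of 0] by (unfold_locales) (auto simp: a_inv_def)
  qed (simp_all add: \<phi>)
  have rel: "clifford_relations f \<subseteq> {p. \<phi> p = 0}"
  proof
    fix r assume "r \<in> clifford_relations f"
    then obtain \<alpha> where r: "r = (\<Sum>i\<in>UNIV. fa_const (\<alpha> i) * fa_gen i) ^ 3 - fa_const (mpoly_eval f \<alpha>)"
      unfolding clifford_relations_def by blast
    have "\<phi> r = (\<alpha> 0 *# A0 + \<alpha> 1 *# A1 + \<alpha> 2 *# A2) ^ 3 - mpoly_eval f \<alpha> *# 1"
      unfolding r \<phi>_def
      by (simp add: fa_hom_minus fa_hom_power fa_hom_add fa_hom_mult fa_hom_const sum_three sm_simps)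
    also have "\<dots> = 0"
      using T tri_eta[of \<alpha>] by (simp add: T_def triples_def)
    finally show "r \<in> {p. \<phi> p = 0}" by simp
  qed
  have sub: "clifford_ideal f \<subseteq> {p. \<phi> p = 0}"
    unfolding clifford_ideal_def by (rule ring.genideal_minimal[OF ring_free_alg ker rel])
  \<comment> \<open>The value on a coset is read off from a chosen representative; the inclusion of
    the ideal in the kernel makes the choice immaterial.\<close>
  define \<rho> where "\<rho> Q = to_mat (\<phi> (SOME p. p \<in> Q))" for Q
  have \<rho>: "\<rho> (clifford_class f p) = to_mat (\<phi> p)" for p
  proof -
    interpret ideal "clifford_ideal f" free_alg_ring by (rule clifford_ideal)
    have "p \<in> clifford_class f p" using a_rcos_self[of p] by (simp add: clifford_class_def)
    then have "(SOME q. q \<in> clifford_class f p) \<in> clifford_class f p" by (rule someI)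
    then obtain i where "i \<in> clifford_ideal f" "(SOME q. q \<in> clifford_class f p) = i + p"
      by (auto simp: clifford_class_def a_r_coset_def')
    then have "\<phi> (SOME q. q \<in> clifford_class f p) = \<phi> p" using sub by (auto simp: \<phi>)
    then show ?thesis by (simp add: \<rho>_def)
  qed
  have "\<rho> \<in> clifford_rep f 3"
    unfolding clifford_rep_def mem_Collect_eq carrier_clifford
  proof (intro conjI allI ballI)
    show "\<rho> \<in> Ring.ring_hom (clifford_algebra f) (Mat 3)"
    proof (rule ring_hom_memI)
      show "\<rho> \<one>\<^bsub>clifford_algebra f\<^esub> = \<one>\<^bsub>Mat 3\<^esub>"
        by (simp add: clifford_class_simps(4)[symmetric] \<rho> \<phi> ring_mat_simps)
    qed (auto simp: carrier_clifford ring_mat_simps \<rho> \<phi> to_mat_add to_mat_mult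
        clifford_class_simps(2,3)[symmetric])
    fix c x assume "x \<in> range (clifford_class f)"
    then show "\<rho> (clifford_smult f c x) = c \<cdot>\<^sub>m \<rho> x"
      by (auto simp: clifford_smult_class \<rho> \<phi> sm_simps to_mat_smult)
  qed
  moreover have "rep_triple f \<rho> = T"
    by (simp add: rep_triple_def rep_map_def \<rho> T_def) (simp add: \<phi>_def)
  ultimately show ?thesis by blast
qed

section \<open>Equivalence, irreducibility and the number of classes\<close>

lemma clifford_rep_equiv_iff:
  fixes f :: "(3, 'k::comm_ring_1) mpoly"
  shows "(\<rho>1, \<rho>2) \<in> clifford_rep_equiv f 3 \<longleftrightarrow> \<rho>1 \<in> clifford_rep f 3 \<and> \<rho>2 \<in> clifford_rep f 3 \<and>
    conj3 (rep_triple f \<rho>1) (rep_triple f \<rho>2)"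
proof (cases "\<rho>1 \<in> clifford_rep f 3 \<and> \<rho>2 \<in> clifford_rep f 3")
  case True
  then have rep: "\<rho>1 \<in> clifford_rep f 3" "\<rho>2 \<in> clifford_rep f 3" by auto
  have "(\<exists>\<theta> \<theta>'. \<forall>x\<in>carrier (clifford_algebra f). similar_mat_wit (\<rho>1 x) (\<rho>2 x) \<theta> \<theta>') \<longleftrightarrow>
    conj3 (rep_triple f \<rho>1) (rep_triple f \<rho>2)"
  proof
    assume "\<exists>\<theta> \<theta>'. \<forall>x\<in>carrier (clifford_algebra f). similar_mat_wit (\<rho>1 x) (\<rho>2 x) \<theta> \<theta>'"
    then obtain \<theta> \<theta>' where w: "\<And>p. similar_mat_wit (\<rho>1 (clifford_class f p)) (\<rho>2 (clifford_class f p)) \<theta> \<theta>'"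
      unfolding carrier_clifford by blast
    have \<theta>: "\<theta> \<in> carrier_mat 3 3" "\<theta>' \<in> carrier_mat 3 3" "\<theta> * \<theta>' = 1\<^sub>m 3" "\<theta>' * \<theta> = 1\<^sub>m 3"
      and eq: "\<rho>1 (clifford_class f p) = \<theta> * \<rho>2 (clifford_class f p) * \<theta>'" for p
      using w[of 0] w[of p] rep_carrier[OF rep(1), of 0] unfolding similar_mat_wit_def Let_def by auto
    have "from_mat \<theta> * from_mat \<theta>' = 1" "from_mat \<theta>' * from_mat \<theta> = 1"
      using \<theta> by (simp_all flip: from_mat_mult)
    moreover have "rep_map f \<rho>1 p = from_mat \<theta> * rep_map f \<rho>2 p * from_mat \<theta>'" for p
      unfolding rep_map_def eq using \<theta> rep_carrier[OF rep(2), of p] by (simp add: from_mat_mult mult.assoc)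
    ultimately show "conj3 (rep_triple f \<rho>1) (rep_triple f \<rho>2)"
      unfolding conj3_def rep_triple_def by (intro exI[of _ "from_mat \<theta>"] exI[of _ "from_mat \<theta>'"]) simp
  next
    assume "conj3 (rep_triple f \<rho>1) (rep_triple f \<rho>2)"
    then obtain \<theta> \<theta>' where \<theta>: "\<theta> * \<theta>' = 1" "\<theta>' * \<theta> = 1"
      and "rep_map f \<rho>1 (fa_gen 0) = \<theta> * rep_map f \<rho>2 (fa_gen 0) * \<theta>'"
      "rep_map f \<rho>1 (fa_gen 1) = \<theta> * rep_map f \<rho>2 (fa_gen 1) * \<theta>'"
      "rep_map f \<rho>1 (fa_gen 2) = \<theta> * rep_map f \<rho>2 (fa_gen 2) * \<theta>'"
      unfolding conj3_def rep_triple_def by auto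
    then have "\<forall>i. rep_map f \<rho>1 (fa_gen i) = \<theta> * rep_map f \<rho>2 (fa_gen i) * \<theta>'"
      unfolding all_three by blast
    then have conj: "rep_map f \<rho>1 p = \<theta> * rep_map f \<rho>2 p * \<theta>'" for p
      using fa_hom_conj[OF \<theta>(2,1)] by (simp add: rep_map_eq[OF rep(1), of p] rep_map_eq[OF rep(2), of p])
    have "similar_mat_wit (\<rho>1 (clifford_class f p)) (\<rho>2 (clifford_class f p)) (to_mat \<theta>) (to_mat \<theta>')" for p
      unfolding similar_mat_wit_def rep_to_mat[OF rep(1)] rep_to_mat[OF rep(2)] Let_def
      using \<theta> by (simp add: conj flip: to_mat_mult)
    then show "\<exists>\<theta> \<theta>'. \<forall>x\<in>carrier (clifford_algebra f). similar_mat_wit (\<rho>1 x) (\<rho>2 x) \<theta> \<theta>'"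
      unfolding carrier_clifford by blast
  qed
  with rep show ?thesis unfolding clifford_rep_equiv_def by simp
next
  case False
  then show ?thesis unfolding clifford_rep_equiv_def by auto
qed

text \<open>A subalgebra of \<open>Mat 3\<close> containing the image is pulled back along
  \<open>to_mat\<close>; the result contains the triple and is therefore everything.\<close>

lemma generating_irreducible:
  fixes f :: "(3, 'k::comm_ring_1) mpoly"
  assumes rep: "\<rho> \<in> clifford_rep f 3" and gen: "generating (rep_triple f \<rho>)"
  shows "\<rho> \<in> irreducible_clifford_rep f 3"
proof -
  have "mat_algebra_generated 3 (\<rho> ` carrier (clifford_algebra f)) = carrier_mat 3 3"
  proof
    have "mat_subalgebra 3 (carrier_mat 3 3 :: 'k mat set)"
    proof -
      have "subring (carrier (Mat 3 :: 'k mat ring)) (Mat 3)"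
        by (rule ring.carrier_is_subring[OF ring_mat])
      then show ?thesis by (simp add: mat_subalgebra_def ring_mat_simps)
    qed
    moreover have "\<rho> ` carrier (clifford_algebra f) \<subseteq> carrier_mat 3 3"
      using rep_carrier[OF rep] by (auto simp: carrier_clifford)
    ultimately show "mat_algebra_generated 3 (\<rho> ` carrier (clifford_algebra f)) \<subseteq> carrier_mat 3 3"
      unfolding mat_algebra_generated_def by blast
    show "carrier_mat 3 3 \<subseteq> mat_algebra_generated 3 (\<rho> ` carrier (clifford_algebra f))"
      unfolding mat_algebra_generated_def
    proof (intro Inter_greatest)
      fix S assume "S \<in> {S. mat_subalgebra 3 S \<and> \<rho> ` carrier (clifford_algebra f) \<subseteq> S}"
      then have sub: "subring S (Mat 3)" and sm: "\<And>c A. A \<in> S \<Longrightarrow> c \<cdot>\<^sub>m A \<in> S" and im: "\<And>p. \<rho> (clifford_class f p) \<in> S"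
        by (auto simp: mat_subalgebra_def carrier_clifford)
      note S = subringE[OF sub, unfolded ring_mat_simps]
      define S' where "S' = {M. to_mat M \<in> S}"
      have "1 \<in> S' \<and> (\<forall>M\<in>S'. \<forall>N\<in>S'. M + N \<in> S' \<and> M * N \<in> S') \<and> (\<forall>c. \<forall>M\<in>S'. c *# M \<in> S') \<and>
        fst (rep_triple f \<rho>) \<in> S' \<and> fst (snd (rep_triple f \<rho>)) \<in> S' \<and> snd (snd (rep_triple f \<rho>)) \<in> S'"
        using S(3,6,7) sm im
        by (simp add: S'_def to_mat_add to_mat_mult to_mat_smult rep_triple_def flip: rep_to_mat[OF rep])
      then have "S' = UNIV" using gen unfolding generating_def by blast
      show "carrier_mat 3 3 \<subseteq> S"
      proof
        fix A :: "'k mat" assume "A \<in> carrier_mat 3 3"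
        moreover have "from_mat A \<in> S'" using \<open>S' = UNIV\<close> by simp
        ultimately show "A \<in> S" by (simp add: S'_def)
      qed
    qed
  qed
  with rep show ?thesis by (simp add: irreducible_clifford_rep_def)
qed

text \<open>Equivalence of two elements of \<open>S\<close> depends only on their values under
  \<open>h\<close>. Classes of representations, where many functions stand for one homomorphism, can
  therefore be counted by representatives among the triples.\<close>

lemma card_quotient_transversal:
  assumes E: "\<And>x y. (x, y) \<in> E \<longleftrightarrow> x \<in> S \<and> y \<in> S \<and> P (h x) (h y)"
    and refl: "\<And>t. P t t" and sym: "\<And>s t. P s t \<Longrightarrow> P t s" and trans: "\<And>s t u. P s t \<Longrightarrow> P t u \<Longrightarrow> P s u"
    and R: "R \<subseteq> h ` S" "\<And>x. x \<in> S \<Longrightarrow> \<exists>r\<in>R. P (h x) r" "\<And>r s. r \<in> R \<Longrightarrow> s \<in> R \<Longrightarrow> P r s \<Longrightarrow> r = s"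
  shows "card (S // E) = card R"
proof -
  define c where "c r = {y \<in> S. P r (h y)}" for r
  have "inj_on c R"
  proof (rule inj_onI)
    fix r s assume rs: "r \<in> R" "s \<in> R" "c r = c s"
    obtain x where "x \<in> S" "r = h x" using R(1) rs(1) by blast
    then have "x \<in> c s" using refl rs(3) by (auto simp: c_def)
    then show "r = s" using R(3)[OF rs(1,2)] sym \<open>r = h x\<close> by (auto simp: c_def)
  qed
  moreover have "c ` R = S // E"
  proof
    show "c ` R \<subseteq> S // E"
    proof
      fix Q assume "Q \<in> c ` R"
      then obtain x where "x \<in> S" "Q = c (h x)" using R(1) by blast
      then have "Q = E `` {x}" by (auto simp: c_def E)
      then show "Q \<in> S // E" using \<open>x \<in> S\<close> by (auto simp: quotient_def)
    qed
    show "S // E \<subseteq> c ` R"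
    proof
      fix Q assume "Q \<in> S // E"
      then obtain x where x: "x \<in> S" "Q = E `` {x}" by (auto simp: quotient_def)
      obtain r where r: "r \<in> R" "P (h x) r" using R(2)[OF x(1)] by blast
      have *: "P (h x) t \<longleftrightarrow> P r t" for t using r(2) sym trans by blast
      have "Q = {y \<in> S. P (h x) (h y)}" using x by (auto simp: E)
      then have "Q = c r" unfolding c_def by (simp only: *)
      then show "Q \<in> c ` R" using r(1) by blast
    qed
  qed
  ultimately show ?thesis using card_image by metis
qed

theorem corollary3p2:
  fixes f :: "(3, 'k::{alg_closed_field, field_char_0}) mpoly"
  assumes "form_of_degree 3 f" and "nondegenerate f"
  shows "card (irreducible_clifford_rep f 3 // clifford_rep_equiv f 3) = 72"
proof -
  let ?F = "\<lambda>x y z. mpoly_eval f (tri x y z)"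
  have 72: "seventy_two_classes ?F"
    by (intro seventy_two_classes_smooth_cubic smooth_cubic_mpoly_eval assms)
  from 72 have gen: "\<forall>T\<in>triples ?F. generating T"
    and "\<exists>R \<subseteq> triples ?F. card R = 72 \<and> (\<forall>T\<in>triples ?F. \<exists>r\<in>R. conj3 T r) \<and>
      (\<forall>r\<in>R. \<forall>s\<in>R. conj3 r s \<longrightarrow> r = s)"
    unfolding seventy_two_classes_def by (rule conjunct1, rule conjunct2)
  then obtain R where R: "R \<subseteq> triples ?F" "card R = 72"
    "\<forall>T\<in>triples ?F. \<exists>r\<in>R. conj3 T r" "\<forall>r\<in>R. \<forall>s\<in>R. conj3 r s \<longrightarrow> r = s"
    by (elim exE conjE)
  have "\<rho> \<in> irreducible_clifford_rep f 3" if "\<rho> \<in> clifford_rep f 3" for \<rho>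
    by (rule generating_irreducible[OF that bspec[OF gen rep_triple_triples[OF that]]])
  \<comment> \<open>Every 3-dimensional representation is irreducible, so the quotient is that of
    all representations.\<close>
  then have "irreducible_clifford_rep f 3 = clifford_rep f 3"
    by (auto simp: irreducible_clifford_rep_def)
  moreover have "card (clifford_rep f 3 // clifford_rep_equiv f 3) = card R"
  proof (rule card_quotient_transversal[OF clifford_rep_equiv_iff conj3_refl conj3_sym conj3_trans])
    show "R \<subseteq> rep_triple f ` clifford_rep f 3"
    proof
      fix r assume "r \<in> R"
      then show "r \<in> rep_triple f ` clifford_rep f 3" using triple_is_rep R(1) by blast
    qed
    show "\<exists>r\<in>R. conj3 (rep_triple f \<rho>) r" if "\<rho> \<in> clifford_rep f 3" for \<rho>
      by (rule bspec[OF R(3) rep_triple_triples[OF that]])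
    show "r = s" if "r \<in> R" "s \<in> R" "conj3 r s" for r s
      using R(4) that by blast
  qed
  ultimately show ?thesis using R(2) by simp
qed

end
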